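(* Let $H$ be a graph and $d$ a positive integer such that for every $r\leq c^*(H)$, for every $F=L_1\times\dots\times L_r$ where each $L_i\subseteq V(H)$ is an incomparable set, and for every $L\subseteq V(H)$, every $S\in F$ which does not have a common neighbor in $L$ can be forbidden by polynomials of degree $d$ with respect to $(F,L)$. Then List $H$-Coloring parameterized by the size $k$ of a minimum vertex cover of the input graph has a kernel with $\mathcal{O}(k^d+k^2)$ vertices and edges.
   Context: Graphs may have loops; $N(v)$ is the neighborhood of $v$; vertices $u,v$ are incomparable if neither $N(u)\subseteq N(v)$ nor $N(v)\subseteq N(u)$, and a set is incomparable if its vertices are pairwise incomparable. A sequence/set $S$ has a common neighbor in $L$ if some vertex of $L$ is adjacent to every element of $S$. $c^*(H)$ is the maximum over $L\subseteq V(H)$ of the largest size of an inclusion-minimal $S\subseteq V(H)$ without a common neighbor in $L$. List $H$-Coloring: given $G$ and lists $\mathcal{L}\colon V(G)\to 2^{V(H)}$, decide whether there is an edge-preserving $\varphi\colon V(G)\to V(H)$ with $\varphi(v)\in\mathcal{L}(v)$ for all $v$; a kernel with $f(k)$ vertices and edges is a polynomial-time algorithm producing an equivalent instance of at most $f(k)$ vertices and edges. Polynomial forbidding: for a finite set $X$, introduce Boolean variables $y_{v,u}$ ($v\in X$, $u\in V(H)$), collected in a vector $\mathbf{y}$; $\mathbf{y}$ is a choice assignment if $\sum_{u\in V(H)}y_{v,u}=1$ for every $v\in X$. Given incomparable $L_1,\dots,L_r,L\subseteq V(H)$, $F=L_1\times\dots\times L_r$, and $S=(s_1,\dots,s_r)\in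 F$ with $\bigcap_i N(s_i)\cap L=\emptyset$, $S$ can be forbidden (on distinct vertices $v_1,\dots,v_r\in X$) by polynomials of degree $d$ with respect to $(F,L)$ if there is a polynomial $p$ over GF(2) of degree at most $d$ in $\mathbf{y}$ such that for every choice assignment $\mathbf{y}$, letting $s_\ell'$ be the unique vertex with $y_{v_\ell,s_\ell'}=1$ and $S'=(s_1',\dots,s_r')\in F$: if $S'=S$ then $p(\mathbf{y})\neq0$, and if $S'$ has a common neighbor in $L$ then $p(\mathbf{y})=0$. The hypothesis of the theorem is required for every finite $X$ and every choice of distinct $v_1,\dots,v_r\in X$. *)

theory Defs
  imports
    Complex_Main
    "HOL-Library.Landau_Symbols"
    "HOL-Library.Poly_Mapping"
    "HOL-Library.Z2"
    "HOL-Computational_Algebra.Polynomial"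
begin

section \<open>Graphs\<close>

text \<open>Finite undirected graphs without parallel edges. A loop at \<open>v\<close> is the edge \<open>{v, v} = {v}\<close>.\<close>

record 'a graph =
  verts :: "'a set"
  edges :: "'a set set"

definition wf_graph :: "'a graph \<Rightarrow> bool" where
  "wf_graph G \<longleftrightarrow> finite (verts G) \<and> (\<forall>e\<in>edges G. \<exists>u\<in>verts G. \<exists>v\<in>verts G. e = {u, v})"

definition adj :: "'a graph \<Rightarrow> 'a \<Rightarrow> 'a \<Rightarrow> bool" where
  "adj G u v \<longleftrightarrow> {u, v} \<in> edges G"

definition nbhd :: "'a graph \<Rightarrow> 'a \<Rightarrow> 'a set" where
  "nbhd G v = {u. adj G v u}"

definition incomparable_set :: "'a graph \<Rightarrow> 'a set \<Rightarrow> bool" where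
  "incomparable_set G A \<longleftrightarrow>
     (\<forall>u\<in>A. \<forall>v\<in>A. u \<noteq> v \<longrightarrow> \<not> nbhd G u \<subseteq> nbhd G v \<and> \<not> nbhd G v \<subseteq> nbhd G u)"

definition has_common_nbr :: "'a graph \<Rightarrow> 'a set \<Rightarrow> 'a set \<Rightarrow> bool" where
  "has_common_nbr G L S \<longleftrightarrow> (\<exists>w\<in>L. \<forall>s\<in>S. adj G w s)"

definition minimal_no_common_nbr :: "'a graph \<Rightarrow> 'a set \<Rightarrow> 'a set \<Rightarrow> bool" where
  "minimal_no_common_nbr G L S \<longleftrightarrow>
     S \<subseteq> verts G \<and> \<not> has_common_nbr G L S \<and> (\<forall>T. T \<subset> S \<longrightarrow> has_common_nbr G L T)"

text \<open>The set below is never empty: for \<open>L = {}\<close> the set \<open>S = {}\<close> is admissible.\<close>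

definition c_star :: "'a graph \<Rightarrow> nat" where
  "c_star H = Max {card S | L S. L \<subseteq> verts H \<and> minimal_no_common_nbr H L S}"

definition vertex_cover :: "'a graph \<Rightarrow> 'a set \<Rightarrow> bool" where
  "vertex_cover G C \<longleftrightarrow> C \<subseteq> verts G \<and> (\<forall>e\<in>edges G. e \<inter> C \<noteq> {})"

definition vc_number :: "'a graph \<Rightarrow> nat" where
  "vc_number G = Min {card C | C. vertex_cover G C}"

section \<open>List colorings\<close>

definition list_instance :: "'h graph \<Rightarrow> 'a graph \<Rightarrow> ('a \<Rightarrow> 'h set) \<Rightarrow> bool" where
  "list_instance H G \<L> \<longleftrightarrow> wf_graph G \<and> (\<forall>v\<in>verts G. \<L> v \<subseteq> verts H)"

definition list_colorable :: "'h graph \<Rightarrow> 'a graph \<Rightarrow> ('a \<Rightarrow> 'h set) \<Rightarrow> bool" where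
  "list_colorable H G \<L> \<longleftrightarrow>
     (\<exists>\<phi>. (\<forall>v\<in>verts G. \<phi> v \<in> verts H \<and> \<phi> v \<in> \<L> v) \<and>
          (\<forall>u\<in>verts G. \<forall>v\<in>verts G. adj G u v \<longrightarrow> adj H (\<phi> u) (\<phi> v)))"

section \<open>Polynomial forbidding\<close>

text \<open>Multivariate polynomials over GF(2): a finitely supported map from monomials to
  coefficients, a monomial being a finitely supported map from variables to exponents.
  The variable \<open>(v, u)\<close> stands for \<open>y\<^bsub>v,u\<^esub>\<close>.\<close>

type_synonym 'x mpoly2 = "('x \<Rightarrow>\<^sub>0 nat) \<Rightarrow>\<^sub>0 bit"

definition mp_in_vars :: "'x set \<Rightarrow> 'x mpoly2 \<Rightarrow> bool" where
  "mp_in_vars V p \<longleftrightarrow> (\<forall>m\<in>Poly_Mapping.keys p. Poly_Mapping.keys m \<subseteq> V)"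

definition mp_degree_le :: "nat \<Rightarrow> 'x mpoly2 \<Rightarrow> bool" where
  "mp_degree_le d p \<longleftrightarrow>
     (\<forall>m\<in>Poly_Mapping.keys p. (\<Sum>x\<in>Poly_Mapping.keys m. Poly_Mapping.lookup m x) \<le> d)"

definition mp_eval :: "('x \<Rightarrow> bit) \<Rightarrow> 'x mpoly2 \<Rightarrow> bit" where
  "mp_eval a p =
     (\<Sum>m\<in>Poly_Mapping.keys p.
        Poly_Mapping.lookup p m * (\<Prod>x\<in>Poly_Mapping.keys m. a x ^ Poly_Mapping.lookup m x))"

definition choice_assignment :: "'h graph \<Rightarrow> 'v set \<Rightarrow> ('v \<times> 'h \<Rightarrow> bool) \<Rightarrow> bool" where
  "choice_assignment H X y \<longleftrightarrow> (\<forall>v\<in>X. (\<Sum>u\<in>verts H. of_bool (y (v, u))) = (1::nat))"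

definition chosen :: "'h graph \<Rightarrow> ('v \<times> 'h \<Rightarrow> bool) \<Rightarrow> 'v \<Rightarrow> 'h" where
  "chosen H y v = (THE u. u \<in> verts H \<and> y (v, u))"

text \<open>A choice assignment whose chosen tuple lies outside \<open>F\<close> imposes no condition on \<open>p\<close>.\<close>

definition forbids ::
  "'h graph \<Rightarrow> 'v set \<Rightarrow> 'v list \<Rightarrow> 'h list set \<Rightarrow> 'h set \<Rightarrow> 'h list \<Rightarrow> ('v \<times> 'h) mpoly2 \<Rightarrow> bool"
where
  "forbids H X vs F L S p \<longleftrightarrow>
     (\<forall>y. choice_assignment H X y \<longrightarrow>
       (let S' = map (chosen H y) vs; val = mp_eval (\<lambda>x. of_bool (y x)) p in
        S' \<in> F \<longrightarrow>
          (S' = S \<longrightarrow> val \<noteq> 0) \<and> (has_common_nbr H L (set S') \<longrightarrow> val = 0)))"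

definition can_be_forbidden ::
  "'h graph \<Rightarrow> nat \<Rightarrow> 'h list set \<Rightarrow> 'h set \<Rightarrow> 'h list \<Rightarrow> bool" where
  "can_be_forbidden H d F L S \<longleftrightarrow>
     (\<forall>(X :: nat set) vs. finite X \<and> distinct vs \<and> set vs \<subseteq> X \<and> length vs = length S \<longrightarrow>
        (\<exists>p. mp_in_vars (X \<times> verts H) p \<and> mp_degree_le d p \<and> forbids H X vs F L S p))"

section \<open>Polynomial-time algorithms\<close>

text \<open>The model of computation is Jones's WHILE language over binary trees. In contrast to the
  unit-cost measure, reading a variable or a constant is charged the size of the whole tree. Hence
  the size of every value is at most the time spent on producing it, and the model is polynomially
  equivalent to Turing machines for functions as well as for decision problems.\<close>

datatype data = Atom | Pair data data

datatype expr =
    Var nat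
  | Const data
  | PairE expr expr
  | Fst expr
  | Snd expr
  | Eq expr expr

datatype cmd =
    Skip
  | Assign nat expr
  | Seq cmd cmd
  | If expr cmd cmd
  | While expr cmd

type_synonym store = "nat \<Rightarrow> data"

fun dsize :: "data \<Rightarrow> nat" where
  "dsize Atom = 1"
| "dsize (Pair a b) = Suc (dsize a + dsize b)"

fun dfst :: "data \<Rightarrow> data" where
  "dfst Atom = Atom"
| "dfst (Pair a b) = a"

fun dsnd :: "data \<Rightarrow> data" where
  "dsnd Atom = Atom"
| "dsnd (Pair a b) = b"

text \<open>The tree \<open>Atom\<close> represents false and every other tree represents true.\<close>

fun eval_expr :: "expr \<Rightarrow> store \<Rightarrow> data" where
  "eval_expr (Var x) s = s x"
| "eval_expr (Const c) s = c"
| "eval_expr (PairE e f) s = Pair (eval_expr e s) (eval_expr f s)"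
| "eval_expr (Fst e) s = dfst (eval_expr e s)"
| "eval_expr (Snd e) s = dsnd (eval_expr e s)"
| "eval_expr (Eq e f) s = (if eval_expr e s = eval_expr f s then Pair Atom Atom else Atom)"

fun cost_expr :: "expr \<Rightarrow> store \<Rightarrow> nat" where
  "cost_expr (Var x) s = dsize (s x)"
| "cost_expr (Const c) s = dsize c"
| "cost_expr (PairE e f) s = Suc (cost_expr e s + cost_expr f s)"
| "cost_expr (Fst e) s = Suc (cost_expr e s)"
| "cost_expr (Snd e) s = Suc (cost_expr e s)"
| "cost_expr (Eq e f) s = Suc (cost_expr e s + cost_expr f s)"

text \<open>\<open>exec c s t s'\<close>: started in store \<open>s\<close>, command \<open>c\<close> halts after time \<open>t\<close> in store \<open>s'\<close>.\<close>

inductive exec :: "cmd \<Rightarrow> store \<Rightarrow> nat \<Rightarrow> store \<Rightarrow> bool" where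
  Skip: "exec Skip s 1 s"
| Assign: "exec (Assign x e) s (Suc (cost_expr e s)) (s(x := eval_expr e s))"
| Seq: "exec c s t s' \<Longrightarrow> exec c' s' t' s'' \<Longrightarrow> exec (Seq c c') s (Suc (t + t')) s''"
| IfTrue: "eval_expr e s \<noteq> Atom \<Longrightarrow> exec c s t s' \<Longrightarrow>
    exec (If e c c') s (Suc (cost_expr e s + t)) s'"
| IfFalse: "eval_expr e s = Atom \<Longrightarrow> exec c' s t s' \<Longrightarrow>
    exec (If e c c') s (Suc (cost_expr e s + t)) s'"
| WhileFalse: "eval_expr e s = Atom \<Longrightarrow> exec (While e c) s (Suc (cost_expr e s)) s"
| WhileTrue: "eval_expr e s \<noteq> Atom \<Longrightarrow> exec c s t s' \<Longrightarrow> exec (While e c) s' t' s'' \<Longrightarrow>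
    exec (While e c) s (Suc (cost_expr e s + t + t')) s''"

text \<open>Input and output are passed in variable \<open>0\<close>; all other variables are initially \<open>Atom\<close>.\<close>

definition computes_within :: "cmd \<Rightarrow> nat \<Rightarrow> data \<Rightarrow> data \<Rightarrow> bool" where
  "computes_within c b x z \<longleftrightarrow>
     (\<exists>t s. exec c ((\<lambda>_. Atom)(0 := x)) t s \<and> t \<le> b \<and> s 0 = z)"

section \<open>Encoding of instances and kernels\<close>

fun enc_nat :: "nat \<Rightarrow> data" where
  "enc_nat 0 = Atom"
| "enc_nat (Suc n) = Pair Atom (enc_nat n)"

fun enc_list :: "('b \<Rightarrow> data) \<Rightarrow> 'b list \<Rightarrow> data" where
  "enc_list f [] = Atom"
| "enc_list f (x # xs) = Pair (f x) (enc_list f xs)"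

definition enc_edge :: "nat \<times> nat \<Rightarrow> data" where
  "enc_edge e = Pair (enc_nat (fst e)) (enc_nat (snd e))"

text \<open>An instance on \<open>n\<close> vertices has vertex set \<open>{0, \<dots>, n - 1}\<close> and is encoded by the sequence of
  its \<open>n\<close> color lists together with a list of its edges, in any order but without repetitions.
  The colors are written as numbers by means of \<open>num\<close>. Since every vertex and every color list
  contributes to the size of the encoding, unary numbers cause only a polynomial overhead.\<close>

definition encodes ::
  "('h \<Rightarrow> nat) \<Rightarrow> data \<Rightarrow> nat graph \<Rightarrow> (nat \<Rightarrow> 'h set) \<Rightarrow> bool" where
  "encodes num x G \<L> \<longleftrightarrow>
     (\<exists>ls es.
        x = Pair (enc_list (enc_list enc_nat) ls) (enc_list enc_edge es) \<and>
        verts G = {..<length ls} \<and>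
        (\<forall>v<length ls. distinct (ls ! v) \<and> set (ls ! v) = num ` \<L> v) \<and>
        distinct (map (\<lambda>(u, v). {u, v}) es) \<and> edges G = (\<lambda>(u, v). {u, v}) ` set es)"

text \<open>A kernel for List \<open>H\<close>-Coloring parameterized by the minimum size of a vertex cover. The graph
  \<open>H\<close> is fixed, so the algorithm may depend on \<open>H\<close> and on the numbering of its vertices.
  The parameter is not part of the input of the algorithm.\<close>

definition list_coloring_vc_kernel :: "'h graph \<Rightarrow> (nat \<Rightarrow> nat) \<Rightarrow> bool" where
  "list_coloring_vc_kernel H f \<longleftrightarrow>
     (\<forall>num. inj_on num (verts H) \<longrightarrow>
       (\<exists>c (q :: nat poly).
          \<forall>x G \<L>. list_instance H G \<L> \<and> encodes num x G \<L> \<longrightarrow>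
            (\<exists>z G' \<L>'.
               computes_within c (poly q (dsize x)) x z \<and>
               list_instance H G' \<L>' \<and> encodes num z G' \<L>' \<and>
               (list_colorable H G' \<L>' \<longleftrightarrow> list_colorable H G \<L>) \<and>
               card (verts G') + card (edges G') \<le> f (vc_number G))))"

end

theory Submission
  imports Defs "HOL-Library.Multiset"
begin

text \<open>Replacing every list by an incomparable sublist that dominates it and taking the endpoints of a
  greedy maximal matching, we get incomparable lists and a vertex cover \<open>A\<close> of size at most \<open>2k\<close>. A
  coloring of \<open>A\<close> extends to a vertex \<open>w\<close> outside \<open>A\<close> unless an inclusion-minimal set of colors without
  common neighbor in the list of \<open>w\<close> occurs on at most \<open>c\<^sup>*\<close> neighbors of \<open>w\<close>. For each tuple of at most \<open>c\<^sup>*\<close>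
  neighbors this is forbidden by the vanishing of polynomials of degree at most \<open>d\<close> in the \<open>O(k)\<close>
  variables of \<open>A\<close>. Over GF(2) these polynomials span a space of dimension \<open>O(k\<^sup>d)\<close>; for each member of a
  basis chosen among them we keep one new vertex that has the list of \<open>w\<close> and is adjacent to the tuple. If
  a coloring of \<open>A\<close> extends to the new vertices, then the basis vanishes, hence all polynomials vanish,
  and the coloring extends to \<open>G\<close>.

  The polynomial depends only on the lists involved, up to renaming of the variables, so the
  algorithm finds it in a finite table. Monomials are words, with repetitions and in any order,
  which increases their number only by a constant factor. Polynomial running time is shown by
  closing the computable functions under programming constructs, the essential one being
  iteration over a list with an accumulator of polynomial size.\<close>

section \<open>Functions computable in polynomial time\<close>

text \<open>Incomparability is enforced because forbidding is granted only for incomparable factors;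
  it costs nothing, since a dominated color can be exchanged for a dominating one. A minimum cover
  is hard to find, so a cover of at most twice its size is used, which changes only constants. For a
  tuple of vertices there is one polynomial per color tuple without common neighbor. On colors taken
  from the lists, all of them vanish exactly when the colors have a common neighbor. So a gadget
  amounts to the vanishing of all polynomials of its tuple, and the gadget of one basis row takes
  care of every row with the same origin. Conversely, \<open>G\<close> implies every gadget, because
  the neighbors of the gadget are among those of \<open>w\<close>. Elimination treats words as
  formal symbols, even if two of them denote the same monomial. This is sound because evaluation at
  a coloring is linear on formal sums; only the dimension grows. The term \<open>k^2\<close> pays
  for the edges inside the cover, \<open>k^d\<close> for the gadgets, each of which has one vertex
  and at most \<open>c_star H\<close> edges. For running times the obstacle is size: a loop with a
  polynomial body may still blow up its accumulator.\<close>

lemma poly_nat_mono: "a \<le> b \<Longrightarrow> poly q a \<le> poly q (b::nat)"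
  by (induction q) (auto intro!: add_mono mult_mono)

text \<open>Every tree is read as a list, so that functions on lists are total on trees.\<close>

fun dlist :: "data \<Rightarrow> data list" where
  "dlist Atom = []"
| "dlist (Pair a b) = a # dlist b"

abbreviation encl :: "data list \<Rightarrow> data" where
  "encl \<equiv> enc_list (\<lambda>x. x)"

lemma dlist_encl [simp]: "dlist (encl l) = l"
  by (induction l) auto

lemma encl_dlist [simp]: "encl (dlist x) = x"
  by (induction x) auto

lemma dsize_pos: "0 < dsize x"
  by (cases x) auto

lemma dsize_dfst: "dsize (dfst x) \<le> dsize x"
  by (cases x) auto

lemma dsize_dsnd: "dsize (dsnd x) \<le> dsize x"
  by (cases x) auto

text \<open>Variable \<open>1\<close> holds a stack that is preserved, and nothing is assumed about the initial contents of
  the other variables, so that programs can be run one inside the other.\<close>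

definition ptime :: "(data \<Rightarrow> data) \<Rightarrow> bool" where
  "ptime f \<longleftrightarrow> (\<exists>c q. \<forall>s. \<exists>t s'. exec c s t s' \<and> s' 0 = f (s 0) \<and> s' 1 = s 1 \<and>
     t \<le> poly q (dsize (s 0) + dsize (s 1)) \<and> dsize (f (s 0)) \<le> poly q (dsize (s 0)))"

lemma ptime_computes:
  assumes "ptime f"
  shows "\<exists>c q. \<forall>x. computes_within c (poly q (dsize x)) x (f x)"
proof -
  obtain c q where *: "\<And>s. \<exists>t s'. exec c s t s' \<and> s' 0 = f (s 0) \<and> s' 1 = s 1 \<and>
     t \<le> poly q (dsize (s 0) + dsize (s 1)) \<and> dsize (f (s 0)) \<le> poly q (dsize (s 0))"
    using assms unfolding ptime_def by blast
  \<comment> \<open>The initial stack is \<open>Atom\<close>, of size 1, hence \<open>q\<close> is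
    taken at the input size plus one.\<close>
  have "computes_within c (poly (pcompose q [:1, 1:]) (dsize x)) x (f x)" for x
    using *[of "(\<lambda>_::nat. Atom)(0 := x)"] by (auto simp: computes_within_def poly_pcompose)
  then show ?thesis by blast
qed

text \<open>The size bound is a clause of \<open>ptime\<close>, so that nothing has to be derived
  from running times. It does not mention the stack, hence any store with \<open>x\<close> in
  variable \<open>0\<close> yields it.\<close>

lemma ptime_size:
  assumes "ptime f"
  obtains q where "\<And>x. dsize (f x) \<le> poly q (dsize x)"
proof -
  obtain c q where *: "\<And>s. \<exists>t s'. exec c s t s' \<and> s' 0 = f (s 0) \<and> s' 1 = s 1 \<and>
     t \<le> poly q (dsize (s 0) + dsize (s 1)) \<and> dsize (f (s 0)) \<le> poly q (dsize (s 0))"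
    using assms unfolding ptime_def by blast
  have "dsize (f x) \<le> poly q (dsize x)" for x
    using *[of "\<lambda>_::nat. x"] by auto
  then show ?thesis using that by blast
qed

lemma ptime_expr:
  assumes "\<And>s. eval_expr e s = f (s 0)"
    and "\<And>s. cost_expr e s \<le> poly q (dsize (s 0))"
    and "\<And>s. dsize (f ((s :: store) 0)) \<le> poly q (dsize (s 0))"
  shows "ptime f"
proof -
  have "\<exists>t s'. exec (Assign 0 e) s t s' \<and> s' 0 = f (s 0) \<and> s' 1 = s 1 \<and>
     t \<le> poly ([:1:] + q) (dsize (s 0) + dsize (s 1)) \<and> dsize (f (s 0)) \<le> poly ([:1:] + q) (dsize (s 0))" for s
    using exec.Assign[of 0 e s] assms[of s] poly_nat_mono[of "dsize (s 0)" "dsize (s 0) + dsize (s 1)" q]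
    by (intro exI[of _ "Suc (cost_expr e s)"] exI[of _ "s(0 := eval_expr e s)"]) auto
  then show ?thesis unfolding ptime_def by blast
qed

section \<open>Closure under composition, pairing, branching and tests\<close>

named_theorems ptime_intros

lemma ptime_id [ptime_intros]: "ptime (\<lambda>x. x)"
  by (rule ptime_expr[where e = "Var 0" and q = "[:0, 1:]"]) auto

lemma ptime_const [ptime_intros]: "ptime (\<lambda>x. a)"
  by (rule ptime_expr[where e = "Const a" and q = "[:dsize a:]"]) auto

lemma ptime_dfst_id: "ptime dfst"
  by (rule ptime_expr[where e = "Fst (Var 0)" and q = "[:1, 1:]"]) (auto simp: dsize_dfst le_SucI)

lemma ptime_dsnd_id: "ptime dsnd"
  by (rule ptime_expr[where e = "Snd (Var 0)" and q = "[:1, 1:]"]) (auto simp: dsize_dsnd le_SucI)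

lemma ptime_compose:
  assumes "ptime g" "ptime f"
  shows "ptime (\<lambda>x. g (f x))"
proof -
  obtain cf qf where f: "\<And>s. \<exists>t s'. exec cf s t s' \<and> s' 0 = f (s 0) \<and> s' 1 = s 1 \<and>
     t \<le> poly qf (dsize (s 0) + dsize (s 1)) \<and> dsize (f (s 0)) \<le> poly qf (dsize (s 0))"
    using assms(2) unfolding ptime_def by blast
  obtain cg qg where g: "\<And>s. \<exists>t s'. exec cg s t s' \<and> s' 0 = g (s 0) \<and> s' 1 = s 1 \<and>
     t \<le> poly qg (dsize (s 0) + dsize (s 1)) \<and> dsize (g (s 0)) \<le> poly qg (dsize (s 0))"
    using assms(1) unfolding ptime_def by blast
  \<comment> \<open>The second program sees the value left by the first, of size at most
    \<open>qf\<close>, together with the unchanged stack; the composed polynomial pays for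
    this.\<close>
  define q where "q = [:1:] + qf + pcompose qg (qf + [:0, 1:])"
  have "\<exists>t s'. exec (Seq cf cg) s t s' \<and> s' 0 = g (f (s 0)) \<and> s' 1 = s 1 \<and>
     t \<le> poly q (dsize (s 0) + dsize (s 1)) \<and> dsize (g (f (s 0))) \<le> poly q (dsize (s 0))" for s
  proof -
    let ?n = "dsize (s 0) + dsize (s 1)"
    obtain t s' where 1: "exec cf s t s'" "s' 0 = f (s 0)" "s' 1 = s 1" "t \<le> poly qf ?n"
      "dsize (f (s 0)) \<le> poly qf (dsize (s 0))"
      using f by blast
    obtain t' s'' where 2: "exec cg s' t' s''" "s'' 0 = g (s' 0)" "s'' 1 = s' 1"
      "t' \<le> poly qg (dsize (s' 0) + dsize (s' 1))" "dsize (g (s' 0)) \<le> poly qg (dsize (s' 0))"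
      using g by blast
    have "poly qf (dsize (s 0)) \<le> poly qf ?n"
      by (rule poly_nat_mono) simp
    then have "t' \<le> poly qg (poly qf ?n + ?n)"
      using 1 2(4) by (intro order_trans[OF 2(4)] poly_nat_mono) simp
    then have "Suc (t + t') \<le> poly q ?n"
      using 1 by (simp add: q_def poly_pcompose)
    moreover have "dsize (g (f (s 0))) \<le> poly q (dsize (s 0))"
    proof -
      have "dsize (g (f (s 0))) \<le> poly qg (dsize (f (s 0)))" using 1 2 by simp
      also have "\<dots> \<le> poly qg (poly qf (dsize (s 0)) + dsize (s 0))"
        using 1 by (intro poly_nat_mono) simp
      finally show ?thesis by (simp add: q_def poly_pcompose)
    qed
    ultimately show ?thesis
      using exec.Seq[OF 1(1) 2(1)] 1 2 by auto
  qed
  then show ?thesis unfolding ptime_def by blast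
qed

lemma ptime_dfst [ptime_intros]: "ptime f \<Longrightarrow> ptime (\<lambda>x. dfst (f x))"
  by (rule ptime_compose[OF ptime_dfst_id])

lemma ptime_dsnd [ptime_intros]: "ptime f \<Longrightarrow> ptime (\<lambda>x. dsnd (f x))"
  by (rule ptime_compose[OF ptime_dsnd_id])

lemma exec_exI: "exec c s t s' \<Longrightarrow> P t s' \<Longrightarrow> \<exists>t s'. exec c s t s' \<and> P t s'"
  by blast

text \<open>The input is pushed on the stack while \<open>cf\<close> runs, then exchanged there for
  the first result while \<open>cg\<close> runs. Variable \<open>2\<close> holds a value only
  between the two calls, so it does not matter that they may overwrite it.\<close>

lemma ptime_Pair [ptime_intros]:
  assumes "ptime f" "ptime g"
  shows "ptime (\<lambda>x. Pair (f x) (g x))"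
proof -
  obtain cf qf where f: "\<And>s. \<exists>t s'. exec cf s t s' \<and> s' 0 = f (s 0) \<and> s' 1 = s 1 \<and>
     t \<le> poly qf (dsize (s 0) + dsize (s 1)) \<and> dsize (f (s 0)) \<le> poly qf (dsize (s 0))"
    using assms(1) unfolding ptime_def by blast
  obtain cg qg where g: "\<And>s. \<exists>t s'. exec cg s t s' \<and> s' 0 = g (s 0) \<and> s' 1 = s 1 \<and>
     t \<le> poly qg (dsize (s 0) + dsize (s 1)) \<and> dsize (g (s 0)) \<le> poly qg (dsize (s 0))"
    using assms(2) unfolding ptime_def by blast
  define c where "c = Seq (Assign 1 (PairE (Var 0) (Var 1))) (Seq cf (Seq (Assign 2 (Var 0))
    (Seq (Assign 0 (Fst (Var 1))) (Seq (Assign 1 (PairE (Var 2) (Snd (Var 1)))) (Seq cg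
    (Seq (Assign 0 (PairE (Fst (Var 1)) (Var 0))) (Assign 1 (Snd (Var 1)))))))))"
  \<comment> \<open>\<open>r\<close> bounds the joint size of variables \<open>0\<close> and
    \<open>1\<close> at both calls: the stack additionally holds a copy of the input or the value of
    \<open>f\<close>. The factors 50 below are slack for the assignments.\<close>
  define r :: "nat poly" where "r = [:1, 2:] + qf"
  define q where "q = [:50, 50:] + smult 50 r + pcompose qf r + pcompose qg r + smult 50 (pcompose qg [:0,1:])"
  have "\<exists>t s'. exec c s t s' \<and> s' 0 = Pair (f (s 0)) (g (s 0)) \<and> s' 1 = s 1 \<and>
     t \<le> poly q (dsize (s 0) + dsize (s 1)) \<and> dsize (Pair (f (s 0)) (g (s 0))) \<le> poly q (dsize (s 0))" for s
  proof -
    define n where "n = dsize (s 0) + dsize (s 1)"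
    define s1 where "s1 = s(1 := Pair (s 0) (s 1))"
    have e1: "exec (Assign 1 (PairE (Var 0) (Var 1))) s (Suc (Suc n)) s1"
      using exec.Assign[of 1 "PairE (Var 0) (Var 1)" s] by (simp add: s1_def n_def)
    obtain t2 s2 where 2: "exec cf s1 t2 s2" "s2 0 = f (s 0)" "s2 1 = Pair (s 0) (s 1)"
      "t2 \<le> poly qf (dsize (s1 0) + dsize (s1 1))" "dsize (f (s 0)) \<le> poly qf (dsize (s 0))"
      using f[of s1] by (auto simp: s1_def)
    define s3 where "s3 = s2(2 := f (s 0))"
    have e3: "exec (Assign 2 (Var 0)) s2 (Suc (dsize (f (s 0)))) s3"
      using exec.Assign[of 2 "Var 0" s2] 2 by (simp add: s3_def)
    define s4 where "s4 = s3(0 := s 0)"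
    have e4: "exec (Assign 0 (Fst (Var 1))) s3 (3 + n) s4"
      using exec.Assign[of 0 "Fst (Var 1)" s3] 2
      by (simp add: s4_def s3_def n_def numeral_3_eq_3)
    define s5 where "s5 = s4(1 := Pair (f (s 0)) (s 1))"
    have e5: "exec (Assign 1 (PairE (Var 2) (Snd (Var 1)))) s4 (4 + n + dsize (f (s 0))) s5"
      using exec.Assign[of 1 "PairE (Var 2) (Snd (Var 1))" s4] 2
      by (simp add: s5_def s4_def s3_def n_def eval_nat_numeral add_ac)
    have s50: "s5 0 = s 0" and s51: "s5 1 = Pair (f (s 0)) (s 1)"
      by (auto simp: s5_def s4_def)
    obtain t6 s6 where 6: "exec cg s5 t6 s6" "s6 0 = g (s 0)" "s6 1 = Pair (f (s 0)) (s 1)"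
      "t6 \<le> poly qg (dsize (s5 0) + dsize (s5 1))" "dsize (g (s 0)) \<le> poly qg (dsize (s 0))"
      using g[of s5] s50 s51 by auto
    define s7 where "s7 = s6(0 := Pair (f (s 0)) (g (s 0)))"
    have e7: "exec (Assign 0 (PairE (Fst (Var 1)) (Var 0))) s6
        (4 + dsize (s 1) + dsize (f (s 0)) + dsize (g (s 0))) s7"
      using exec.Assign[of 0 "PairE (Fst (Var 1)) (Var 0)" s6] 6
      by (simp add: s7_def eval_nat_numeral add_ac)
    define s8 where "s8 = s7(1 := s 1)"
    have e8: "exec (Assign 1 (Snd (Var 1))) s7 (3 + dsize (s 1) + dsize (f (s 0))) s8"
      using exec.Assign[of 1 "Snd (Var 1)" s7] 6
      by (simp add: s8_def s7_def eval_nat_numeral add_ac)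
    let ?t = "Suc (Suc (Suc n) + Suc (t2 + Suc (Suc (dsize (f (s 0))) + Suc ((3 + n) + 
       Suc ((4 + n + dsize (f (s 0))) + Suc (t6 + Suc ((4 + dsize (s 1) + dsize (f (s 0)) + dsize (g (s 0)))
        + (3 + dsize (s 1) + dsize (f (s 0))))))))))"
    have ex: "exec c s ?t s8"
      unfolding c_def by (rule exec.Seq[OF e1 exec.Seq[OF 2(1) exec.Seq[OF e3 exec.Seq[OF e4
        exec.Seq[OF e5 exec.Seq[OF 6(1) exec.Seq[OF e7 e8]]]]]]])
    have m1: "poly qf (dsize (s 0)) \<le> poly qf n" "poly qg (dsize (s 0)) \<le> poly qg n"
      by (auto intro!: poly_nat_mono simp: n_def)
    have "t2 \<le> poly qf (poly r n)"
      using 2(4) by (rule order_trans) (auto intro!: poly_nat_mono simp: s1_def r_def n_def simp del: One_nat_def)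
    moreover have "t6 \<le> poly qg (poly r n)"
      using 6(4) by (rule order_trans) (use m1 2(5) in \<open>auto intro!: poly_nat_mono simp: s50 s51 r_def n_def simp del: One_nat_def\<close>)
    ultimately have "?t \<le> poly q n"
      using m1 2(5) 6(5) by (simp add: q_def r_def poly_pcompose n_def)
    moreover have "dsize (Pair (f (s 0)) (g (s 0))) \<le> poly q (dsize (s 0))"
      using 2(5) 6(5) by (simp add: q_def r_def poly_pcompose)
    ultimately show ?thesis
      using ex by (intro exI[of _ ?t] exI[of _ s8]) (auto simp: s8_def s7_def n_def)
  qed
  then show ?thesis unfolding ptime_def by blast
qed

text \<open>These are the two values that \<open>Eq\<close> returns.\<close>

definition dbool :: "bool \<Rightarrow> data" where
  "dbool b = (if b then Pair Atom Atom else Atom)"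

lemma dbool_eq_Atom [simp]: "dbool b = Atom \<longleftrightarrow> \<not> b"
  by (simp add: dbool_def)

text \<open>The test is computed as a pair with a copy of the input by \<open>ptime_Pair\<close>, so
  the input survives for the branch without further work on the stack.\<close>

lemma ptime_If [ptime_intros]:
  assumes "ptime (\<lambda>x. dbool (P x))" "ptime f" "ptime g"
  shows "ptime (\<lambda>x. if P x then f x else g x)"
proof -
  obtain cf qf where f: "\<And>s. \<exists>t s'. exec cf s t s' \<and> s' 0 = f (s 0) \<and> s' 1 = s 1 \<and>
     t \<le> poly qf (dsize (s 0) + dsize (s 1)) \<and> dsize (f (s 0)) \<le> poly qf (dsize (s 0))"
    using assms(2) unfolding ptime_def by blast
  obtain cg qg where g: "\<And>s. \<exists>t s'. exec cg s t s' \<and> s' 0 = g (s 0) \<and> s' 1 = s 1 \<and>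
     t \<le> poly qg (dsize (s 0) + dsize (s 1)) \<and> dsize (g (s 0)) \<le> poly qg (dsize (s 0))"
    using assms(3) unfolding ptime_def by blast
  obtain cp qp where p: "\<And>s. \<exists>t s'. exec cp s t s' \<and> s' 0 = Pair (dbool (P (s 0))) (s 0) \<and> s' 1 = s 1 \<and>
     t \<le> poly qp (dsize (s 0) + dsize (s 1)) \<and>
     dsize (Pair (dbool (P (s 0))) (s 0)) \<le> poly qp (dsize (s 0))"
    using ptime_Pair[OF assms(1) ptime_id] unfolding ptime_def by blast
  define c where "c = Seq cp (Seq (Assign 2 (Fst (Var 0))) (Seq (Assign 0 (Snd (Var 0))) (If (Var 2) cf cg)))"
  define q where "q = [:50, 50:] + qp + qf + qg"
  have "\<exists>t s'. exec c s t s' \<and> s' 0 = (if P (s 0) then f (s 0) else g (s 0)) \<and> s' 1 = s 1 \<and>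
     t \<le> poly q (dsize (s 0) + dsize (s 1)) \<and> 
     dsize (if P (s 0) then f (s 0) else g (s 0)) \<le> poly q (dsize (s 0))" for s
  proof -
    define n where "n = dsize (s 0) + dsize (s 1)"
    obtain t1 s1 where 1: "exec cp s t1 s1" "s1 0 = Pair (dbool (P (s 0))) (s 0)" "s1 1 = s 1"
      "t1 \<le> poly qp n"
      using p[of s] by (auto simp: n_def)
    define m where "m = dsize (dbool (P (s 0)))"
    have m: "m \<le> 3" by (simp add: m_def dbool_def)
    define s2 where "s2 = s1(2 := dbool (P (s 0)))"
    have e2: "exec (Assign 2 (Fst (Var 0))) s1 (3 + m + dsize (s 0)) s2"
      using exec.Assign[of 2 "Fst (Var 0)" s1] 1 by (simp add: s2_def m_def eval_nat_numeral)
    define s3 where "s3 = s2(0 := s 0)"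
    have e3: "exec (Assign 0 (Snd (Var 0))) s2 (3 + m + dsize (s 0)) s3"
      using exec.Assign[of 0 "Snd (Var 0)" s2] 1 by (simp add: s3_def s2_def m_def eval_nat_numeral)
    have s3: "s3 0 = s 0" "s3 1 = s 1" "s3 2 = dbool (P (s 0))"
      using 1 by (auto simp: s3_def s2_def)
    obtain tf sf where F: "exec cf s3 tf sf" "sf 0 = f (s 0)" "sf 1 = s 1"
      "tf \<le> poly qf n" "dsize (f (s 0)) \<le> poly qf (dsize (s 0))"
      using f[of s3] s3 by (auto simp: n_def)
    obtain tg sg where G: "exec cg s3 tg sg" "sg 0 = g (s 0)" "sg 1 = s 1"
      "tg \<le> poly qg n" "dsize (g (s 0)) \<le> poly qg (dsize (s 0))"
      using g[of s3] s3 by (auto simp: n_def)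
    show ?thesis
    proof (cases "P (s 0)")
      case True
      have "exec (If (Var 2) cf cg) s3 (Suc (m + tf)) sf"
        using exec.IfTrue[of "Var 2" s3 cf tf sf cg] F s3 True by (simp add: m_def)
      from exec.Seq[OF 1(1) exec.Seq[OF e2 exec.Seq[OF e3 this]]] have X: "exec c s (Suc (t1 + Suc ((3 + m + dsize (s 0)) + Suc ((3 + m + dsize (s 0)) + Suc (m + tf))))) sf"
        unfolding c_def .
      then show ?thesis
        using True F 1(4) m by (intro exec_exI[OF X]) (auto simp: q_def n_def)
    next
      case False
      have "exec (If (Var 2) cf cg) s3 (Suc (m + tg)) sg"
        using exec.IfFalse[of "Var 2" s3 cg tg sg cf] G s3 False by (simp add: m_def)
      from exec.Seq[OF 1(1) exec.Seq[OF e2 exec.Seq[OF e3 this]]] have X: "exec c s (Suc (t1 + Suc ((3 + m + dsize (s 0)) + Suc ((3 + m + dsize (s 0)) + Suc (m + tg))))) sg"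
        unfolding c_def .
      then show ?thesis
        using False G 1(4) m by (intro exec_exI[OF X]) (auto simp: q_def n_def)
    qed
  qed
  then show ?thesis unfolding ptime_def by blast
qed


lemma ptime_eq [ptime_intros]:
  assumes "ptime f" "ptime g"
  shows "ptime (\<lambda>x. dbool (f x = g x))"
proof -
  have "ptime (\<lambda>x. dbool (dfst x = dsnd x))"
    by (rule ptime_expr[where e = "Eq (Fst (Var 0)) (Snd (Var 0))" and q = "[:5, 3:]"])
      (auto simp: dbool_def)
  from ptime_compose[OF this ptime_Pair[OF assms]] show ?thesis by simp
qed

lemma ptime_not [ptime_intros]:
  assumes "ptime (\<lambda>x. dbool (P x))"
  shows "ptime (\<lambda>x. dbool (\<not> P x))"
proof -
  have "ptime (\<lambda>x. if P x then Atom else Pair Atom Atom)"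
    by (intro ptime_intros assms)
  moreover have "dbool (\<not> P x) = (if P x then Atom else Pair Atom Atom)" for x
    by (simp add: dbool_def)
  ultimately show ?thesis by simp
qed

lemma ptime_disj [ptime_intros]:
  assumes "ptime (\<lambda>x. dbool (P x))" "ptime (\<lambda>x. dbool (Q x))"
  shows "ptime (\<lambda>x. dbool (P x \<or> Q x))"
proof -
  have "ptime (\<lambda>x. if P x then Pair Atom Atom else dbool (Q x))"
    by (intro ptime_intros assms)
  moreover have "dbool (P x \<or> Q x) = (if P x then Pair Atom Atom else dbool (Q x))" for x
    by (simp add: dbool_def)
  ultimately show ?thesis by simp
qed

lemma ptime_conj [ptime_intros]:
  assumes "ptime (\<lambda>x. dbool (P x))" "ptime (\<lambda>x. dbool (Q x))"
  shows "ptime (\<lambda>x. dbool (P x \<and> Q x))"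
proof -
  have "ptime (\<lambda>x. if P x then dbool (Q x) else Atom)"
    by (intro ptime_intros assms)
  moreover have "dbool (P x \<and> Q x) = (if P x then dbool (Q x) else Atom)" for x
    by (simp add: dbool_def)
  ultimately show ?thesis by simp
qed

section \<open>Iteration over a list\<close>

lemma dsize_encl_append: "dsize (encl (ys @ zs)) + 1 = dsize (encl ys) + dsize (encl zs)"
  by (induction ys) auto

lemma dsize_mem: "e \<in> set (dlist x) \<Longrightarrow> dsize e < dsize x"
  by (induction x) auto

lemma length_dlist: "length (dlist x) < dsize x"
  by (induction x) auto

text \<open>The loop works on the triple of context, accumulator and remaining list; the context and the
  remaining list are saved on the stack while the body runs.\<close>

definition fold_body :: "cmd \<Rightarrow> cmd" where
  "fold_body c =
     Seq (Assign 1 (PairE (PairE (Fst (Var 0)) (Snd (Snd (Snd (Var 0))))) (Var 1)))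
    (Seq (Assign 0 (PairE (Fst (Var 0)) (PairE (Fst (Snd (Var 0))) (Fst (Snd (Snd (Var 0)))))))
    (Seq c
    (Seq (Assign 0 (PairE (Fst (Fst (Var 1))) (PairE (Var 0) (Snd (Fst (Var 1))))))
         (Assign 1 (Snd (Var 1))))))"

lemma exec_fold_body:
  fixes qg :: "nat poly"
  assumes g: "\<And>s. \<exists>t s'. exec c s t s' \<and> s' 0 = g (s 0) \<and> s' 1 = s 1 \<and>
     t \<le> poly qg (dsize (s 0) + dsize (s 1)) \<and> dsize (g (s 0)) \<le> poly qg (dsize (s 0))"
    and s: "s 0 = Pair x (Pair a (Pair e r))"
    and M: "dsize (Pair x (Pair a (Pair e r))) + dsize (s 1) \<le> M" "dsize (g (Pair x (Pair a e))) \<le> M"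
  shows "\<exists>t s'. exec (fold_body c) s t s' \<and> s' 0 = Pair x (Pair (g (Pair x (Pair a e))) r) \<and>
     s' 1 = s 1 \<and> t \<le> 50 + 50 * M + poly qg (3 * M + 3)"
proof -
  define s1 where "s1 = s(1 := Pair (Pair x r) (s 1))"
  let ?N = "dsize (s 0)"
  let ?e1 = "PairE (PairE (Fst (Var 0)) (Snd (Snd (Snd (Var 0))))) (Var 1)"
  have e1: "exec (Assign 1 ?e1) s (Suc (cost_expr ?e1 s)) s1"
    using exec.Assign[of 1 ?e1 s] s by (simp add: s1_def)
  define s2 where "s2 = s1(0 := Pair x (Pair a e))"
  let ?e2 = "PairE (Fst (Var 0)) (PairE (Fst (Snd (Var 0))) (Fst (Snd (Snd (Var 0)))))"
  have e2: "exec (Assign 0 ?e2) s1 (Suc (cost_expr ?e2 s1)) s2"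
    using exec.Assign[of 0 ?e2 s1] s by (simp add: s1_def s2_def)
  have s2: "s2 0 = Pair x (Pair a e)" "s2 1 = Pair (Pair x r) (s 1)"
    by (auto simp: s2_def s1_def)
  obtain t3 s3 where 3: "exec c s2 t3 s3" "s3 0 = g (Pair x (Pair a e))" "s3 1 = Pair (Pair x r) (s 1)"
    "t3 \<le> poly qg (dsize (s2 0) + dsize (s2 1))"
    using g[of s2] s2 by auto
  let ?e4 = "PairE (Fst (Fst (Var 1))) (PairE (Var 0) (Snd (Fst (Var 1))))"
  define s4 where "s4 = s3(0 := Pair x (Pair (g (Pair x (Pair a e))) r))"
  have e4: "exec (Assign 0 ?e4) s3 (Suc (cost_expr ?e4 s3)) s4"
    using exec.Assign[of 0 ?e4 s3] 3 by (simp add: s4_def)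
  define s5 where "s5 = s4(1 := s 1)"
  have e5: "exec (Assign 1 (Snd (Var 1))) s4 (Suc (cost_expr (Snd (Var 1)) s4)) s5"
    using exec.Assign[of 1 "Snd (Var 1)" s4] 3 by (simp add: s4_def s5_def)
  have "poly qg (dsize (s2 0) + dsize (s2 1)) \<le> poly qg (3 * M + 3)"
    using M by (intro poly_nat_mono) (simp add: s2 del: One_nat_def)
  then have "t3 \<le> poly qg (3 * M + 3)" using 3(4) by simp
  then show ?thesis
    unfolding fold_body_def
    using M
    by (intro exec_exI[OF exec.Seq[OF e1 exec.Seq[OF e2 exec.Seq[OF 3(1) exec.Seq[OF e4 e5]]]]]) (auto simp: s5_def s4_def s s1_def 3 3[unfolded One_nat_def])
qed

text \<open>The size condition speaks about all prefixes, because that form is inherited by the tail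
  of the list with the next accumulator. The summand 2 counts the two pair nodes of the
  triple.\<close>

lemma exec_fold_loop:
  fixes qg :: "nat poly"
  assumes g: "\<And>s. \<exists>t s'. exec c s t s' \<and> s' 0 = g (s 0) \<and> s' 1 = s 1 \<and>
     t \<le> poly qg (dsize (s 0) + dsize (s 1)) \<and> dsize (g (s 0)) \<le> poly qg (dsize (s 0))"
    and "s 0 = Pair x (Pair a (encl l))"
    and "\<And>ys zs. l = ys @ zs \<Longrightarrow> dsize (foldl (\<lambda>a e. g (Pair x (Pair a e))) a ys) \<le> B"
    and "dsize x + B + dsize (encl l) + dsize (s 1) + 2 \<le> M"
  shows "\<exists>t s'. exec (While (Snd (Snd (Var 0))) (fold_body c)) s t s' \<and>
     s' 0 = Pair x (Pair (foldl (\<lambda>a e. g (Pair x (Pair a e))) a l) Atom) \<and> s' 1 = s 1 \<and>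
     t \<le> (length l + 1) * (60 + 60 * M + poly qg (3 * M + 3))"
  using assms(2-)
proof (induction l arbitrary: s a)
  case Nil
  have "dsize a \<le> B" using Nil(2)[of "[]" "[]"] by simp
  then show ?case
    using Nil by (intro exec_exI[OF exec.WhileFalse]) auto
next
  case (Cons e l)
  let ?a = "g (Pair x (Pair a e))"
  have a: "dsize a \<le> B" using Cons.prems(2)[of "[]" "e # l"] by simp
  have a': "dsize ?a \<le> B" using Cons.prems(2)[of "[e]" "l"] by simp
  obtain t1 s1 where 1: "exec (fold_body c) s t1 s1" "s1 0 = Pair x (Pair ?a (encl l))"
    "s1 1 = s 1" "t1 \<le> 50 + 50 * M + poly qg (3 * M + 3)"
    using exec_fold_body[OF g, of s x a e "encl l" M] Cons.prems a a' by auto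
  have pre: "dsize (foldl (\<lambda>a e. g (Pair x (Pair a e))) ?a ys) \<le> B" if "l = ys @ zs" for ys zs
    using Cons.prems(2)[of "e # ys" zs] that by simp
  have "dsize x + B + dsize (encl l) + dsize (s1 1) + 2 \<le> M"
    using Cons.prems(3) 1 by simp
  then have "\<exists>t s'. exec (While (Snd (Snd (Var 0))) (fold_body c)) s1 t s' \<and>
     s' 0 = Pair x (Pair (foldl (\<lambda>a e. g (Pair x (Pair a e))) ?a l) Atom) \<and> s' 1 = s1 1 \<and>
     t \<le> (length l + 1) * (60 + 60 * M + poly qg (3 * M + 3))"
    by (intro Cons.IH) (use 1 pre in auto)
  then obtain t2 s2 where 2:
    "exec (While (Snd (Snd (Var 0))) (fold_body c)) s1 t2 s2"
    "s2 0 = Pair x (Pair (foldl (\<lambda>a e. g (Pair x (Pair a e))) ?a l) Atom)" "s2 1 = s1 1"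
    "t2 \<le> (length l + 1) * (60 + 60 * M + poly qg (3 * M + 3))"
    by blast
  have X: "exec (While (Snd (Snd (Var 0))) (fold_body c)) s
     (Suc (cost_expr (Snd (Snd (Var 0))) s + t1 + t2)) s2"
    by (rule exec.WhileTrue[OF _ 1(1) 2(1)]) (simp add: Cons.prems)
  moreover have "cost_expr (Snd (Snd (Var 0))) s \<le> M + 3"
    using Cons.prems a by simp
  ultimately show ?case
    using 1 2 by (intro exec_exI[OF X]) auto
qed

text \<open>A polynomial step may square its accumulator each time, so closure of
  \<open>ptime\<close> under iteration fails without the bound \<open>B\<close> on all intermediate
  accumulators. With it, every round costs polynomial time, and there are fewer rounds than the size
  of the list.\<close>

lemma ptime_foldl:
  assumes "ptime (\<lambda>z. g (dfst z) (dfst (dsnd z)) (dsnd (dsnd z)))" "ptime i" "ptime l"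
    and B: "\<And>x ys zs. dlist (l x) = ys @ zs \<Longrightarrow> dsize (foldl (g x) (i x) ys) \<le> poly B (dsize x)"
  shows "ptime (\<lambda>x. foldl (g x) (i x) (dlist (l x)))"
proof -
  define G where "G = (\<lambda>z. g (dfst z) (dfst (dsnd z)) (dsnd (dsnd z)))"
  obtain c qg where g: "\<And>s. \<exists>t s'. exec c s t s' \<and> s' 0 = G (s 0) \<and> s' 1 = s 1 \<and>
     t \<le> poly qg (dsize (s 0) + dsize (s 1)) \<and> dsize (G (s 0)) \<le> poly qg (dsize (s 0))"
    using assms(1) unfolding ptime_def G_def by blast
  have "ptime (\<lambda>x. Pair x (Pair (i x) (l x)))"
    by (intro ptime_intros assms)
  then obtain ci qi where p: "\<And>s. \<exists>t s'. exec ci s t s' \<and> s' 0 = Pair (s 0) (Pair (i (s 0)) (l (s 0))) \<and> s' 1 = s 1 \<and>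
     t \<le> poly qi (dsize (s 0) + dsize (s 1)) \<and> dsize (Pair (s 0) (Pair (i (s 0)) (l (s 0)))) \<le> poly qi (dsize (s 0))"
    unfolding ptime_def by blast
  define prog where "prog = Seq ci (Seq (While (Snd (Snd (Var 0))) (fold_body c)) (Assign 0 (Fst (Snd (Var 0)))))"
  define r :: "nat poly" where "r = B + qi + [:2, 1:]"
  \<comment> \<open>\<open>qi\<close> bounds the size of the initial triple, hence also the number
    of iterations; \<open>r\<close> bounds everything stored during the loop.\<close>
  define q where "q = qi + (qi + 1) * ([:60:] + smult 60 r + pcompose qg (smult 3 r + [:3:])) + [:10,1:] + B"
  have "\<exists>t s'. exec prog s t s' \<and> s' 0 = foldl (g (s 0)) (i (s 0)) (dlist (l (s 0))) \<and> s' 1 = s 1 \<and>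
     t \<le> poly q (dsize (s 0) + dsize (s 1)) \<and>
     dsize (foldl (g (s 0)) (i (s 0)) (dlist (l (s 0)))) \<le> poly q (dsize (s 0))" for s
  proof -
    define n where "n = dsize (s 0) + dsize (s 1)"
    let ?x = "s 0"
    have G: "(\<lambda>a e. G (Pair ?x (Pair a e))) = g ?x"
      by (simp add: G_def)
    obtain t1 s1 where 1: "exec ci s t1 s1" "s1 0 = Pair ?x (Pair (i ?x) (encl (dlist (l ?x))))"
      "s1 1 = s 1" "t1 \<le> poly qi n" "dsize (Pair (s 0) (Pair (i (s 0)) (l (s 0)))) \<le> poly qi (dsize (s 0))"
      using p[of s] by (auto simp: n_def)
    have m: "poly qi (dsize (s 0)) \<le> poly qi n" "poly B (dsize (s 0)) \<le> poly B n"
      by (auto intro!: poly_nat_mono simp: n_def)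
    have "dsize ?x + poly B (dsize ?x) + dsize (encl (dlist (l ?x))) + dsize (s1 1) + 2 \<le> poly r n"
      using 1 m by (simp add: r_def n_def)
    then have "\<exists>t s'. exec (While (Snd (Snd (Var 0))) (fold_body c)) s1 t s' \<and>
       s' 0 = Pair ?x (Pair (foldl (g ?x) (i ?x) (dlist (l ?x))) Atom) \<and> s' 1 = s1 1 \<and>
       t \<le> (length (dlist (l ?x)) + 1) * (60 + 60 * poly r n + poly qg (3 * poly r n + 3))"
      by (intro exec_fold_loop[of c G qg s1 ?x "i ?x", unfolded G] g) (use 1 B in auto)
    then obtain t2 s2 where 2: "exec (While (Snd (Snd (Var 0))) (fold_body c)) s1 t2 s2"
      "s2 0 = Pair ?x (Pair (foldl (g ?x) (i ?x) (dlist (l ?x))) Atom)" "s2 1 = s 1"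
      "t2 \<le> (length (dlist (l ?x)) + 1) * (60 + 60 * poly r n + poly qg (3 * poly r n + 3))"
      using 1(3) by auto
    define s3 where "s3 = s2(0 := foldl (g ?x) (i ?x) (dlist (l ?x)))"
    have e3: "exec (Assign 0 (Fst (Snd (Var 0)))) s2 (Suc (cost_expr (Fst (Snd (Var 0))) s2)) s3"
      using exec.Assign[of 0 "Fst (Snd (Var 0))" s2] 2 by (simp add: s3_def)
    have B': "dsize (foldl (g ?x) (i ?x) (dlist (l ?x))) \<le> poly B (dsize ?x)"
      using B[of ?x _ "[]"] by simp
    have len: "length (dlist (l ?x)) \<le> poly qi n"
      using length_dlist[of "l ?x"] 1(5) m by simp
    have "t2 \<le> (poly qi n + 1) * (60 + 60 * poly r n + poly qg (3 * poly r n + 3))"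
      by (rule order_trans[OF 2(4)] mult_le_mono)+ (use len in auto)
    then have "Suc (t1 + Suc (t2 + Suc (cost_expr (Fst (Snd (Var 0))) s2))) \<le> poly q n"
      using 1(4) 2(2) B' m by (simp add: q_def poly_pcompose n_def)
    then show ?thesis
      using B' 2(3) unfolding prog_def n_def
      by (intro exec_exI[OF exec.Seq[OF 1(1) exec.Seq[OF 2(1) e3]]]) (auto simp: s3_def q_def)
  qed
  then show ?thesis unfolding ptime_def by blast
qed

section \<open>Lists and tables\<close>

lemma dsize_encl_le:
  assumes "\<And>e. e \<in> set l \<Longrightarrow> dsize e \<le> M"
  shows "dsize (encl l) \<le> 1 + length l * (M + 1)"
  using assms
proof (induction l)
  case (Cons a l)
  then have "dsize a \<le> M" "dsize (encl l) \<le> 1 + length l * (M + 1)" by auto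
  then show ?case by simp
qed simp

lemma dsize_encl_prefix:
  assumes "dlist x = ys @ zs"
  shows "dsize (encl ys) \<le> dsize x" and "length ys < dsize x"
    and "\<And>e. e \<in> set ys \<Longrightarrow> dsize e < dsize x"
proof -
  have "dsize x + 1 = dsize (encl ys) + dsize (encl zs)"
    using dsize_encl_append[of ys zs] assms by (metis encl_dlist)
  then show "dsize (encl ys) \<le> dsize x"
    using dsize_pos[of "encl zs"] by simp
  show "length ys < dsize x" using length_dlist[of x] assms by simp
  show "dsize e < dsize x" if "e \<in> set ys" for e
    using dsize_mem[of e x] assms that by simp
qed

lemma dsize_encl_rev: "dsize (encl (rev l)) = dsize (encl l)"
proof (induction l)
  case (Cons e l)
  then show ?case using dsize_encl_append[of "rev l" "[e]"] by simp
qed simp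

text \<open>Growth that depends only on the input \<open>x\<close>, whatever the accumulator, adds
  up to at most the length of the list times the increment.\<close>

lemma ptime_foldl_add:
  assumes "ptime (\<lambda>z. g (dfst z) (dfst (dsnd z)) (dsnd (dsnd z)))" "ptime i" "ptime l"
    and B: "\<And>x a e. e \<in> set (dlist (l x)) \<Longrightarrow> dsize (g x a e) \<le> dsize a + poly B (dsize x)"
  shows "ptime (\<lambda>x. foldl (g x) (i x) (dlist (l x)))"
proof -
  obtain qi where qi: "\<And>x. dsize (i x) \<le> poly qi (dsize x)" using ptime_size[OF assms(2)] by blast
  obtain ql where ql: "\<And>x. dsize (l x) \<le> poly ql (dsize x)" using ptime_size[OF assms(3)] by blast
  show ?thesis
  proof (rule ptime_foldl[where B = "qi + ql * B"], (fact assms)+)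
    fix x ys zs assume *: "dlist (l x) = ys @ zs"
    then have "set ys \<subseteq> set (dlist (l x))" by simp
    then have "dsize (foldl (g x) (i x) ys) \<le> dsize (i x) + length ys * poly B (dsize x)"
    proof (induction ys rule: rev_induct)
      case (snoc e ys)
      then show ?case
        using B[of e x "foldl (g x) (i x) ys"] by simp
    qed simp
    also have "length ys * poly B (dsize x) \<le> poly ql (dsize x) * poly B (dsize x)"
      using dsize_encl_prefix(2)[OF *] ql[of x] by (intro mult_le_mono1) simp
    finally show "dsize (foldl (g x) (i x) ys) \<le> poly (qi + ql * B) (dsize x)"
      using qi[of x] * by simp
  qed
qed

text \<open>For loops that overwrite the accumulator: the size never exceeds the larger of its start
  and a bound in the input, however many rounds are made.\<close>

lemma ptime_foldl_max:
  assumes "ptime (\<lambda>z. g (dfst z) (dfst (dsnd z)) (dsnd (dsnd z)))" "ptime i" "ptime l"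
    and B: "\<And>x a e. e \<in> set (dlist (l x)) \<Longrightarrow> dsize (g x a e) \<le> max (dsize a) (poly B (dsize x))"
  shows "ptime (\<lambda>x. foldl (g x) (i x) (dlist (l x)))"
proof -
  obtain qi where qi: "\<And>x. dsize (i x) \<le> poly qi (dsize x)" using ptime_size[OF assms(2)] by blast
  show ?thesis
  proof (rule ptime_foldl[where B = "qi + B"], (fact assms)+)
    fix x ys zs assume *: "dlist (l x) = ys @ zs"
    have "set ys \<subseteq> set (dlist (l x)) \<Longrightarrow>
      dsize (foldl (g x) (i x) ys) \<le> max (dsize (i x)) (poly B (dsize x))"
    proof (induction ys rule: rev_induct)
      case (snoc e ys)
      then show ?case
        using B[of e x "foldl (g x) (i x) ys"] by auto
    qed simp
    then show "dsize (foldl (g x) (i x) ys) \<le> poly (qi + B) (dsize x)"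
      using qi[of x] * by simp
  qed
qed

lemma foldl_Pair: "foldl (\<lambda>a e. Pair e a) a l = encl (rev l @ dlist a)"
  by (induction l arbitrary: a) auto

text \<open>A loop that conses onto its accumulator reverses the list, so this is the primitive from
  which reversal and, by a second reversal, concatenation are obtained.\<close>

lemma ptime_rev_append:
  assumes "ptime f" "ptime g"
  shows "ptime (\<lambda>x. encl (rev (dlist (f x)) @ dlist (g x)))"
proof -
  obtain q where q: "\<And>x. dsize (f x) \<le> poly q (dsize x)" using ptime_size[OF assms(1)] by blast
  have "ptime (\<lambda>x. foldl (\<lambda>a e. Pair e a) (g x) (dlist (f x)))"
  proof (rule ptime_foldl_add[where B = "q + [:1:]"])
    show "dsize (Pair e a) \<le> dsize a + poly (q + [:1:]) (dsize x)" if "e \<in> set (dlist (f x))" for x a e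
      using dsize_mem[OF that] q[of x] by simp
  qed (intro ptime_intros assms)+
  then show ?thesis by (simp add: foldl_Pair)
qed

lemma ptime_rev [ptime_intros]:
  assumes "ptime f"
  shows "ptime (\<lambda>x. encl (rev (dlist (f x))))"
  using ptime_rev_append[OF assms ptime_const[of Atom]] by simp

lemma ptime_append [ptime_intros]:
  assumes "ptime f" "ptime g"
  shows "ptime (\<lambda>x. encl (dlist (f x) @ dlist (g x)))"
  using ptime_rev_append[OF ptime_rev[OF assms(1)] assms(2)] by simp

text \<open>The pieces are accumulated in reverse and turned around once at the end. Mapping and
  filtering are the cases of one-element and at most one-element pieces.\<close>

lemma ptime_concat_map [ptime_intros]:
  assumes "ptime (\<lambda>z. f (dfst z) (dsnd z))" "ptime l"
  shows "ptime (\<lambda>x. encl (concat (map (\<lambda>e. dlist (f x e)) (dlist (l x)))))"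
proof -
  obtain q where q: "\<And>x. dsize (f (dfst x) (dsnd x)) \<le> poly q (dsize x)" using ptime_size[OF assms(1)] by blast
  obtain ql where ql: "\<And>x. dsize (l x) \<le> poly ql (dsize x)" using ptime_size[OF assms(2)] by blast
  have *: "foldl (\<lambda>a e. encl (rev (dlist (f x e)) @ dlist a)) a ys =
      encl (rev (concat (map (\<lambda>e. dlist (f x e)) ys)) @ dlist a)" for x a ys
    by (induction ys arbitrary: a) auto
  \<comment> \<open>\<open>f\<close> expects the context and the element, whereas a loop body
    receives context, accumulator and element; the accumulator is dropped here.\<close>
  have "ptime (\<lambda>z. f (dfst (Pair (dfst z) (dsnd (dsnd z)))) (dsnd (Pair (dfst z) (dsnd (dsnd z)))))"
    by (rule ptime_compose[OF assms(1)]) (intro ptime_intros)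
  then have f: "ptime (\<lambda>z. f (dfst z) (dsnd (dsnd z)))" by simp
  have "ptime (\<lambda>x. foldl (\<lambda>a e. encl (rev (dlist (f x e)) @ dlist a)) Atom (dlist (l x)))"
  proof (rule ptime_foldl_add[where B = "pcompose q ([:1, 1:] + ql)"])
    fix x a e assume e: "e \<in> set (dlist (l x))"
    have "dsize (encl (rev (dlist (f x e)) @ dlist a)) + 1 = dsize (f x e) + dsize a"
      using dsize_encl_append[of "rev (dlist (f x e))" "dlist a"] by (simp add: dsize_encl_rev)
    moreover have "dsize (f x e) \<le> poly (pcompose q ([:1, 1:] + ql)) (dsize x)"
    proof -
      have "dsize (f x e) \<le> poly q (dsize (Pair x e))"
      using q[of "Pair x e"] by simp
    also have "\<dots> \<le> poly (pcompose q ([:1, 1:] + ql)) (dsize x)"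
      using dsize_mem[OF e] ql[of x] unfolding poly_pcompose by (intro poly_nat_mono) simp
      finally show ?thesis .
    qed
    ultimately show "dsize (encl (rev (dlist (f x e)) @ dlist a)) \<le>
      dsize a + poly (pcompose q ([:1, 1:] + ql)) (dsize x)"
      by simp
  qed (intro ptime_intros ptime_rev_append f assms)+
  then have "ptime (\<lambda>x. encl (rev (concat (map (\<lambda>e. dlist (f x e)) (dlist (l x))))))"
    by (simp add: *)
  from ptime_rev[OF this] show ?thesis by simp
qed

lemma ptime_map [ptime_intros]:
  assumes "ptime (\<lambda>z. f (dfst z) (dsnd z))" "ptime l"
  shows "ptime (\<lambda>x. encl (map (\<lambda>e. f x e) (dlist (l x))))"
proof -
  have "ptime (\<lambda>x. encl (concat (map (\<lambda>e. dlist (Pair (f x e) Atom)) (dlist (l x)))))"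
    by (intro ptime_intros assms)
  then show ?thesis by (simp add: concat_map_singleton)
qed

lemma ptime_filter [ptime_intros]:
  assumes "ptime (\<lambda>z. dbool (P (dfst z) (dsnd z)))" "ptime l"
  shows "ptime (\<lambda>x. encl (filter (\<lambda>e. P x e) (dlist (l x))))"
proof -
  have "ptime (\<lambda>x. encl (concat (map (\<lambda>e. dlist (if P x e then Pair e Atom else Atom)) (dlist (l x)))))"
    by (intro ptime_intros assms)
  moreover have "concat (map (\<lambda>e. dlist (if P x e then Pair e Atom else Atom)) ys) = filter (P x) ys" for x ys
    by (induction ys) auto
  ultimately show ?thesis by simp
qed

lemma ptime_mem [ptime_intros]:
  assumes "ptime f" "ptime l"
  shows "ptime (\<lambda>x. dbool (f x \<in> set (dlist (l x))))"
proof -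
  have "ptime (\<lambda>z. f (dfst z))"
    by (rule ptime_compose[OF assms(1)]) (intro ptime_intros)
  then have "ptime (\<lambda>x. dbool (encl (filter (\<lambda>e. e = f x) (dlist (l x))) \<noteq> Atom))"
    by (intro ptime_intros assms)
  moreover have "encl (filter (\<lambda>e. e = v) ys) \<noteq> Atom \<longleftrightarrow> v \<in> set ys" for v ys
    by (induction ys) auto
  ultimately show ?thesis by simp
qed

section \<open>Unary numbers, enumeration and lookup\<close>

lemma enc_nat_eq_encl: "enc_nat n = encl (replicate n Atom)"
  by (induction n) auto

lemma enc_nat_inject [simp]: "enc_nat m = enc_nat n \<longleftrightarrow> m = n"
proof (induction m arbitrary: n)
  case 0 then show ?case by (cases n) auto
next
  case (Suc m) then show ?case by (cases n) auto
qed

lemma dlist_enc_nat_add: "encl (dlist (enc_nat m) @ dlist (enc_nat n)) = enc_nat (m + n)"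
  by (induction m) (auto simp: enc_nat_eq_encl)

lemma ptime_length [ptime_intros]:
  assumes "ptime l"
  shows "ptime (\<lambda>x. enc_nat (length (dlist (l x))))"
proof -
  have "ptime (\<lambda>x. encl (map (\<lambda>e. Atom) (dlist (l x))))"
    by (intro ptime_intros assms)
  then show ?thesis by (simp add: enc_nat_eq_encl map_replicate_const)
qed

definition denum :: "data list \<Rightarrow> data list" where
  "denum l = map (\<lambda>(i, e). Pair (enc_nat i) e) (List.enumerate 0 l)"

lemma denum_snoc: "denum (l @ [e]) = denum l @ [Pair (enc_nat (length l)) e]"
  by (simp add: denum_def enumerate_append_eq)

lemma length_denum [simp]: "length (denum l) = length l"
  by (simp add: denum_def)

lemma nth_denum [simp]: "i < length l \<Longrightarrow> denum l ! i = Pair (enc_nat i) (l ! i)"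
  by (simp add: denum_def nth_enumerate_eq)

lemma set_denum: "set (denum l) = {Pair (enc_nat i) (l ! i) |i. i < length l}"
  unfolding set_conv_nth by (intro Collect_cong ex_cong1) auto

lemma dsize_enc_nat: "dsize (enc_nat n) = 2 * n + 1"
  by (induction n) auto

text \<open>The length of the accumulator serves as the counter. The increment thus depends on the
  accumulator, which rules out \<open>ptime_foldl_add\<close>; instead the prefixes are bounded
  directly, with unary indices below the length, which gives a quadratic bound.\<close>

lemma ptime_denum [ptime_intros]:
  assumes "ptime l"
  shows "ptime (\<lambda>x. encl (denum (dlist (l x))))"
proof -
  obtain ql where ql: "\<And>x. dsize (l x) \<le> poly ql (dsize x)" using ptime_size[OF assms(1)] by blast
  have *: "foldl (\<lambda>a e. Pair (Pair (enc_nat (length (dlist a))) e) a) Atom ys = encl (rev (denum ys))" for ys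
    by (induction ys rule: rev_induct) (auto simp: denum_snoc, simp add: denum_def)
  have "ptime (\<lambda>x. foldl (\<lambda>a e. Pair (Pair (enc_nat (length (dlist a))) e) a) Atom (dlist (l x)))"
  proof (rule ptime_foldl[where B = "1 + ql * (smult 3 ql + [:3:])"])
    fix x ys zs assume a: "dlist (l x) = ys @ zs"
    let ?n = "dsize (l x)"
    have "dsize (encl (denum ys)) \<le> 1 + length (denum ys) * (3 * ?n + 2 + 1)"
    proof (rule dsize_encl_le)
      fix e assume "e \<in> set (denum ys)"
      then obtain i where i: "i < length ys" "e = Pair (enc_nat i) (ys ! i)"
        by (auto simp: set_denum)
      then show "dsize e \<le> 3 * ?n + 2"
        using dsize_encl_prefix(2)[OF a] dsize_encl_prefix(3)[OF a, of "ys ! i"]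
        by (simp add: dsize_enc_nat)
    qed
    also have "\<dots> \<le> 1 + poly ql (dsize x) * (3 * poly ql (dsize x) + 3)"
      using ql[of x] dsize_encl_prefix(2)[OF a] by (intro add_left_mono mult_le_mono) auto
    finally show "dsize (foldl (\<lambda>a e. Pair (Pair (enc_nat (length (dlist a))) e) a) Atom ys)
      \<le> poly (1 + ql * (smult 3 ql + [:3:])) (dsize x)"
      by (simp add: * dsize_encl_rev)
  qed (intro ptime_intros assms)+
  then have "ptime (\<lambda>x. encl (rev (denum (dlist (l x)))))" by (simp add: *)
  from ptime_rev[OF this] show ?thesis by simp
qed

text \<open>Lookup is filtering of the enumerated list, so its running time needs no new loop. An
  index out of range yields \<open>Atom\<close>.\<close>

definition dnth :: "data list \<Rightarrow> data \<Rightarrow> data" where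
  "dnth l v = dsnd (dfst (encl (filter (\<lambda>p. dfst p = v) (denum l))))"

text \<open>An absent element yields \<open>Atom\<close>, which is also the index 0; the kernel
  therefore looks up only elements known to occur.\<close>

definition dindex :: "data list \<Rightarrow> data \<Rightarrow> data" where
  "dindex l v = dfst (dfst (encl (filter (\<lambda>p. dsnd p = v) (denum l))))"

lemma filter_eq_single:
  assumes "i < length l" "P (l ! i)" "\<And>j. j < length l \<Longrightarrow> P (l ! j) \<Longrightarrow> j = i"
  shows "filter P l = [l ! i]"
proof -
  have "{j. j < length l \<and> P (l ! j)} = {i}" using assms(1,2) by (blast dest: assms(3))
  then have "length (filter P l) = 1" by (simp add: length_filter_conv_card)
  then obtain y where y: "filter P l = [y]" by (auto simp: length_Suc_conv)
  have "l ! i \<in> set (filter P l)" using assms(1,2) by simp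
  then show ?thesis unfolding y by simp
qed

lemma dnth_enc_nat [simp]: "i < length l \<Longrightarrow> dnth l (enc_nat i) = l ! i"
  using filter_eq_single[of i "denum l" "\<lambda>p. dfst p = enc_nat i"] by (simp add: dnth_def)

lemma dindex_nth [simp]: "distinct l \<Longrightarrow> i < length l \<Longrightarrow> dindex l (l ! i) = enc_nat i"
  using filter_eq_single[of i "denum l" "\<lambda>p. dsnd p = l ! i"]
  by (simp add: dindex_def nth_eq_iff_index_eq)

lemma ptime_dnth [ptime_intros]:
  assumes "ptime l" "ptime f"
  shows "ptime (\<lambda>x. dnth (dlist (l x)) (f x))"
proof -
  have [ptime_intros]: "ptime (\<lambda>z. f (dfst z))"
    by (rule ptime_compose[OF assms(2)]) (intro ptime_intros)
  have "ptime (\<lambda>x. dsnd (dfst (encl (filter (\<lambda>p. dfst p = f x) (dlist (encl (denum (dlist (l x)))))))))"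
    by (intro ptime_intros assms)
  then show ?thesis by (simp add: dnth_def)
qed

lemma ptime_dindex [ptime_intros]:
  assumes "ptime l" "ptime f"
  shows "ptime (\<lambda>x. dindex (dlist (l x)) (f x))"
proof -
  have [ptime_intros]: "ptime (\<lambda>z. f (dfst z))"
    by (rule ptime_compose[OF assms(2)]) (intro ptime_intros)
  have "ptime (\<lambda>x. dfst (dfst (encl (filter (\<lambda>p. dsnd p = f x) (dlist (encl (denum (dlist (l x)))))))))"
    by (intro ptime_intros assms)
  then show ?thesis by (simp add: dindex_def)
qed

text \<open>The keys are tested one after the other, and the functions \<open>g k\<close> are built
  into the program. Hence they may be picked by mere existence; this is how everything that depends
  on \<open>H\<close> enters the algorithm.\<close>

lemma ptime_table:
  assumes "finite D" "\<And>k. k \<in> D \<Longrightarrow> ptime (g k)" "ptime f"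
  shows "\<exists>T. ptime T \<and> (\<forall>x. f x \<in> D \<longrightarrow> T x = g (f x) x)"
  using assms(1,2)
proof (induction D)
  case empty
  then show ?case using ptime_const by auto
next
  case (insert k D)
  then obtain T where T: "ptime T" "\<forall>x. f x \<in> D \<longrightarrow> T x = g (f x) x" by auto
  have "ptime (\<lambda>x. if f x = k then g k x else T x)"
    by (intro ptime_intros assms T insert.prems) auto
  moreover have "\<forall>x. f x \<in> insert k D \<longrightarrow> (if f x = k then g k x else T x) = g (f x) x"
    using T by auto
  ultimately show ?case by blast
qed

text \<open>Bodies of maps and filters see a pair of context and element; this transports functions
  of the context to them.\<close>

lemma ptime_lift: "ptime f \<Longrightarrow> ptime (\<lambda>z. f (dfst z))"
  by (rule ptime_compose[OF _ ptime_dfst_id])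

lemma dsize_encl_filter: "dsize (encl (filter P l)) \<le> dsize (encl l)"
  by (induction l) auto

section \<open>Gaussian elimination over GF(2)\<close>

text \<open>The universe \<open>U\<close> bounds the size of the sum, whatever the sizes of the summands.\<close>

definition xorv :: "data \<Rightarrow> data \<Rightarrow> data \<Rightarrow> data" where
  "xorv U v b = encl (filter (\<lambda>m. (m \<in> set (dlist v)) \<noteq> (m \<in> set (dlist b))) (dlist U))"

text \<open>Rows are pairs of a vector and its origin, a vector being the list of its monomials. The
  pivot of a row is its first monomial.\<close>

definition reduce :: "data \<Rightarrow> data list \<Rightarrow> data \<Rightarrow> data" where
  "reduce U B v = foldl (\<lambda>v e. if dfst (dfst e) \<in> set (dlist v) then xorv U v (dfst e) else v) v B"

text \<open>New rows go to the end, so that the pivot of a row is absent from all later rows. The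
  origin is carried along unchanged, although the vector is reduced.\<close>

definition gauss_step :: "data \<Rightarrow> data \<Rightarrow> data \<Rightarrow> data" where
  "gauss_step U B e = (if reduce U (dlist B) (dfst e) = Atom then B
     else encl (dlist B @ dlist (Pair (Pair (reduce U (dlist B) (dfst e)) (dsnd e)) Atom)))"

definition gauss :: "data \<Rightarrow> data list \<Rightarrow> data" where
  "gauss U l = foldl (gauss_step U) Atom l"

text \<open>The value over GF(2) of the sum of the monomials in \<open>v\<close>, where
  \<open>T\<close> tells which monomials have value one. A vector counts as a set, in accordance
  with \<open>xorv\<close>.\<close>

definition veval :: "(data \<Rightarrow> bool) \<Rightarrow> data \<Rightarrow> bool" where
  "veval T v \<longleftrightarrow> odd (card {m \<in> set (dlist v). T m})"

lemma dsize_reduce: "dsize (reduce U B v) \<le> max (dsize v) (dsize U)"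
proof -
  have *: "dsize (xorv U v b) \<le> dsize U" for v b
    using dsize_encl_filter[of _ "dlist U"] by (simp add: xorv_def)
  show ?thesis unfolding reduce_def
  proof (induction B rule: rev_induct)
    case (snoc e B)
    then show ?case using * by (auto simp: le_max_iff_disj)
  qed simp
qed

lemma ptime_xorv [ptime_intros]:
  assumes "ptime U" "ptime v" "ptime b"
  shows "ptime (\<lambda>x. xorv (U x) (v x) (b x))"
proof -
  have "ptime (\<lambda>x. encl (filter (\<lambda>m. (m \<in> set (dlist (v x)) \<and> m \<notin> set (dlist (b x))) \<or>
      (m \<notin> set (dlist (v x)) \<and> m \<in> set (dlist (b x)))) (dlist (U x))))"
    by (intro ptime_intros assms assms[THEN ptime_lift])
  moreover have "(m \<in> set (dlist v) \<and> m \<notin> set (dlist b)) \<or> (m \<notin> set (dlist v) \<and> m \<in> set (dlist b)) \<longleftrightarrow>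
      ((m \<in> set (dlist v)) \<noteq> (m \<in> set (dlist b)))" for m v b
    by blast
  ultimately show ?thesis unfolding xorv_def by simp
qed

lemma ptime_reduce [ptime_intros]:
  assumes "ptime U" "ptime B" "ptime v"
  shows "ptime (\<lambda>x. reduce (U x) (dlist (B x)) (v x))"
proof -
  obtain q where q: "\<And>x. dsize (U x) \<le> poly q (dsize x)" using ptime_size[OF assms(1)] by blast
  have *: "dsize (xorv U v b) \<le> dsize U" for U v b
    using dsize_encl_filter[of _ "dlist U"] by (simp add: xorv_def)
  show ?thesis unfolding reduce_def
  proof (rule ptime_foldl_max[where B = q])
    show "dsize (if dfst (dfst e) \<in> set (dlist a) then xorv (U x) a (dfst e) else a)
        \<le> max (dsize a) (poly q (dsize x))" for x a e
      using *[of "U x" a "dfst e"] q[of x] by auto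
  qed (intro ptime_intros assms assms[THEN ptime_lift])+
qed

text \<open>A reduced row is the given row itself or a sublist of \<open>U\<close>, however many
  rows were added to it. Hence each round enlarges the basis by an amount bounded in the
  input.\<close>

lemma ptime_gauss [ptime_intros]:
  assumes "ptime U" "ptime l"
  shows "ptime (\<lambda>x. gauss (U x) (dlist (l x)))"
proof -
  obtain q where q: "\<And>x. dsize (U x) \<le> poly q (dsize x)" using ptime_size[OF assms(1)] by blast
  obtain ql where ql: "\<And>x. dsize (l x) \<le> poly ql (dsize x)" using ptime_size[OF assms(2)] by blast
  show ?thesis unfolding gauss_def
  proof (rule ptime_foldl_add[where B = "q + smult 2 ql + [:10:]"])
    fix x a e assume e: "e \<in> set (dlist (l x))"
    let ?r = "reduce (U x) (dlist a) (dfst e)"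
    have "dsize e \<le> poly ql (dsize x)" using dsize_mem[OF e] ql[of x] by simp
    then have "dsize (dfst e) \<le> poly ql (dsize x)" "dsize (dsnd e) \<le> poly ql (dsize x)"
      using dsize_dfst[of e] dsize_dsnd[of e] by linarith+
    moreover have "dsize ?r \<le> dsize (dfst e) + dsize (U x)"
      using dsize_reduce[of "U x" "dlist a" "dfst e"] by simp
    moreover have "dsize (encl (dlist a @ [Pair ?r (dsnd e)])) = dsize a + dsize ?r + dsize (dsnd e) + 2"
      using dsize_encl_append[of "dlist a" "[Pair ?r (dsnd e)]"] by simp
    ultimately show "dsize (gauss_step (U x) a e) \<le> dsize a + poly (q + smult 2 ql + [:10:]) (dsize x)"
      using q[of x] by (auto simp: gauss_step_def)
  qed (unfold gauss_step_def, (intro ptime_intros assms assms[THEN ptime_lift])+)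
qed

section \<open>Correctness of the elimination\<close>

lemma set_xorv:
  assumes "set (dlist v) \<subseteq> set (dlist U)" "set (dlist b) \<subseteq> set (dlist U)"
  shows "set (dlist (xorv U v b)) =
    (set (dlist v) - set (dlist b)) \<union> (set (dlist b) - set (dlist v))"
  using assms by (auto simp: xorv_def)

lemma odd_card_sym_diff:
  assumes "finite A" "finite B"
  shows "odd (card ((A - B) \<union> (B - A))) \<longleftrightarrow> odd (card A) \<noteq> odd (card B)"
proof -
  have "card ((A - B) \<union> (B - A)) = card (A - B) + card (B - A)"
    using assms by (intro card_Un_disjoint) auto
  moreover have "card A = card (A - B) + card (A \<inter> B)"
    using assms by (subst card_Un_disjoint[symmetric]) (auto intro: arg_cong[where f = card])
  moreover have "card B = card (B - A) + card (A \<inter> B)"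
    using assms by (subst card_Un_disjoint[symmetric]) (auto intro: arg_cong[where f = card])
  ultimately show ?thesis by auto
qed

lemma veval_xorv:
  assumes "set (dlist v) \<subseteq> set (dlist U)" "set (dlist b) \<subseteq> set (dlist U)"
  shows "veval T (xorv U v b) \<longleftrightarrow> veval T v \<noteq> veval T b"
proof -
  let ?A = "{m \<in> set (dlist v). T m}" and ?B = "{m \<in> set (dlist b). T m}"
  have "{m \<in> set (dlist (xorv U v b)). T m} = (?A - ?B) \<union> (?B - ?A)"
    unfolding set_xorv[OF assms] by auto
  then show ?thesis
    using odd_card_sym_diff[of ?A ?B] by (simp add: veval_def)
qed

lemma veval_Atom [simp]: "\<not> veval T Atom"
  by (simp add: veval_def)

lemma reduce_Nil [simp]: "reduce U [] v = v"
  by (simp add: reduce_def)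

lemma reduce_Cons: "reduce U (e # B) v =
    reduce U B (if dfst (dfst e) \<in> set (dlist v) then xorv U v (dfst e) else v)"
  by (simp add: reduce_def)

text \<open>All three parts come from one induction. The last one guarantees that a pivot already
  removed cannot return through rows that do not contain it.\<close>

lemma reduce_veval:
  assumes "set (dlist v) \<subseteq> set (dlist U)"
    "\<And>e. e \<in> set B \<Longrightarrow> set (dlist (dfst e)) \<subseteq> set (dlist U)"
  shows "set (dlist (reduce U B v)) \<subseteq> set (dlist U)"
    and "(\<And>e. e \<in> set B \<Longrightarrow> \<not> veval T (dfst e)) \<Longrightarrow> veval T (reduce U B v) = veval T v"
    and "m \<notin> set (dlist v) \<Longrightarrow> (\<And>e. e \<in> set B \<Longrightarrow> m \<notin> set (dlist (dfst e))) \<Longrightarrow>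
      m \<notin> set (dlist (reduce U B v))"
proof -
  have "set (dlist (reduce U B v)) \<subseteq> set (dlist U) \<and>
    ((\<forall>e\<in>set B. \<not> veval T (dfst e)) \<longrightarrow> veval T (reduce U B v) = veval T v) \<and>
    (m \<notin> set (dlist v) \<longrightarrow> (\<forall>e\<in>set B. m \<notin> set (dlist (dfst e))) \<longrightarrow> m \<notin> set (dlist (reduce U B v)))"
    using assms
  proof (induction B arbitrary: v)
    case (Cons e B)
    define w where "w = (if dfst (dfst e) \<in> set (dlist v) then xorv U v (dfst e) else v)"
    have e: "set (dlist (dfst e)) \<subseteq> set (dlist U)" using Cons.prems by simp
    have w: "set (dlist w) \<subseteq> set (dlist U)"
      "\<not> veval T (dfst e) \<Longrightarrow> veval T w = veval T v"
      "m \<notin> set (dlist v) \<Longrightarrow> m \<notin> set (dlist (dfst e)) \<Longrightarrow> m \<notin> set (dlist w)"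
      using Cons.prems(1) e by (auto simp: w_def set_xorv veval_xorv)
    show ?case
      using Cons.IH[OF w(1)] Cons.prems(2) w by (auto simp: reduce_Cons w_def[symmetric])
  qed simp
  then show "set (dlist (reduce U B v)) \<subseteq> set (dlist U)"
    "(\<And>e. e \<in> set B \<Longrightarrow> \<not> veval T (dfst e)) \<Longrightarrow> veval T (reduce U B v) = veval T v"
    "m \<notin> set (dlist v) \<Longrightarrow> (\<And>e. e \<in> set B \<Longrightarrow> m \<notin> set (dlist (dfst e))) \<Longrightarrow>
      m \<notin> set (dlist (reduce U B v))"
    by blast+
qed

text \<open>A single pass suffices: the pivot of a row is gone once that row has been processed, and
  by the order of the rows no later row contains it.\<close>

lemma reduce_pivot:
  assumes "set (dlist v) \<subseteq> set (dlist U)"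
    "\<And>e. e \<in> set B \<Longrightarrow> set (dlist (dfst e)) \<subseteq> set (dlist U)"
    "\<And>e. e \<in> set B \<Longrightarrow> dfst e \<noteq> Atom"
    "sorted_wrt (\<lambda>e e'. dfst (dfst e) \<notin> set (dlist (dfst e'))) B"
    "e \<in> set B"
  shows "dfst (dfst e) \<notin> set (dlist (reduce U B v))"
  using assms
proof (induction B arbitrary: v)
  case (Cons b B)
  define w where "w = (if dfst (dfst b) \<in> set (dlist v) then xorv U v (dfst b) else v)"
  have b: "set (dlist (dfst b)) \<subseteq> set (dlist U)" "dfst b \<noteq> Atom" using Cons.prems by simp_all
  then have p: "dfst (dfst b) \<in> set (dlist (dfst b))" by (cases "dfst b") auto
  have w: "set (dlist w) \<subseteq> set (dlist U)"
    using Cons.prems(1) b by (auto simp: w_def set_xorv)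
  have pw: "dfst (dfst b) \<notin> set (dlist w)"
    using Cons.prems(1) b p by (auto simp: w_def set_xorv)
  show ?case
  proof (cases "e = b")
    case True
    then show ?thesis
      using reduce_veval(3)[OF w _ pw, of B] Cons.prems by (auto simp: reduce_Cons w_def[symmetric])
  next
    case False
    then show ?thesis
      using Cons.IH[OF w] Cons.prems by (auto simp: reduce_Cons w_def[symmetric])
  qed
qed simp

text \<open>The last clause says that the kept origins span. Several rows may share an origin, so it
  assumes vanishing for all input rows with a kept origin, not just for those that produced basis
  rows; a gadget supplies exactly this.\<close>

lemma gauss_invariant:
  assumes "\<And>e. e \<in> set l \<Longrightarrow> set (dlist (dfst e)) \<subseteq> set (dlist U)"
  shows "(\<forall>e\<in>set (dlist (gauss U l)). set (dlist (dfst e)) \<subseteq> set (dlist U) \<and> dfst e \<noteq> Atom) \<and>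
    dsnd ` set (dlist (gauss U l)) \<subseteq> dsnd ` set l \<and>
    sorted_wrt (\<lambda>e e'. dfst (dfst e) \<notin> set (dlist (dfst e'))) (dlist (gauss U l)) \<and>
    ((\<forall>e\<in>set l. dsnd e \<in> dsnd ` set (dlist (gauss U l)) \<longrightarrow> \<not> veval T (dfst e)) \<longrightarrow>
      (\<forall>e\<in>set l. \<not> veval T (dfst e)) \<and> (\<forall>e\<in>set (dlist (gauss U l)). \<not> veval T (dfst e)))"
  using assms
proof (induction l rule: rev_induct)
  case Nil
  then show ?case by (simp add: gauss_def)
next
  case (snoc e l)
  define B where "B = gauss U l"
  define r where "r = reduce U (dlist B) (dfst e)"
  have step: "gauss U (l @ [e]) = (if r = Atom then B else encl (dlist B @ [Pair r (dsnd e)]))"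
    by (simp add: gauss_def gauss_step_def B_def r_def)
  have eU: "set (dlist (dfst e)) \<subseteq> set (dlist U)" using snoc.prems by simp
  have inv: "(\<forall>e\<in>set (dlist B). set (dlist (dfst e)) \<subseteq> set (dlist U) \<and> dfst e \<noteq> Atom) \<and>
    dsnd ` set (dlist B) \<subseteq> dsnd ` set l \<and>
    sorted_wrt (\<lambda>e e'. dfst (dfst e) \<notin> set (dlist (dfst e'))) (dlist B) \<and>
    ((\<forall>e\<in>set l. dsnd e \<in> dsnd ` set (dlist B) \<longrightarrow> \<not> veval T (dfst e)) \<longrightarrow>
      (\<forall>e\<in>set l. \<not> veval T (dfst e)) \<and> (\<forall>e\<in>set (dlist B). \<not> veval T (dfst e)))"
    unfolding B_def by (rule snoc.IH) (simp add: snoc.prems)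
  have IH: "\<And>e. e\<in>set (dlist B) \<Longrightarrow> set (dlist (dfst e)) \<subseteq> set (dlist U)"
    "\<And>e. e\<in>set (dlist B) \<Longrightarrow> dfst e \<noteq> Atom"
    "dsnd ` set (dlist B) \<subseteq> dsnd ` set l"
    "sorted_wrt (\<lambda>e e'. dfst (dfst e) \<notin> set (dlist (dfst e'))) (dlist B)"
    "(\<forall>e\<in>set l. dsnd e \<in> dsnd ` set (dlist B) \<longrightarrow> \<not> veval T (dfst e)) \<Longrightarrow>
      (\<forall>e\<in>set l. \<not> veval T (dfst e)) \<and> (\<forall>e\<in>set (dlist B). \<not> veval T (dfst e))"
    using inv by blast+
  have rU: "set (dlist r) \<subseteq> set (dlist U)"
    unfolding r_def by (rule reduce_veval(1)[OF eU IH(1)])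
  have piv: "dfst (dfst b) \<notin> set (dlist r)" if "b \<in> set (dlist B)" for b
    unfolding r_def by (rule reduce_pivot[OF eU IH(1) IH(2) IH(4) that])
  have ev: "veval T r = veval T (dfst e)" if "\<forall>e\<in>set (dlist B). \<not> veval T (dfst e)"
    unfolding r_def using that by (intro reduce_veval(2)[OF eU IH(1)]) auto
  show ?case
  proof (cases "r = Atom")
    case True
    have eq: "gauss U (l @ [e]) = B" using True by (simp add: step)
    have "(\<forall>e\<in>set (l @ [e]). \<not> veval T (dfst e)) \<and> (\<forall>e\<in>set (dlist B). \<not> veval T (dfst e))"
      if "\<forall>e\<in>set (l @ [e]). dsnd e \<in> dsnd ` set (dlist B) \<longrightarrow> \<not> veval T (dfst e)"
    proof -
      have 1: "(\<forall>e\<in>set l. \<not> veval T (dfst e)) \<and> (\<forall>e\<in>set (dlist B). \<not> veval T (dfst e))"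
        using that by (intro IH(5)) simp
      \<comment> \<open>The row was reduced to zero by rows that vanish under \<open>T\<close>, so
        it vanishes itself.\<close>
      then have "veval T Atom = veval T (dfst e)" using ev unfolding True by blast
      then show ?thesis using 1 by simp
    qed
    moreover have "dsnd ` set (dlist B) \<subseteq> dsnd ` set (l @ [e])" using IH(3) by auto
    ultimately show ?thesis unfolding eq using IH(1,2,4) by blast
  next
    case False
    have eq: "dlist (gauss U (l @ [e])) = dlist B @ [Pair r (dsnd e)]" using False by (simp add: step)
    have "(\<forall>e\<in>set (l @ [e]). \<not> veval T (dfst e)) \<and>
        (\<forall>e\<in>set (dlist B @ [Pair r (dsnd e)]). \<not> veval T (dfst e))"
      if "\<forall>e'\<in>set (l @ [e]). dsnd e' \<in> dsnd ` set (dlist B @ [Pair r (dsnd e)]) \<longrightarrow> \<not> veval T (dfst e')"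
    proof -
      have "\<not> veval T (dfst e)" using that by simp
      moreover have "(\<forall>e\<in>set l. \<not> veval T (dfst e)) \<and> (\<forall>e\<in>set (dlist B). \<not> veval T (dfst e))"
        using that by (intro IH(5)) simp
      ultimately show ?thesis using ev by simp
    qed
    moreover have "sorted_wrt (\<lambda>e e'. dfst (dfst e) \<notin> set (dlist (dfst e'))) (dlist B @ [Pair r (dsnd e)])"
      using IH(4) piv by (simp add: sorted_wrt_append)
    moreover have "dsnd ` set (dlist B @ [Pair r (dsnd e)]) \<subseteq> dsnd ` set (l @ [e])"
      using IH(3) by auto
    moreover have "\<forall>e\<in>set (dlist B @ [Pair r (dsnd e)]). set (dlist (dfst e)) \<subseteq> set (dlist U) \<and> dfst e \<noteq> Atom"
      using IH(1,2) rU False by simp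
    ultimately show ?thesis unfolding eq by blast
  qed
qed

lemma gauss_spanning:
  assumes "\<And>e. e \<in> set l \<Longrightarrow> set (dlist (dfst e)) \<subseteq> set (dlist U)"
    and "\<And>e. e \<in> set l \<Longrightarrow> dsnd e \<in> dsnd ` set (dlist (gauss U l)) \<Longrightarrow> \<not> veval T (dfst e)"
    and "e \<in> set l"
  shows "\<not> veval T (dfst e)"
  using gauss_invariant[of l U T, OF assms(1)] assms(2,3) by blast

lemma gauss_subset:
  assumes "\<And>e. e \<in> set l \<Longrightarrow> set (dlist (dfst e)) \<subseteq> set (dlist U)"
  shows "dsnd ` set (dlist (gauss U l)) \<subseteq> dsnd ` set l"
  using gauss_invariant[of l U, OF assms] by blast

text \<open>Independence is used in the form of pivots: a later row contains its own pivot but no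
  earlier one, so the pivots are distinct elements of \<open>U\<close>.\<close>

lemma length_gauss:
  assumes "\<And>e. e \<in> set l \<Longrightarrow> set (dlist (dfst e)) \<subseteq> set (dlist U)"
  shows "length (dlist (gauss U l)) \<le> card (set (dlist U))"
proof -
  let ?B = "dlist (gauss U l)"
  have inv: "\<And>e. e\<in>set ?B \<Longrightarrow> set (dlist (dfst e)) \<subseteq> set (dlist U)"
    "\<And>e. e\<in>set ?B \<Longrightarrow> dfst e \<noteq> Atom"
    "sorted_wrt (\<lambda>e e'. dfst (dfst e) \<notin> set (dlist (dfst e'))) ?B"
    using gauss_invariant[of l U, OF assms] by auto
  have p: "dfst (dfst e) \<in> set (dlist (dfst e))" if "e \<in> set ?B" for e
    using inv(2)[OF that] by (cases "dfst e") auto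
  have "sorted_wrt (\<noteq>) (map (\<lambda>e. dfst (dfst e)) ?B)"
    unfolding sorted_wrt_map using inv(3) by (rule sorted_wrt_mono_rel[rotated]) (use p in metis)
  then have "distinct (map (\<lambda>e. dfst (dfst e)) ?B)"
    by (simp add: distinct_conv_nth sorted_wrt_iff_nth_less) (metis nat_neq_iff)
  moreover have "set (map (\<lambda>e. dfst (dfst e)) ?B) \<subseteq> set (dlist U)"
    using inv(1) p by auto
  ultimately show ?thesis
    by (metis card_mono distinct_card length_map List.finite_set)
qed

section \<open>Greedy vertex cover\<close>

text \<open>A loop contributes one vertex only. This keeps the cover free of repetitions, so that
  positions in it can number the kernel vertices.\<close>

definition greedy_step :: "data \<Rightarrow> data \<Rightarrow> data" where
  "greedy_step a e = (if dfst e \<in> set (dlist a) \<or> dsnd e \<in> set (dlist a) then a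
     else if dfst e = dsnd e then Pair (dfst e) a else Pair (dfst e) (Pair (dsnd e) a))"

definition greedy_cover :: "data list \<Rightarrow> data" where
  "greedy_cover l = foldl greedy_step Atom l"

lemma ptime_greedy_cover [ptime_intros]:
  assumes "ptime l"
  shows "ptime (\<lambda>x. greedy_cover (dlist (l x)))"
proof -
  obtain ql where ql: "\<And>x. dsize (l x) \<le> poly ql (dsize x)" using ptime_size[OF assms(1)] by blast
  show ?thesis unfolding greedy_cover_def
  proof (rule ptime_foldl_add[where B = "smult 2 ql + [:10:]"])
    fix x a e assume e: "e \<in> set (dlist (l x))"
    have "dsize e \<le> poly ql (dsize x)" using dsize_mem[OF e] ql[of x] by simp
    then have "dsize (dfst e) \<le> poly ql (dsize x)" "dsize (dsnd e) \<le> poly ql (dsize x)"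
      using dsize_dfst[of e] dsize_dsnd[of e] by linarith+
    then show "dsize (greedy_step a e) \<le> dsize a + poly (smult 2 ql + [:10:]) (dsize x)"
      by (auto simp: greedy_step_def)
  qed (unfold greedy_step_def, (intro ptime_intros assms assms[THEN ptime_lift])+)
qed

text \<open>The induction needs the stronger bound \<open>2 * card (C \<inter> set (A l))\<close>:
  an edge adds at most two vertices, both new, and at least one of them lies in
  \<open>C\<close>.\<close>

lemma greedy_cover:
  fixes C :: "data set"
  defines "A \<equiv> \<lambda>l. dlist (greedy_cover l)"
  shows "distinct (A l)"
    and "set (A l) \<subseteq> (\<Union>e\<in>set l. {dfst e, dsnd e})"
    and "e \<in> set l \<Longrightarrow> dfst e \<in> set (A l) \<or> dsnd e \<in> set (A l)"
    and "finite C \<Longrightarrow> (\<And>e. e \<in> set l \<Longrightarrow> dfst e \<in> C \<or> dsnd e \<in> C) \<Longrightarrow> length (A l) \<le> 2 * card C"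
proof -
  have "distinct (A l) \<and> set (A l) \<subseteq> (\<Union>e\<in>set l. {dfst e, dsnd e}) \<and>
    (\<forall>e\<in>set l. dfst e \<in> set (A l) \<or> dsnd e \<in> set (A l)) \<and>
    (finite C \<longrightarrow> (\<forall>e\<in>set l. dfst e \<in> C \<or> dsnd e \<in> C) \<longrightarrow> length (A l) \<le> 2 * card (C \<inter> set (A l)))" for l
  proof (induction l rule: rev_induct)
    case Nil
    then show ?case by (simp add: A_def greedy_cover_def)
  next
    case (snoc e l)
    let ?a = "A l"
    consider (old) "dfst e \<in> set ?a \<or> dsnd e \<in> set ?a" "A (l @ [e]) = ?a"
      | (loop) "dfst e \<notin> set ?a" "dfst e = dsnd e" "A (l @ [e]) = dfst e # ?a"
      | (new) "dfst e \<notin> set ?a" "dsnd e \<notin> set ?a" "dfst e \<noteq> dsnd e" "A (l @ [e]) = dfst e # dsnd e # ?a"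
      by (auto simp: A_def greedy_cover_def greedy_step_def)
    then show ?case
    proof cases
      case old
      then show ?thesis using snoc by auto
    next
      case loop
      then show ?thesis using snoc by (auto simp: Int_insert_right)
    next
      case new
      have "length (A (l @ [e])) \<le> 2 * card (C \<inter> set (A (l @ [e])))"
        if "finite C" "\<forall>e\<in>set (l @ [e]). dfst e \<in> C \<or> dsnd e \<in> C"
      proof -
        have "length ?a \<le> 2 * card (C \<inter> set ?a)" using snoc that by auto
        then show ?thesis using that new by (auto simp: Int_insert_right)
      qed
      then show ?thesis using snoc new by auto
    qed
  qed
  note inv = this[of l]
  show "distinct (A l)" "set (A l) \<subseteq> (\<Union>e\<in>set l. {dfst e, dsnd e})"
    "e \<in> set l \<Longrightarrow> dfst e \<in> set (A l) \<or> dsnd e \<in> set (A l)"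
    using inv by auto
  show "length (A l) \<le> 2 * card C" if "finite C" "\<And>e. e \<in> set l \<Longrightarrow> dfst e \<in> C \<or> dsnd e \<in> C"
  proof -
    have "card (C \<inter> set (A l)) \<le> card C" using that by (intro card_mono) auto
    then show ?thesis using inv that by fastforce
  qed
qed

section \<open>Forbidding polynomials as sets of words\<close>

lemma in_listset_iff:
  "xs \<in> listset As \<longleftrightarrow> length xs = length As \<and> (\<forall>i<length As. xs ! i \<in> As ! i)"
proof (induction As arbitrary: xs)
  case (Cons A As)
  then show ?case by (cases xs) (auto simp: set_Cons_def All_less_Suc2)
qed auto

lemma ex_monomial_word: "\<exists>w. \<forall>x. count_list w x = Poly_Mapping.lookup m (x :: 'x)"
proof -
  have "finite {x. 0 < Poly_Mapping.lookup m x}"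
    using finite_lookup[of m] by simp
  then have "count (Abs_multiset (Poly_Mapping.lookup m)) = Poly_Mapping.lookup m"
    by (simp add: count_Abs_multiset)
  moreover obtain w where "mset w = Abs_multiset (Poly_Mapping.lookup m)"
    using ex_mset by blast
  ultimately show ?thesis by (metis count_mset)
qed

text \<open>A variable is repeated according to its exponent, in an arbitrary order; the degree
  thereby becomes the length of the word.\<close>

definition monomial_word :: "('x \<Rightarrow>\<^sub>0 nat) \<Rightarrow> 'x list" where
  "monomial_word m = (SOME w. \<forall>x. count_list w x = Poly_Mapping.lookup m x)"

lemma count_monomial_word: "count_list (monomial_word m) x = Poly_Mapping.lookup m x"
  unfolding monomial_word_def using someI_ex[OF ex_monomial_word[of m]] by simp

lemma set_monomial_word: "set (monomial_word m) = Poly_Mapping.keys m"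
  by (metis count_list_0_iff count_monomial_word not_in_keys_iff_lookup_eq_zero subsetI subset_antisym)

lemma length_monomial_word:
  "length (monomial_word m) = (\<Sum>x\<in>Poly_Mapping.keys m. Poly_Mapping.lookup m x)"
  using sum_count_set[of "monomial_word m" "Poly_Mapping.keys m"]
  by (simp add: set_monomial_word count_monomial_word)

lemma inj_monomial_word: "inj monomial_word"
  by (rule injI, rule poly_mapping_eqI) (metis count_monomial_word)

lemma of_nat_bit: "(of_nat n :: bit) = of_bool (odd n)"
  by (induction n) auto

text \<open>A coefficient in the support can only be one over GF(2), and a positive power of a truth
  value is that value. So the value is the parity of the number of satisfied monomials.\<close>

lemma mp_eval_of_bool:
  "mp_eval (\<lambda>x. of_bool (y x)) p =
     of_bool (odd (card {m \<in> Poly_Mapping.keys p. \<forall>x\<in>Poly_Mapping.keys m. y x}))"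
proof -
  have 1: "(\<Prod>x\<in>Poly_Mapping.keys m. of_bool (y x) ^ Poly_Mapping.lookup m x) =
      (of_bool (\<forall>x\<in>Poly_Mapping.keys m. y x) :: bit)" for m :: "'a \<Rightarrow>\<^sub>0 nat"
  proof -
    have "(of_bool (y x) ^ Poly_Mapping.lookup m x :: bit) = of_bool (y x)"
      if "x \<in> Poly_Mapping.keys m" for x
      using that by (cases "y x") (auto simp: in_keys_iff)
    then have "(\<Prod>x\<in>Poly_Mapping.keys m. of_bool (y x) ^ Poly_Mapping.lookup m x) =
      (\<Prod>x\<in>Poly_Mapping.keys m. of_bool (y x) :: bit)"
      by simp
    also have "\<dots> = of_bool (\<forall>x\<in>Poly_Mapping.keys m. y x)"
      by (cases "\<forall>x\<in>Poly_Mapping.keys m. y x") (auto intro!: prod_zero)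
    finally show ?thesis .
  qed
  have 2: "Poly_Mapping.lookup p m = 1" if "m \<in> Poly_Mapping.keys p" for m
    using that by (cases "Poly_Mapping.lookup p m") (auto simp: in_keys_iff)
  have "mp_eval (\<lambda>x. of_bool (y x)) p =
    (\<Sum>m\<in>Poly_Mapping.keys p. of_bool (\<forall>x\<in>Poly_Mapping.keys m. y x))"
    unfolding mp_eval_def 1 using 2 by simp
  also have "\<dots> = of_nat (card {m \<in> Poly_Mapping.keys p. \<forall>x\<in>Poly_Mapping.keys m. y x})"
    by (subst sum_of_bool_eq) (auto simp: Int_def)
  finally show ?thesis by (simp add: of_nat_bit)
qed

text \<open>Variables refer to positions \<open>i\<close> in the tuple instead of vertices. The
  hypothesis is instantiated once, with \<open>X\<close> the set of positions, and the result serves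
  as a template for every tuple with these lists.\<close>

definition forbidding_words ::
  "'h graph \<Rightarrow> nat \<Rightarrow> 'h set list \<Rightarrow> 'h set \<Rightarrow> 'h list \<Rightarrow> (nat \<times> 'h) list list \<Rightarrow> bool" where
  "forbidding_words H d Ls L S ws \<longleftrightarrow> distinct ws \<and>
     (\<forall>w\<in>set ws. length w \<le> d \<and> set w \<subseteq> {..<length Ls} \<times> verts H) \<and>
     (\<forall>ss\<in>listset Ls. let n = card {w \<in> set ws. \<forall>(i, u)\<in>set w. ss ! i = u} in
        (ss = S \<longrightarrow> odd n) \<and> (has_common_nbr H L (set ss) \<longrightarrow> even n))"

lemma ex_forbidding_words:
  assumes "wf_graph H" "can_be_forbidden H d (listset Ls) L S" "length S = length Ls"
    and "\<And>A. A \<in> set Ls \<Longrightarrow> A \<subseteq> verts H"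
  shows "\<exists>ws. forbidding_words H d Ls L S ws"
proof -
  let ?r = "length Ls"
  have "finite {..<?r} \<and> distinct [0..<?r] \<and> set [0..<?r] \<subseteq> {..<?r} \<and> length [0..<?r] = length S"
    using assms(3) by auto
  then obtain p where p: "mp_in_vars ({..<?r} \<times> verts H) p" "mp_degree_le d p"
      "forbids H {..<?r} [0..<?r] (listset Ls) L S p"
    using assms(2) unfolding can_be_forbidden_def by blast
  obtain ms where ms: "distinct ms" "set ms = Poly_Mapping.keys p"
    using finite_distinct_list[OF finite_keys[of p]] by blast
  have "forbidding_words H d Ls L S (map monomial_word ms)"
    unfolding forbidding_words_def
  proof (intro conjI ballI)
    \<comment> \<open>Distinct monomials give distinct words, so passing to words preserves the
      parities.\<close>
    show "distinct (map monomial_word ms)"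
      using ms inj_on_subset[OF inj_monomial_word subset_UNIV] by (simp add: distinct_map)
    show "length w \<le> d" "set w \<subseteq> {..<?r} \<times> verts H" if "w \<in> set (map monomial_word ms)" for w
      using that ms p(1,2)
      by (auto simp: length_monomial_word set_monomial_word mp_degree_le_def mp_in_vars_def, blast+)
    fix ss assume ss: "ss \<in> listset Ls"
    then have len: "length ss = ?r" and mem: "\<And>i. i < ?r \<Longrightarrow> ss ! i \<in> verts H"
      using assms(4) by (auto simp: in_listset_iff) (metis nth_mem subsetD)
    \<comment> \<open>The choice assignment that selects the colors \<open>ss\<close>; below, its
      chosen tuple is shown to be \<open>ss\<close>.\<close>
    define y where "y = (\<lambda>(i, u). i < ?r \<and> ss ! i = u)"
    have "(\<Sum>u\<in>verts H. of_bool (y (v, u))) = (1 :: nat)" if "v < ?r" for v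
    proof -
      have "(\<Sum>u\<in>verts H. of_bool (y (v, u))) = (\<Sum>u\<in>verts H. if ss ! v = u then 1 else (0 :: nat))"
        using that by (intro sum.cong) (auto simp: y_def)
      then show ?thesis
        using assms(1) mem[OF that] by (simp add: wf_graph_def)
    qed
    then have choice: "choice_assignment H {..<?r} y"
      by (simp add: choice_assignment_def)
    have "chosen H y i = ss ! i" if "i < ?r" for i
      unfolding chosen_def using that mem[OF that] by (intro the_equality) (auto simp: y_def)
    then have map: "map (chosen H y) [0..<?r] = ss"
      using len by (intro nth_equalityI) auto
    let ?M = "{m \<in> Poly_Mapping.keys p. \<forall>x\<in>Poly_Mapping.keys m. y x}"
    have "{w \<in> set (map monomial_word ms). \<forall>(i, u)\<in>set w. ss ! i = u} = monomial_word ` ?M"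
    proof -
      have "(\<forall>(i, u)\<in>set (monomial_word m). ss ! i = u) \<longleftrightarrow> (\<forall>x\<in>Poly_Mapping.keys m. y x)"
        if "m \<in> Poly_Mapping.keys p" for m
        using that p(1) by (fastforce simp: set_monomial_word mp_in_vars_def y_def)
      then have "?M = {m \<in> Poly_Mapping.keys p. \<forall>(i, u)\<in>set (monomial_word m). ss ! i = u}"
        by (intro Collect_cong conj_cong) auto
      moreover have "{w \<in> f ` M. Q w} = f ` {m \<in> M. Q (f m)}"
        for Q and f :: "'k \<Rightarrow> 'l" and M by auto
      ultimately show ?thesis using ms by simp
    qed
    then have "card {w \<in> set (map monomial_word ms). \<forall>(i, u)\<in>set w. ss ! i = u} = card ?M"
      using card_image[OF inj_on_subset[OF inj_monomial_word subset_UNIV]] by metis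
    then show "let n = card {w \<in> set (map monomial_word ms). \<forall>(i, u)\<in>set w. ss ! i = u} in
        (ss = S \<longrightarrow> odd n) \<and> (has_common_nbr H L (set ss) \<longrightarrow> even n)"
      using mp[OF spec[OF p(3)[unfolded forbids_def], of y] choice, unfolded Let_def map mp_eval_of_bool] ss
      by (simp add: Let_def split: if_splits)
  qed
  then show ?thesis by blast
qed

section \<open>Graphs and list colorings\<close>

text \<open>If \<open>v\<close> dominates \<open>u\<close>, then \<open>u\<close> can be discarded,
  since whatever dominates \<open>v\<close> also dominates \<open>u\<close>. Of several vertices
  with equal neighborhoods only one survives.\<close>

lemma ex_incomparable_subset:
  assumes "finite A"
  shows "\<exists>B\<subseteq>A. incomparable_set H B \<and> (\<forall>a\<in>A. \<exists>b\<in>B. nbhd H a \<subseteq> nbhd H b)"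
  using assms
proof (induction "card A" arbitrary: A rule: less_induct)
  case less
  show ?case
  proof (cases "incomparable_set H A")
    case False
    then obtain u v where uv: "u \<in> A" "v \<in> A" "u \<noteq> v" "nbhd H u \<subseteq> nbhd H v"
      unfolding incomparable_set_def by metis
    have "card (A - {u}) < card A" using uv less.prems by (intro card_Diff1_less)
    then obtain B where B: "B \<subseteq> A - {u}" "incomparable_set H B"
        "\<forall>a\<in>A - {u}. \<exists>b\<in>B. nbhd H a \<subseteq> nbhd H b"
      using less.hyps[of "A - {u}"] less.prems by auto
    obtain b where "b \<in> B" "nbhd H v \<subseteq> nbhd H b" using B uv by blast
    then have "\<forall>a\<in>A. \<exists>b\<in>B. nbhd H a \<subseteq> nbhd H b" using B(3) uv by blast
    then show ?thesis using B by blast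
  qed blast
qed

lemma ex_minimal_no_common_nbr:
  assumes "finite T" "T \<subseteq> verts H" "\<not> has_common_nbr H L T"
  shows "\<exists>S\<subseteq>T. minimal_no_common_nbr H L S"
  using assms
proof (induction T rule: finite_psubset_induct)
  case (psubset T)
  show ?case
  proof (cases "\<forall>T'. T' \<subset> T \<longrightarrow> has_common_nbr H L T'")
    case True
    then show ?thesis using psubset.prems unfolding minimal_no_common_nbr_def by blast
  next
    case False
    then obtain T' where "T' \<subset> T" "\<not> has_common_nbr H L T'" by blast
    then show ?thesis using psubset.IH[of T'] psubset.prems by blast
  qed
qed

lemma card_le_c_star:
  assumes "wf_graph H" "L \<subseteq> verts H" "minimal_no_common_nbr H L S"
  shows "card S \<le> c_star H"
  unfolding c_star_def
proof (rule Max_ge)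
  have "{card S | L S. L \<subseteq> verts H \<and> minimal_no_common_nbr H L S} \<subseteq> card ` Pow (verts H)"
    by (auto simp: minimal_no_common_nbr_def)
  then show "finite {card S | L S. L \<subseteq> verts H \<and> minimal_no_common_nbr H L S}"
    by (rule finite_subset) (use assms(1) in \<open>simp add: wf_graph_def\<close>)
qed (use assms in blast)

lemma ex_minimum_vertex_cover:
  assumes "wf_graph G"
  shows "\<exists>C. vertex_cover G C \<and> card C = vc_number G"
proof -
  have fin: "finite {card C | C. vertex_cover G C}"
  proof -
    have "{card C | C. vertex_cover G C} \<subseteq> card ` Pow (verts G)"
      by (auto simp: vertex_cover_def)
    then show ?thesis
      by (rule finite_subset) (use assms in \<open>simp add: wf_graph_def\<close>)
  qed
  have "vertex_cover G (verts G)"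
    using assms by (fastforce simp: vertex_cover_def wf_graph_def)
  then have "vc_number G \<in> {card C | C. vertex_cover G C}"
    unfolding vc_number_def by (intro Min_in fin) blast
  then show ?thesis by auto
qed

lemma adj_commute: "adj G u v \<longleftrightarrow> adj G v u"
  by (simp add: adj_def insert_commute)

text \<open>Moving every vertex to a color with a larger neighborhood keeps the coloring proper, even
  when all vertices move at once.\<close>

lemma list_colorable_dominating:
  assumes "\<And>v. v \<in> verts G \<Longrightarrow> \<L>' v \<subseteq> \<L> v"
    and "\<And>v. v \<in> verts G \<Longrightarrow> \<L> v \<subseteq> verts H"
    and "\<And>v a. v \<in> verts G \<Longrightarrow> a \<in> \<L> v \<Longrightarrow> \<exists>b\<in>\<L>' v. nbhd H a \<subseteq> nbhd H b"
  shows "list_colorable H G \<L>' \<longleftrightarrow> list_colorable H G \<L>"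
proof
  assume "list_colorable H G \<L>'"
  then show "list_colorable H G \<L>" using assms(1) unfolding list_colorable_def by blast
next
  assume "list_colorable H G \<L>"
  then obtain \<phi> where \<phi>: "\<And>v. v \<in> verts G \<Longrightarrow> \<phi> v \<in> verts H \<and> \<phi> v \<in> \<L> v"
      "\<And>u v. u \<in> verts G \<Longrightarrow> v \<in> verts G \<Longrightarrow> adj G u v \<Longrightarrow> adj H (\<phi> u) (\<phi> v)"
    unfolding list_colorable_def by blast
  have "\<forall>v. \<exists>b. v \<in> verts G \<longrightarrow> b \<in> \<L>' v \<and> nbhd H (\<phi> v) \<subseteq> nbhd H b"
    using assms(3) \<phi>(1) by blast
  then obtain \<psi> where \<psi>: "\<And>v. v \<in> verts G \<Longrightarrow> \<psi> v \<in> \<L>' v \<and> nbhd H (\<phi> v) \<subseteq> nbhd H (\<psi> v)"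
    by metis
  have "adj H (\<psi> u) (\<psi> v)" if "u \<in> verts G" "v \<in> verts G" "adj G u v" for u v
  proof -
    have "\<phi> v \<in> nbhd H (\<psi> u)" using \<phi>(2)[OF that] \<psi>[OF that(1)] by (auto simp: nbhd_def)
    then have "\<psi> u \<in> nbhd H (\<phi> v)" by (simp add: nbhd_def adj_commute[of H "\<phi> v"])
    then have "\<psi> u \<in> nbhd H (\<psi> v)" using \<psi>[OF that(2)] by blast
    then show ?thesis by (simp add: nbhd_def adj_commute[of H "\<psi> v"])
  qed
  then show "list_colorable H G \<L>'"
    unfolding list_colorable_def using \<psi> assms(1,2) by blast
qed

section \<open>Finite tables of lists and polynomials\<close>

lemma dlist_enc_list [simp]: "dlist (enc_list f l) = map f l"
  by (induction l) auto

lemma enc_list_eq_encl: "enc_list f l = encl (map f l)"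
  by (induction l) auto

lemma dlist_if: "dlist (if b then x else y) = (if b then dlist x else dlist y)"
  by simp

lemma ptime_list:
  assumes "\<And>y. y \<in> set ys \<Longrightarrow> ptime (F y)"
  shows "ptime (\<lambda>x. encl (map (\<lambda>y. F y x) ys))"
  using assms
proof (induction ys)
  case Nil
  then show ?case using ptime_const[of Atom] by simp
next
  case (Cons y ys)
  then have "ptime (\<lambda>x. Pair (F y x) (encl (map (\<lambda>y. F y x) ys)))"
    by (intro ptime_intros) auto
  then show ?case by simp
qed

text \<open>In contrast to \<open>dnth\<close>, the index is a constant of the program, namely a
  position in a tuple.\<close>

definition const_nth :: "nat \<Rightarrow> data \<Rightarrow> data" where
  "const_nth i x = dfst ((dsnd ^^ i) x)"

lemma ptime_const_nth [ptime_intros]: "ptime (const_nth i)"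
proof -
  have "ptime (\<lambda>x. (dsnd ^^ i) x)"
  proof (induction i)
    case (Suc i)
    from ptime_dsnd[OF this] show ?case by simp
  qed (simp add: ptime_id)
  then have "ptime (\<lambda>x. dfst ((dsnd ^^ i) x))" by (rule ptime_dfst)
  then show ?thesis by (simp add: const_nth_def[abs_def])
qed

lemma const_nth_encl [simp]: "i < length l \<Longrightarrow> const_nth i (encl l) = l ! i"
proof (induction i arbitrary: l)
  case 0
  then show ?case by (cases l) (auto simp: const_nth_def)
next
  case (Suc i)
  then show ?case by (cases l) (auto simp: const_nth_def funpow_Suc_right simp del: funpow.simps)
qed

definition colors :: "'h graph \<Rightarrow> ('h \<Rightarrow> nat) \<Rightarrow> data \<Rightarrow> 'h set" where
  "colors H num A = {u \<in> verts H. enc_nat (num u) \<in> set (dlist A)}"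

text \<open>An encoding may list its colors in any order, so all orders are included. Repetitions
  are excluded, which makes the set finite and admits \<open>ptime_table\<close>.\<close>

definition color_lists :: "'h graph \<Rightarrow> ('h \<Rightarrow> nat) \<Rightarrow> data set" where
  "color_lists H num = enc_list enc_nat ` {l. set l \<subseteq> num ` verts H \<and> distinct l}"

lemma finite_color_lists: "wf_graph H \<Longrightarrow> finite (color_lists H num)"
  unfolding color_lists_def by (intro finite_imageI finite_subset_distinct) (simp add: wf_graph_def)

lemma colors_subset: "colors H num A \<subseteq> verts H"
  by (auto simp: colors_def)

lemma colors_enc_list: "colors H num (enc_list enc_nat l) = {u \<in> verts H. num u \<in> set l}"
  by (auto simp: colors_def)

lemma ex_color_list:
  assumes "wf_graph H" "inj_on num (verts H)" "B \<subseteq> verts H"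
  shows "\<exists>A\<in>color_lists H num. colors H num A = B"
proof -
  have "finite (num ` B)" using assms(1,3) by (auto simp: wf_graph_def intro: finite_subset)
  then obtain l where l: "set l = num ` B" "distinct l" using finite_distinct_list[of "num ` B"] by auto
  have "enc_list enc_nat l \<in> color_lists H num"
    unfolding color_lists_def using l assms(3) by (intro imageI) auto
  moreover have "colors H num (enc_list enc_nat l) = B"
  proof -
    have "colors H num (enc_list enc_nat l) = {u \<in> verts H. num u \<in> num ` B}"
      by (simp only: colors_enc_list l(1))
    then show ?thesis using inj_on_image_mem_iff[OF assms(2) _ assms(3)] assms(3) by blast
  qed
  ultimately show ?thesis by blast
qed

definition reduced_list :: "'h graph \<Rightarrow> ('h \<Rightarrow> nat) \<Rightarrow> data \<Rightarrow> data \<Rightarrow> bool" where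
  "reduced_list H num A B \<longleftrightarrow> B \<in> color_lists H num \<and> colors H num B \<subseteq> colors H num A \<and>
     incomparable_set H (colors H num B) \<and>
     (\<forall>a\<in>colors H num A. \<exists>b\<in>colors H num B. nbhd H a \<subseteq> nbhd H b)"

text \<open>No computation in \<open>H\<close> takes place: the reduced list is chosen in advance
  for each of the finitely many color lists.\<close>

lemma ex_list_reduction:
  assumes "wf_graph H" "inj_on num (verts H)"
  shows "\<exists>red. ptime red \<and> (\<forall>A\<in>color_lists H num. reduced_list H num A (red A))"
proof -
  have "\<forall>A. \<exists>B. reduced_list H num A B"
  proof
    fix A
    have "finite (colors H num A)"
      using assms(1) colors_subset[of H num A] by (auto simp: wf_graph_def intro: finite_subset)
    from ex_incomparable_subset[OF this, of H] obtain C where C: "C \<subseteq> colors H num A"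
      "incomparable_set H C" "\<forall>a\<in>colors H num A. \<exists>b\<in>C. nbhd H a \<subseteq> nbhd H b"
      by blast
    then have "C \<subseteq> verts H" using colors_subset[of H num A] by blast
    from ex_color_list[OF assms this] C show "\<exists>B. reduced_list H num A B"
      unfolding reduced_list_def by metis
  qed
  then obtain R where R: "\<And>A. reduced_list H num A (R A)" by metis
  obtain T where "ptime T" "\<forall>x. x \<in> color_lists H num \<longrightarrow> T x = R x"
    using ptime_table[where g = "\<lambda>k x. R k" and f = "\<lambda>x. x",
        OF finite_color_lists[OF assms(1)] ptime_const ptime_id] by blast
  then show ?thesis using R by metis
qed

section \<open>Polynomials instantiated at tuples of vertices\<close>

definition sat :: "('h \<Rightarrow> nat) \<Rightarrow> (data \<Rightarrow> 'h) \<Rightarrow> data \<Rightarrow> bool" where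
  "sat num \<phi> m \<longleftrightarrow> (\<forall>l\<in>set (dlist m). enc_nat (num (\<phi> (dfst l))) = dsnd l)"

text \<open>The letter \<open>Pair v (enc_nat (num u))\<close> is the variable for vertex
  \<open>v\<close> and color \<open>u\<close>, and a list of letters is a monomial.
  \<open>sat\<close> evaluates it at the choice assignment given by a coloring.\<close>

definition letters :: "'h graph \<Rightarrow> ('h \<Rightarrow> nat) \<Rightarrow> data set \<Rightarrow> data set" where
  "letters H num V = (\<lambda>(v, u). Pair v (enc_nat (num u))) ` (V \<times> verts H)"

definition words :: "nat \<Rightarrow> 'a set \<Rightarrow> 'a list set" where
  "words d A = {w. set w \<subseteq> A \<and> length w \<le> d}"

text \<open>The vectors \<open>vs\<close> express that the colors of the vertices \<open>ts\<close> have a common neighbor in the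
  list \<open>A\<close>, provided that these colors are taken from the lists \<open>Ls\<close>.\<close>

definition expresses_common_nbr ::
  "'h graph \<Rightarrow> ('h \<Rightarrow> nat) \<Rightarrow> nat \<Rightarrow> data \<Rightarrow> data list \<Rightarrow> data list \<Rightarrow> data list \<Rightarrow> bool" where
  "expresses_common_nbr H num d A Ls ts vs \<longleftrightarrow>
     (\<forall>v\<in>set vs. set (dlist v) \<subseteq> encl ` words d (letters H num (set ts))) \<and>
     (distinct ts \<longrightarrow> (\<forall>\<phi>. (\<forall>i<length ts. \<phi> (ts ! i) \<in> colors H num (Ls ! i)) \<longrightarrow>
        (has_common_nbr H (colors H num A) (\<phi> ` set ts) \<longleftrightarrow> (\<forall>v\<in>set vs. \<not> veval (sat num \<phi>) v))))"

text \<open>The renaming of variables that turns a template into a monomial: position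
  \<open>i\<close> becomes the \<open>i\<close>-th vertex of the tuple.\<close>

definition inst_word :: "('h \<Rightarrow> nat) \<Rightarrow> (nat \<times> 'h) list \<Rightarrow> data \<Rightarrow> data" where
  "inst_word num w ts = encl (map (\<lambda>(i, u). Pair (const_nth i ts) (enc_nat (num u))) w)"

definition inst_words :: "('h \<Rightarrow> nat) \<Rightarrow> (nat \<times> 'h) list list \<Rightarrow> data \<Rightarrow> data" where
  "inst_words num ws ts = encl (map (\<lambda>w. inst_word num w ts) ws)"

lemma ptime_inst_words: "ptime (inst_words num ws)"
proof -
  have "ptime (inst_word num w)" for w
    unfolding inst_word_def case_prod_unfold
    by (intro ptime_list ptime_intros)
  then show ?thesis unfolding inst_words_def by (intro ptime_list)
qed

lemma inst_word_in_words:
  assumes "length w \<le> d" "set w \<subseteq> {..<length ts} \<times> verts H"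
  shows "inst_word num w (encl ts) \<in> encl ` words d (letters H num (set ts))"
  unfolding inst_word_def words_def letters_def
  using assms by (intro imageI) fastforce

lemma sat_inst_word:
  assumes "set w \<subseteq> {..<length ts} \<times> verts H" "inj_on num (verts H)" "\<And>t. t \<in> set ts \<Longrightarrow> \<phi> t \<in> verts H"
  shows "sat num \<phi> (inst_word num w (encl ts)) \<longleftrightarrow> (\<forall>(i, u)\<in>set w. map \<phi> ts ! i = u)"
proof -
  have "enc_nat (num (\<phi> (const_nth i (encl ts)))) = enc_nat (num u) \<longleftrightarrow> map \<phi> ts ! i = u"
    if "(i, u) \<in> set w" for i u
  proof -
    have "i < length ts" "u \<in> verts H" using that assms(1) by auto
    then show ?thesis using assms(2,3) by (auto simp: inj_on_def)
  qed
  then show ?thesis by (fastforce simp: sat_def inst_word_def)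
qed

text \<open>With a repeated vertex two words could collapse and change a parity. This is why only
  tuples of distinct vertices are considered.\<close>

lemma inj_on_inst_word:
  assumes "distinct ts" "inj_on num (verts H)"
  shows "inj_on (\<lambda>w. inst_word num w (encl ts)) {w. set w \<subseteq> {..<length ts} \<times> verts H}"
proof (rule inj_onI)
  fix w w' assume w: "w \<in> {w. set w \<subseteq> {..<length ts} \<times> verts H}"
    and w': "w' \<in> {w. set w \<subseteq> {..<length ts} \<times> verts H}"
    and eq: "inst_word num w (encl ts) = inst_word num w' (encl ts)"
  let ?f = "\<lambda>(i, u). Pair (const_nth i (encl ts)) (enc_nat (num u))"
  have "inj_on ?f ({..<length ts} \<times> verts H)"
    using assms by (auto simp: inj_on_def nth_eq_iff_index_eq)
  moreover have "map ?f w = map ?f w'"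
    using arg_cong[OF eq, of dlist] by (simp add: inst_word_def)
  ultimately show "w = w'"
    using w w' by (auto intro: map_inj_on inj_on_subset)
qed

lemma veval_inst_words:
  assumes "distinct ts" "inj_on num (verts H)" "\<And>t. t \<in> set ts \<Longrightarrow> \<phi> t \<in> verts H"
    "\<And>w. w \<in> set ws \<Longrightarrow> set w \<subseteq> {..<length ts} \<times> verts H"
  shows "veval (sat num \<phi>) (inst_words num ws (encl ts)) \<longleftrightarrow>
    odd (card {w \<in> set ws. \<forall>(i, u)\<in>set w. map \<phi> ts ! i = u})"
proof -
  let ?f = "\<lambda>w. inst_word num w (encl ts)"
  have "{m \<in> set (dlist (inst_words num ws (encl ts))). sat num \<phi> m} =
      ?f ` {w \<in> set ws. sat num \<phi> (?f w)}"
    by (auto simp: inst_words_def)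
  also have "{w \<in> set ws. sat num \<phi> (?f w)} = {w \<in> set ws. \<forall>(i, u)\<in>set w. map \<phi> ts ! i = u}"
    by (intro Collect_cong conj_cong refl sat_inst_word[where H = H] assms)
  finally have eq: "{m \<in> set (dlist (inst_words num ws (encl ts))). sat num \<phi> m} =
      ?f ` {w \<in> set ws. \<forall>(i, u)\<in>set w. map \<phi> ts ! i = u}" .
  have "inj_on ?f {w \<in> set ws. \<forall>(i, u)\<in>set w. map \<phi> ts ! i = u}"
    by (rule inj_on_subset[OF inj_on_inst_word[OF assms(1,2)]]) (use assms(4) in blast)
  then have "card {m \<in> set (dlist (inst_words num ws (encl ts))). sat num \<phi> m} =
      card {w \<in> set ws. \<forall>(i, u)\<in>set w. map \<phi> ts ! i = u}"
    unfolding eq by (rule card_image)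
  then show ?thesis by (simp add: veval_def)
qed

text \<open>One template is taken for each tuple \<open>S\<close> in the product without common
  neighbor. If the chosen colors have a common neighbor, each of these polynomials vanishes;
  otherwise the one that forbids the chosen tuple itself does not.\<close>

lemma ex_expressing_vectors:
  assumes wf: "wf_graph H" and inj: "inj_on num (verts H)"
    and forb: "\<And>S. S \<in> listset (map (colors H num) Ls) \<Longrightarrow> \<not> has_common_nbr H (colors H num A) (set S) \<Longrightarrow>
        can_be_forbidden H d (listset (map (colors H num) Ls)) (colors H num A) S"
  shows "\<exists>V. ptime V \<and> (\<forall>ts. length ts = length Ls \<longrightarrow>
      expresses_common_nbr H num d A Ls ts (dlist (V (encl ts))))"
proof -
  let ?F = "listset (map (colors H num) Ls)" and ?L = "colors H num A"
  define bad where "bad = {S \<in> ?F. \<not> has_common_nbr H ?L (set S)}"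
  have "?F \<subseteq> {S. set S \<subseteq> verts H \<and> length S = length Ls}"
    using colors_subset by (fastforce simp: in_listset_iff in_set_conv_nth)
  then have "finite bad"
    using finite_lists_length_eq[of "verts H" "length Ls"] wf
    unfolding bad_def wf_graph_def by (auto intro: finite_subset)
  then obtain Ss where Ss: "set Ss = bad" using finite_list by blast
  have "\<exists>ws. forbidding_words H d (map (colors H num) Ls) ?L S ws" if "S \<in> bad" for S
    using that forb colors_subset[of H num]
    by (intro ex_forbidding_words wf) (auto simp: bad_def in_listset_iff)
  then obtain W where W: "\<And>S. S \<in> bad \<Longrightarrow> forbidding_words H d (map (colors H num) Ls) ?L S (W S)"
    by metis
  define V where "V = (\<lambda>ts. encl (map (\<lambda>S. inst_words num (W S) ts) Ss))"
  have "expresses_common_nbr H num d A Ls ts (dlist (V (encl ts)))" if len: "length ts = length Ls" for ts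
    unfolding expresses_common_nbr_def
  proof (intro conjI ballI impI allI)
    have Wd: "length w \<le> d" "set w \<subseteq> {..<length ts} \<times> verts H" if "S \<in> bad" "w \<in> set (W S)" for S w
      using W[OF that(1)] that(2) len by (auto simp: forbidding_words_def)
    show "set (dlist v) \<subseteq> encl ` words d (letters H num (set ts))" if v: "v \<in> set (dlist (V (encl ts)))" for v
    proof -
      obtain S where S: "S \<in> bad" "v = inst_words num (W S) (encl ts)"
        using v Ss by (auto simp: V_def)
      show ?thesis
        using inst_word_in_words[OF Wd[OF S(1)]] by (auto simp: S(2) inst_words_def)
    qed
    fix \<phi> assume dis: "distinct ts" and \<phi>: "\<forall>i<length ts. \<phi> (ts ! i) \<in> colors H num (Ls ! i)"
    have F: "map \<phi> ts \<in> ?F" using \<phi> len by (auto simp: in_listset_iff)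
    have \<phi>V: "\<phi> t \<in> verts H" if "t \<in> set ts" for t
      using that \<phi> colors_subset[of H num] by (auto simp: in_set_conv_nth)
    have ev: "veval (sat num \<phi>) (inst_words num (W S) (encl ts)) \<longleftrightarrow>
        odd (card {w \<in> set (W S). \<forall>(i, u)\<in>set w. map \<phi> ts ! i = u})" if "S \<in> bad" for S
      using Wd[OF that] by (intro veval_inst_words[where H = H] dis inj \<phi>V)
    show "has_common_nbr H ?L (\<phi> ` set ts) \<longleftrightarrow>
        (\<forall>v\<in>set (dlist (V (encl ts))). \<not> veval (sat num \<phi>) v)"
    proof
      assume "has_common_nbr H ?L (\<phi> ` set ts)"
      then have "even (card {w \<in> set (W S). \<forall>(i, u)\<in>set w. map \<phi> ts ! i = u})" if "S \<in> bad" for S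
        using W[OF that] F by (simp add: forbidding_words_def Let_def)
      then show "\<forall>v\<in>set (dlist (V (encl ts))). \<not> veval (sat num \<phi>) v"
        using ev Ss by (auto simp: V_def)
    next
      assume *: "\<forall>v\<in>set (dlist (V (encl ts))). \<not> veval (sat num \<phi>) v"
      show "has_common_nbr H ?L (\<phi> ` set ts)"
      proof (rule ccontr)
        assume "\<not> has_common_nbr H ?L (\<phi> ` set ts)"
        then have S: "map \<phi> ts \<in> bad" using F by (simp add: bad_def)
        \<comment> \<open>The violated polynomial is the one belonging to the actual colors.\<close>
        have "odd (card {w \<in> set (W (map \<phi> ts)). \<forall>(i, u)\<in>set w. map \<phi> ts ! i = u})"
          using W[OF S] F unfolding forbidding_words_def Let_def by blast
        then show False using * ev[OF S] S Ss by (auto simp: V_def)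
      qed
    qed
  qed
  moreover have "ptime V"
    unfolding V_def by (intro ptime_list ptime_inst_words)
  ultimately show ?thesis by blast
qed

text \<open>The key consists of color lists only, at most \<open>c\<close> of them besides
  \<open>A\<close>, and not of vertices. That leaves finitely many keys.\<close>

lemma ex_vector_table:
  assumes wf: "wf_graph H" and inj: "inj_on num (verts H)"
    and forb: "\<And>Ls L S. length Ls \<le> c \<Longrightarrow>
           (\<forall>A\<in>set Ls. A \<subseteq> verts H \<and> incomparable_set H A) \<Longrightarrow>
           L \<subseteq> verts H \<Longrightarrow> S \<in> listset Ls \<Longrightarrow> \<not> has_common_nbr H L (set S) \<Longrightarrow>
           can_be_forbidden H d (listset Ls) L S"
  shows "\<exists>tab. ptime tab \<and> (\<forall>A Ls ts. A \<in> color_lists H num \<longrightarrow> set Ls \<subseteq> color_lists H num \<longrightarrow>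
      (\<forall>B\<in>set Ls. incomparable_set H (colors H num B)) \<longrightarrow> length Ls \<le> c \<longrightarrow> length ts = length Ls \<longrightarrow>
      expresses_common_nbr H num d A Ls ts (dlist (tab (Pair (Pair A (encl Ls)) (encl ts)))))"
proof -
  define K where "K = color_lists H num \<times>
    {Ls. set Ls \<subseteq> {B \<in> color_lists H num. incomparable_set H (colors H num B)} \<and> length Ls \<le> c}"
  have "finite K"
    unfolding K_def using finite_color_lists[OF wf]
    by (intro finite_cartesian_product finite_lists_length_le) auto
  have "\<exists>V. ptime V \<and> (\<forall>ts. length ts = length Ls \<longrightarrow>
      expresses_common_nbr H num d A Ls ts (dlist (V (encl ts))))" if "(A, Ls) \<in> K" for A Ls
    using that colors_subset[of H num]
    by (intro ex_expressing_vectors wf inj forb) (auto simp: K_def)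
  then have "\<forall>k. \<exists>V. k \<in> K \<longrightarrow> ptime V \<and> (\<forall>ts. length ts = length (snd k) \<longrightarrow>
      expresses_common_nbr H num d (fst k) (snd k) ts (dlist (V (encl ts))))"
    by (metis prod.collapse)
  then obtain V where V: "\<And>k. k \<in> K \<Longrightarrow> ptime (V k)"
    "\<And>A Ls ts. (A, Ls) \<in> K \<Longrightarrow> length ts = length Ls \<Longrightarrow>
      expresses_common_nbr H num d A Ls ts (dlist (V (A, Ls) (encl ts)))"
    by (metis fst_conv snd_conv)
  let ?key = "\<lambda>k. (dfst k, dlist (dsnd k))" and ?D = "(\<lambda>(A, Ls). Pair A (encl Ls)) ` K"
  have "\<exists>T. ptime T \<and> (\<forall>x. dfst x \<in> ?D \<longrightarrow> T x = V (?key (dfst x)) (dsnd x))"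
  proof (rule ptime_table[where g = "\<lambda>k x. V (?key k) (dsnd x)" and f = dfst])
    show "finite ?D" using \<open>finite K\<close> by simp
    show "ptime (\<lambda>x. V (?key k) (dsnd x))" if "k \<in> ?D" for k
      using that V(1) by (intro ptime_compose[OF _ ptime_dsnd_id]) auto
  qed (rule ptime_dfst_id)
  then obtain T where T: "ptime T" "\<And>x. dfst x \<in> ?D \<Longrightarrow> T x = V (?key (dfst x)) (dsnd x)"
    by blast
  have "expresses_common_nbr H num d A Ls ts (dlist (T (Pair (Pair A (encl Ls)) (encl ts))))"
    if "A \<in> color_lists H num" "set Ls \<subseteq> color_lists H num"
      "\<forall>B\<in>set Ls. incomparable_set H (colors H num B)" "length Ls \<le> c" "length ts = length Ls" for A Ls ts
  proof -
    have k: "(A, Ls) \<in> K" using that by (auto simp: K_def)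
    then have "T (Pair (Pair A (encl Ls)) (encl ts)) = V (A, Ls) (encl ts)"
      by (subst T(2)) (auto intro: rev_image_eqI)
    then show ?thesis using V(2)[OF k that(5)] by simp
  qed
  then show ?thesis using T(1) by blast
qed

section \<open>The kernelization algorithm\<close>

definition neighbors :: "data list \<Rightarrow> data \<Rightarrow> data list" where
  "neighbors es w = concat (map (\<lambda>e. if dfst e = w then [dsnd e] else if dsnd e = w then [dfst e] else []) es)"

lemma ptime_neighbors [ptime_intros]:
  assumes "ptime es" "ptime w"
  shows "ptime (\<lambda>x. encl (neighbors (dlist (es x)) (w x)))"
proof -
  have "ptime (\<lambda>x. encl (concat (map (\<lambda>e. dlist (if dfst e = w x then Pair (dsnd e) Atom
      else if dsnd e = w x then Pair (dfst e) Atom else Atom)) (dlist (es x)))))"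
    by (intro ptime_intros assms assms[THEN ptime_lift])
  then show ?thesis by (simp add: neighbors_def dlist_if cong: if_cong)
qed

fun tuples :: "nat \<Rightarrow> data list \<Rightarrow> data list" where
  "tuples 0 N = [Atom]"
| "tuples (Suc r) N = tuples r N @
     concat (map (\<lambda>v. map (\<lambda>t. Pair v t) (filter (\<lambda>t. v \<notin> set (dlist t)) (tuples r N))) N)"

text \<open>The exponent \<open>r\<close> is a constant of the program: the induction runs over
  programs, so the number of about \<open>r\<close>-th power many tuples is a polynomial.\<close>

lemma ptime_tuples [ptime_intros]:
  assumes "ptime N"
  shows "ptime (\<lambda>x. encl (tuples r (dlist (N x))))"
proof (induction r)
  case 0
  then show ?case using ptime_const[of "Pair Atom Atom"] by simp
next
  case (Suc r)
  have "ptime (\<lambda>x. encl (dlist (encl (tuples r (dlist (N x)))) @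
      dlist (encl (concat (map (\<lambda>v. dlist (encl (map (\<lambda>t. Pair v t)
        (dlist (encl (filter (\<lambda>t. v \<notin> set (dlist t)) (dlist (encl (tuples r (dlist (N x))))))))))) (dlist (N x)))))))"
    by (intro ptime_intros assms assms[THEN ptime_lift] Suc Suc[THEN ptime_lift])
  then show ?case by simp
qed

lemma set_tuples:
  "t \<in> set (tuples r N) \<longleftrightarrow> distinct (dlist t) \<and> set (dlist t) \<subseteq> set N \<and> length (dlist t) \<le> r"
proof (induction r arbitrary: t)
  case 0
  show ?case by (cases t) auto
next
  case (Suc r)
  have "t \<in> set (tuples (Suc r) N) \<longleftrightarrow> t \<in> set (tuples r N) \<or>
      (\<exists>v\<in>set N. \<exists>t'\<in>set (tuples r N). v \<notin> set (dlist t') \<and> t = Pair v t')"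
    by auto
  also have "\<dots> \<longleftrightarrow> distinct (dlist t) \<and> set (dlist t) \<subseteq> set N \<and> length (dlist t) \<le> Suc r"
  proof (cases t)
    case Atom
    then show ?thesis by (simp add: Suc)
  next
    case (Pair v t')
    then show ?thesis by (simp add: Suc) linarith
  qed
  finally show ?case .
qed

text \<open>A gadget is a pair of a color list and a tuple of vertices; it stands for a new vertex with
  this list that is adjacent to these vertices.\<close>

definition vertex_rows ::
  "(data \<Rightarrow> data) \<Rightarrow> nat \<Rightarrow> data list \<Rightarrow> data list \<Rightarrow> data list \<Rightarrow> data \<Rightarrow> data list" where
  "vertex_rows tab c ls es A p =
     (if dfst p \<in> set A then [] else
      concat (map (\<lambda>t. map (\<lambda>v. Pair v (Pair (dsnd p) t))
          (dlist (tab (Pair (Pair (dsnd p) (encl (map (\<lambda>v. dnth ls v) (dlist t)))) t))))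
        (tuples c (neighbors es (dfst p)))))"

definition rows ::
  "(data \<Rightarrow> data) \<Rightarrow> nat \<Rightarrow> data list \<Rightarrow> data list \<Rightarrow> data list \<Rightarrow> data list" where
  "rows tab c ls es A = concat (map (\<lambda>p. vertex_rows tab c ls es A p) (denum ls))"

lemma ptime_vertex_rows [ptime_intros]:
  assumes "ptime tab" "ptime ls" "ptime es" "ptime A" "ptime p"
  shows "ptime (\<lambda>x. encl (vertex_rows tab c (dlist (ls x)) (dlist (es x)) (dlist (A x)) (p x)))"
proof -
  have "ptime (\<lambda>x. if p' x \<in> set (dlist (A x)) then Atom else
      encl (concat (map (\<lambda>t. dlist (encl (map (\<lambda>v. Pair v (Pair (dsnd (p x)) t))
        (dlist (tab (Pair (Pair (dsnd (p x)) (encl (map (\<lambda>v. dnth (dlist (ls x)) v) (dlist t)))) t))))))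
        (dlist (encl (tuples c (dlist (encl (neighbors (dlist (es x)) (p' x))))))))))"
    if "ptime p'" for p'
    by (intro ptime_intros assms that assms(2-)[THEN ptime_lift] assms(2-)[THEN ptime_lift, THEN ptime_lift]
        ptime_compose[OF assms(1)])
  note * = this[OF ptime_dfst[OF assms(5)]]
  have "encl (vertex_rows tab c ls es A p) = (if dfst p \<in> set A then Atom else
      encl (concat (map (\<lambda>t. dlist (encl (map (\<lambda>v. Pair v (Pair (dsnd p) t))
        (dlist (tab (Pair (Pair (dsnd p) (encl (map (\<lambda>v. dnth ls v) (dlist t)))) t))))))
        (dlist (encl (tuples c (dlist (encl (neighbors es (dfst p))))))))))" for ls es A p
    by (simp add: vertex_rows_def)
  then show ?thesis using * by simp
qed

lemma ptime_rows [ptime_intros]: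
  assumes "ptime tab" "ptime ls" "ptime es" "ptime A"
  shows "ptime (\<lambda>x. encl (rows tab c (dlist (ls x)) (dlist (es x)) (dlist (A x))))"
proof -
  have "ptime (\<lambda>x. encl (concat (map (\<lambda>p. dlist (encl (vertex_rows tab c (dlist (ls x)) (dlist (es x)) (dlist (A x)) p)))
      (dlist (encl (denum (dlist (ls x))))))))"
    by (intro ptime_intros assms assms(2-)[THEN ptime_lift])
  then show ?thesis by (simp add: rows_def)
qed

text \<open>The universe consists of the monomials that really occur. Basis rows with a common
  origin yield the same gadget several times; these copies are counted in the bound and need no
  removal.\<close>

definition gadgets :: "data list \<Rightarrow> data list" where
  "gadgets R = map (\<lambda>e. dsnd e) (dlist (gauss (encl (concat (map (\<lambda>e. dlist (dfst e)) R))) R))"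

lemma ptime_gadgets [ptime_intros]:
  assumes "ptime R"
  shows "ptime (\<lambda>x. encl (gadgets (dlist (R x))))"
  unfolding gadgets_def by (intro ptime_intros assms)

text \<open>Cover vertices are renamed to their position in \<open>A\<close>, and gadget
  \<open>j\<close> receives the number \<open>length A + j\<close>, computed by concatenating unary
  numbers. Edges of the input that leave \<open>A\<close> are dropped, the gadgets standing in for
  them.\<close>

definition kernel_edges :: "data list \<Rightarrow> data list \<Rightarrow> data list \<Rightarrow> data list" where
  "kernel_edges es A B =
     concat (map (\<lambda>e. if dfst e \<in> set A \<and> dsnd e \<in> set A
       then [Pair (dindex A (dfst e)) (dindex A (dsnd e))] else []) es) @
     concat (map (\<lambda>p. map (\<lambda>v. Pair (encl (dlist (enc_nat (length A)) @ dlist (dfst p))) (dindex A v))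
       (dlist (dsnd (dsnd p)))) (denum B))"

lemma ptime_kernel_edges [ptime_intros]:
  assumes "ptime es" "ptime A" "ptime B"
  shows "ptime (\<lambda>x. encl (kernel_edges (dlist (es x)) (dlist (A x)) (dlist (B x))))"
proof -
  have "ptime (\<lambda>x. encl (dlist (encl (concat (map (\<lambda>e. dlist (if dfst e \<in> set (dlist (A x)) \<and> dsnd e \<in> set (dlist (A x))
       then Pair (Pair (dindex (dlist (A x)) (dfst e)) (dindex (dlist (A x)) (dsnd e))) Atom else Atom)) (dlist (es x))))) @
     dlist (encl (concat (map (\<lambda>p. dlist (encl (map (\<lambda>v.
       Pair (encl (dlist (enc_nat (length (dlist (A x)))) @ dlist (dfst p))) (dindex (dlist (A x)) v))
       (dlist (dsnd (dsnd p)))))) (dlist (encl (denum (dlist (B x))))))))))"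
    by (intro ptime_intros assms assms[THEN ptime_lift] assms[THEN ptime_lift, THEN ptime_lift])
  then show ?thesis by (simp add: kernel_edges_def dlist_if cong: if_cong)
qed

definition kernelize :: "(data \<Rightarrow> data) \<Rightarrow> (data \<Rightarrow> data) \<Rightarrow> nat \<Rightarrow> data list \<Rightarrow> data list \<Rightarrow> data" where
  "kernelize red tab c ls0 es =
    (let ls = map red ls0; A = dlist (greedy_cover es); B = gadgets (rows tab c ls es A) in
     Pair (encl (map (\<lambda>v. dnth ls v) A @ map (\<lambda>g. dfst g) B)) (encl (kernel_edges es A B)))"

lemma ptime_kernelize:
  assumes "ptime red" "ptime tab"
  shows "ptime (\<lambda>x. kernelize red tab c (dlist (dfst x)) (dlist (dsnd x)))"
proof -
  define LS where "LS = (\<lambda>x. encl (map (\<lambda>l. red l) (dlist (dfst x))))"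
  define AA where "AA = (\<lambda>x. greedy_cover (dlist (dsnd x)))"
  define RR where "RR = (\<lambda>x. encl (rows tab c (dlist (LS x)) (dlist (dsnd x)) (dlist (AA x))))"
  define BB where "BB = (\<lambda>x. encl (gadgets (dlist (RR x))))"
  have LS: "ptime LS"
    unfolding LS_def by (rule ptime_map[OF ptime_compose[OF assms(1) ptime_dsnd_id] ptime_dfst_id])
  have AA: "ptime AA"
    unfolding AA_def by (rule ptime_greedy_cover[OF ptime_dsnd_id])
  have RR: "ptime RR"
    unfolding RR_def by (rule ptime_rows[OF assms(2) LS ptime_dsnd_id AA])
  have BB: "ptime BB"
    unfolding BB_def by (rule ptime_gadgets[OF RR])
  have "ptime (\<lambda>x. Pair (encl (dlist (encl (map (\<lambda>v. dnth (dlist (LS x)) v) (dlist (AA x)))) @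
      dlist (encl (map (\<lambda>g. dfst g) (dlist (BB x))))))
      (encl (kernel_edges (dlist (dsnd x)) (dlist (AA x)) (dlist (BB x)))))"
    by (rule ptime_Pair[OF ptime_append[OF ptime_map[OF ptime_dnth[OF LS[THEN ptime_lift] ptime_dsnd_id] AA]
        ptime_map[OF ptime_dfst[OF ptime_dsnd_id] BB]] ptime_kernel_edges[OF ptime_dsnd_id AA BB]])
  then show ?thesis by (simp add: kernelize_def Let_def LS_def AA_def RR_def BB_def)
qed

section \<open>Correctness and size of the kernel\<close>

lemma adj_verts: "wf_graph G \<Longrightarrow> adj G u v \<Longrightarrow> u \<in> verts G \<and> v \<in> verts G"
  unfolding wf_graph_def adj_def by (metis doubleton_eq_iff)

lemma has_common_nbr_mono: "has_common_nbr H L T \<Longrightarrow> S \<subseteq> T \<Longrightarrow> has_common_nbr H L S"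
  unfolding has_common_nbr_def by blast

definition cover_coloring ::
  "'h graph \<Rightarrow> 'a graph \<Rightarrow> ('a \<Rightarrow> 'h set) \<Rightarrow> 'a set \<Rightarrow> ('a \<Rightarrow> 'h) \<Rightarrow> bool" where
  "cover_coloring H G \<L> P \<phi> \<longleftrightarrow>
     (\<forall>v\<in>P. \<phi> v \<in> \<L> v) \<and> (\<forall>u\<in>P. \<forall>v\<in>P. adj G u v \<longrightarrow> adj H (\<phi> u) (\<phi> v)) \<and>
     (\<forall>w\<in>verts G - P. has_common_nbr H (\<L> w) (\<phi> ` {u. adj G w u}))"

text \<open>There is neither an edge nor a loop outside a vertex cover, so the remaining vertices
  can be colored independently of each other once the cover is colored.\<close>

lemma list_colorable_cover:
  assumes "list_instance H G \<L>" "vertex_cover G P"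
  shows "list_colorable H G \<L> \<longleftrightarrow> (\<exists>\<phi>. cover_coloring H G \<L> P \<phi>)"
proof
  assume "list_colorable H G \<L>"
  then obtain \<phi> where \<phi>: "\<And>v. v \<in> verts G \<Longrightarrow> \<phi> v \<in> \<L> v"
      "\<And>u v. u \<in> verts G \<Longrightarrow> v \<in> verts G \<Longrightarrow> adj G u v \<Longrightarrow> adj H (\<phi> u) (\<phi> v)"
    unfolding list_colorable_def by blast
  have "has_common_nbr H (\<L> w) (\<phi> ` {u. adj G w u})" if "w \<in> verts G" for w
    using \<phi> that adj_verts[of G w] assms(1) unfolding has_common_nbr_def list_instance_def by blast
  then have "cover_coloring H G \<L> P \<phi>"
    using \<phi> assms(2) unfolding cover_coloring_def vertex_cover_def by blast
  then show "\<exists>\<phi>. cover_coloring H G \<L> P \<phi>" by blast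
next
  assume "\<exists>\<phi>. cover_coloring H G \<L> P \<phi>"
  then obtain \<phi> where \<phi>: "\<And>v. v \<in> P \<Longrightarrow> \<phi> v \<in> \<L> v"
      "\<And>u v. u \<in> P \<Longrightarrow> v \<in> P \<Longrightarrow> adj G u v \<Longrightarrow> adj H (\<phi> u) (\<phi> v)"
      "\<And>w. w \<in> verts G - P \<Longrightarrow> has_common_nbr H (\<L> w) (\<phi> ` {u. adj G w u})"
    unfolding cover_coloring_def by blast
  have "\<forall>w. \<exists>b. w \<in> verts G - P \<longrightarrow> b \<in> \<L> w \<and> (\<forall>u. adj G w u \<longrightarrow> adj H b (\<phi> u))"
    using \<phi>(3) unfolding has_common_nbr_def by blast
  then obtain b where b: "\<And>w. w \<in> verts G - P \<Longrightarrow> b w \<in> \<L> w"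
      "\<And>w u. w \<in> verts G - P \<Longrightarrow> adj G w u \<Longrightarrow> adj H (b w) (\<phi> u)"
    by metis
  define \<psi> where "\<psi> = (\<lambda>v. if v \<in> P then \<phi> v else b v)"
  have "adj H (\<psi> u) (\<psi> v)" if "u \<in> verts G" "v \<in> verts G" "adj G u v" for u v
  proof -
    have "u \<in> P \<or> v \<in> P" using assms(2) that(3) by (auto simp: vertex_cover_def adj_def)
    then consider "u \<in> P" "v \<in> P" | "u \<notin> P" "v \<in> P" | "u \<in> P" "v \<notin> P" by blast
    then show ?thesis
    proof cases
      case 1
      then show ?thesis using \<phi>(2) that by (simp add: \<psi>_def)
    next
      case 2
      then show ?thesis using b(2) that by (simp add: \<psi>_def)
    next
      case 3
      have "adj G v u" using that(3) by (simp add: adj_commute[of G v])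
      then have "adj H (b v) (\<phi> u)" using b(2) that 3 by simp
      then show ?thesis using 3 by (simp add: \<psi>_def adj_commute[of H "\<phi> u"])
    qed
  qed
  moreover have "\<psi> v \<in> \<L> v" if "v \<in> verts G" for v
    using that \<phi>(1) b(1) by (simp add: \<psi>_def)
  moreover have "\<L> v \<subseteq> verts H" if "v \<in> verts G" for v
    using that assms(1) by (simp add: list_instance_def)
  ultimately show "list_colorable H G \<L>"
    unfolding list_colorable_def by blast
qed

definition nat_of :: "data \<Rightarrow> nat" where
  "nat_of x = length (dlist x)"

lemma nat_of_enc_nat [simp]: "nat_of (enc_nat n) = n"
  by (simp add: nat_of_def enc_nat_eq_encl)

lemma color_list_decode:
  assumes "A \<in> color_lists H num" "inj_on num (verts H)"
  shows "enc_list enc_nat (map nat_of (dlist A)) = A" "distinct (map nat_of (dlist A))"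
    "set (map nat_of (dlist A)) = num ` colors H num A"
proof -
  obtain l where l: "A = enc_list enc_nat l" "distinct l" "set l \<subseteq> num ` verts H"
    using assms(1) by (auto simp: color_lists_def)
  then have dec: "map nat_of (dlist A) = l" by (simp add: comp_def)
  show "enc_list enc_nat (map nat_of (dlist A)) = A" "distinct (map nat_of (dlist A))"
    unfolding dec using l by simp_all
  show "set (map nat_of (dlist A)) = num ` colors H num A"
    unfolding dec l(1) colors_enc_list using l(3) by auto
qed

text \<open>Adding one makes the base positive, so that each of the \<open>d + 1\<close> powers is
  at most the highest one, also for \<open>k = 0\<close>.\<close>

lemma card_words:
  assumes "finite A" "card A \<le> k"
  shows "card (words d A) \<le> (d + 1) * (k + 1) ^ d"
proof -
  have "card (words d A) = (\<Sum>i\<le>d. card A ^ i)"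
    unfolding words_def using assms(1) by (rule card_lists_length_le)
  also have "\<dots> \<le> (\<Sum>i\<le>d. (k + 1) ^ d)"
  proof (rule sum_mono)
    fix i assume "i \<in> {..d}"
    have "card A ^ i \<le> (k + 1) ^ i" using assms(2) by (intro power_mono) auto
    also have "\<dots> \<le> (k + 1) ^ d" using \<open>i \<in> {..d}\<close> by (intro power_increasing) auto
    finally show "card A ^ i \<le> (k + 1) ^ d" .
  qed
  finally show ?thesis by simp
qed

lemma finite_words: "finite A \<Longrightarrow> finite (words d A)"
  unfolding words_def by (rule finite_lists_length_le)

text \<open>One encoded input is fixed. Running time is settled at this point, and the tables enter
  only through the properties of their entries.\<close>

locale kernel_instance =
  fixes H :: "'h graph" and num :: "'h \<Rightarrow> nat" and d :: nat
    and red tab :: "data \<Rightarrow> data"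
    and G :: "nat graph" and \<L> :: "nat \<Rightarrow> 'h set"
    and ls0 :: "nat list list" and es :: "(nat \<times> nat) list"
  assumes wf_H: "wf_graph H" and inj: "inj_on num (verts H)"
    and red: "A \<in> color_lists H num \<Longrightarrow> reduced_list H num A (red A)"
    and tab: "A \<in> color_lists H num \<Longrightarrow> set Ls \<subseteq> color_lists H num \<Longrightarrow>
      (\<forall>B\<in>set Ls. incomparable_set H (colors H num B)) \<Longrightarrow> length Ls \<le> c_star H \<Longrightarrow>
      length ts = length Ls \<Longrightarrow>
      expresses_common_nbr H num d A Ls ts (dlist (tab (Pair (Pair A (encl Ls)) (encl ts))))"
    and inst: "list_instance H G \<L>"
    and verts_G: "verts G = {..<length ls0}"
    and lists_G: "v < length ls0 \<Longrightarrow> distinct (ls0 ! v) \<and> set (ls0 ! v) = num ` \<L> v"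
    and distinct_es: "distinct (map (\<lambda>(u, v). {u, v}) es)"
    and edges_G: "edges G = (\<lambda>(u, v). {u, v}) ` set es"
begin

definition "n = length ls0"
definition "ls = map red (map (enc_list enc_nat) ls0)"
definition "E = map enc_edge es"
definition "A = dlist (greedy_cover E)"
definition "R = rows tab (c_star H) ls E A"
definition "B = gadgets R"
definition "C v = colors H num (ls ! v)"
definition "av = map nat_of A"

lemma wf_G: "wf_graph G"
  using inst by (simp add: list_instance_def)

lemma color_list_input:
  assumes "v < n"
  shows "enc_list enc_nat (ls0 ! v) \<in> color_lists H num"
    and "colors H num (enc_list enc_nat (ls0 ! v)) = \<L> v"
proof -
  have v: "\<L> v \<subseteq> verts H" "distinct (ls0 ! v)" "set (ls0 ! v) = num ` \<L> v"
    using assms inst lists_G[of v] verts_G by (auto simp: list_instance_def n_def)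
  show "enc_list enc_nat (ls0 ! v) \<in> color_lists H num"
    unfolding color_lists_def using v by (intro imageI) auto
  show "colors H num (enc_list enc_nat (ls0 ! v)) = \<L> v"
    unfolding colors_enc_list v(3) using inj_on_image_mem_iff[OF inj _ v(1)] v(1) by blast
qed

lemma length_ls [simp]: "length ls = n"
  by (simp add: ls_def n_def)

lemma reduced:
  assumes "v < n"
  shows "ls ! v \<in> color_lists H num" "C v \<subseteq> \<L> v" "incomparable_set H (C v)"
    "\<And>a. a \<in> \<L> v \<Longrightarrow> \<exists>b\<in>C v. nbhd H a \<subseteq> nbhd H b"
proof -
  have "ls ! v = red (enc_list enc_nat (ls0 ! v))"
    using assms by (simp add: ls_def n_def)
  then have "reduced_list H num (enc_list enc_nat (ls0 ! v)) (ls ! v)"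
    using red[OF color_list_input(1)[OF assms]] by simp
  then show "ls ! v \<in> color_lists H num" "C v \<subseteq> \<L> v" "incomparable_set H (C v)"
    "\<And>a. a \<in> \<L> v \<Longrightarrow> \<exists>b\<in>C v. nbhd H a \<subseteq> nbhd H b"
    unfolding reduced_list_def C_def color_list_input(2)[OF assms] by blast+
qed

lemma colorable_reduced: "list_colorable H G C \<longleftrightarrow> list_colorable H G \<L>"
  using reduced inst verts_G
  by (intro list_colorable_dominating) (auto simp: n_def list_instance_def)

lemma instance_reduced: "list_instance H G C"
  using wf_G colors_subset[of H num] by (auto simp: list_instance_def C_def)

lemma edge_verts:
  assumes "(u, v) \<in> set es"
  shows "u < n" "v < n" "adj G u v"
proof -
  show "adj G u v" using assms by (force simp: adj_def edges_G)
  then show "u < n" "v < n" using adj_verts[OF wf_G] verts_G by (auto simp: n_def)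
qed

lemma adj_iff: "adj G u v \<longleftrightarrow> (u, v) \<in> set es \<or> (v, u) \<in> set es"
  by (auto simp: adj_def edges_G doubleton_eq_iff)

lemma A_eq: "A = map enc_nat av"
  and distinct_av: "distinct av"
  and set_av: "set av \<subseteq> {..<n}"
  and cover_av: "vertex_cover G (set av)"
  and length_av: "length av \<le> 2 * vc_number G"
proof -
  have sub: "set A \<subseteq> enc_nat ` {..<n}"
  proof
    fix x assume "x \<in> set A"
    then obtain e where "e \<in> set E" "x = dfst e \<or> x = dsnd e"
      using greedy_cover(2)[of E] unfolding A_def by blast
    then show "x \<in> enc_nat ` {..<n}"
      using edge_verts(1,2) by (auto simp: E_def enc_edge_def)
  qed
  \<comment> \<open>Every element of \<open>A\<close> encodes a number, so decoding loses
    nothing.\<close>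
  then have "map (\<lambda>x. enc_nat (nat_of x)) A = A"
    by (intro map_idI) auto
  then show A_eq: "A = map enc_nat av"
    by (simp add: av_def comp_def)
  have "distinct A" unfolding A_def by (rule greedy_cover(1))
  then show "distinct av" unfolding A_eq by (simp add: distinct_map)
  show "set av \<subseteq> {..<n}" using sub unfolding A_eq by auto
  have "u \<in> set av \<or> v \<in> set av" if "(u, v) \<in> set es" for u v
  proof -
    have "enc_edge (u, v) \<in> set E" using that by (simp add: E_def)
    from greedy_cover(3)[OF this] show ?thesis
      unfolding A_def[symmetric] A_eq by (auto simp: enc_edge_def)
  qed
  then show "vertex_cover G (set av)"
    using \<open>set av \<subseteq> {..<n}\<close> unfolding vertex_cover_def verts_G edges_G n_def by auto
  obtain D where D: "vertex_cover G D" "card D = vc_number G"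
    using ex_minimum_vertex_cover[OF wf_G] by blast
  have fin: "finite D" using D(1) verts_G by (auto simp: vertex_cover_def intro: finite_subset)
  \<comment> \<open>The greedy cover is compared with the encoded vertices of a minimum vertex
    cover.\<close>
  have "length A \<le> 2 * card (enc_nat ` D)"
    unfolding A_def
  proof (rule greedy_cover(4))
    fix e assume "e \<in> set E"
    then obtain u v where uv: "(u, v) \<in> set es" "e = enc_edge (u, v)" by (auto simp: E_def)
    then have "{u, v} \<in> edges G" by (force simp: edges_G)
    then have "{u, v} \<inter> D \<noteq> {}" using D(1) unfolding vertex_cover_def by blast
    then show "dfst e \<in> enc_nat ` D \<or> dsnd e \<in> enc_nat ` D" using uv(2) by (auto simp: enc_edge_def)
  qed (use fin in simp)
  also have "card (enc_nat ` D) \<le> card D" using fin by (rule card_image_le)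
  finally show "length av \<le> 2 * vc_number G" using D(2) unfolding A_eq by simp
qed

lemma set_neighbors: "set (neighbors E (enc_nat w)) = enc_nat ` {u. adj G w u}"
proof (rule set_eqI)
  fix x
  have "x \<in> set (neighbors E (enc_nat w)) \<longleftrightarrow> (\<exists>e\<in>set es. x \<in> set (if fst e = w then [enc_nat (snd e)]
      else if snd e = w then [enc_nat (fst e)] else []))"
    unfolding neighbors_def E_def enc_edge_def by auto
  also have "\<dots> \<longleftrightarrow> (\<exists>u. x = enc_nat u \<and> ((w, u) \<in> set es \<or> (u, w) \<in> set es))"
  proof safe
    fix u v assume "(u, v) \<in> set es" "x \<in> set (if fst (u, v) = w then [enc_nat (snd (u, v))]
      else if snd (u, v) = w then [enc_nat (fst (u, v))] else [])"
    then show "\<exists>u. x = enc_nat u \<and> ((w, u) \<in> set es \<or> (u, w) \<in> set es)"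
      by (cases "u = w"; cases "v = w") auto
  next
    fix u assume "(w, u) \<in> set es"
    then show "\<exists>e\<in>set es. enc_nat u \<in> set (if fst e = w then [enc_nat (snd e)]
      else if snd e = w then [enc_nat (fst e)] else [])"
      by (intro bexI[of _ "(w, u)"]) auto
  next
    fix u assume "(u, w) \<in> set es"
    then show "\<exists>e\<in>set es. enc_nat u \<in> set (if fst e = w then [enc_nat (snd e)]
      else if snd e = w then [enc_nat (fst e)] else [])"
      by (intro bexI[of _ "(u, w)"]) auto
  qed
  finally show "x \<in> set (neighbors E (enc_nat w)) \<longleftrightarrow> x \<in> enc_nat ` {u. adj G w u}"
    unfolding adj_iff by auto
qed

lemma neighbor_in_av: "w \<notin> set av \<Longrightarrow> adj G w u \<Longrightarrow> u \<in> set av"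
  using cover_av by (auto simp: vertex_cover_def adj_def)

definition tuple_at :: "nat \<Rightarrow> nat list \<Rightarrow> bool" where
  "tuple_at w us \<longleftrightarrow> w < n \<and> w \<notin> set av \<and> distinct us \<and> set us \<subseteq> {u. adj G w u} \<and> length us \<le> c_star H"

definition vecs :: "nat \<Rightarrow> nat list \<Rightarrow> data list" where
  "vecs w us = dlist (tab (Pair (Pair (ls ! w) (encl (map (\<lambda>v. ls ! v) us))) (encl (map enc_nat us))))"

definition gadget :: "nat \<Rightarrow> nat list \<Rightarrow> data" where
  "gadget w us = Pair (ls ! w) (encl (map enc_nat us))"

lemma tuple_at_subset: "tuple_at w us \<Longrightarrow> set us \<subseteq> set av"
  using neighbor_in_av by (auto simp: tuple_at_def)

lemma tuple_at_less: "tuple_at w us \<Longrightarrow> v \<in> set us \<Longrightarrow> v < n"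
  using tuple_at_subset set_av by blast

lemma tuples_neighbors:
  assumes "w < n" "w \<notin> set av"
  shows "t \<in> set (tuples (c_star H) (neighbors E (enc_nat w))) \<longleftrightarrow> (\<exists>us. tuple_at w us \<and> t = encl (map enc_nat us))"
proof
  assume "t \<in> set (tuples (c_star H) (neighbors E (enc_nat w)))"
  then have t: "distinct (dlist t)" "set (dlist t) \<subseteq> enc_nat ` {u. adj G w u}" "length (dlist t) \<le> c_star H"
    unfolding set_tuples set_neighbors by auto
  define us where "us = map nat_of (dlist t)"
  have "map (\<lambda>x. enc_nat (nat_of x)) (dlist t) = dlist t"
    using t(2) by (intro map_idI) auto
  then have us: "dlist t = map enc_nat us" by (simp add: us_def comp_def)
  moreover have "set us \<subseteq> {u. adj G w u}" using t(2) unfolding us by auto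
  ultimately have "tuple_at w us" using t assms by (auto simp: tuple_at_def distinct_map)
  moreover have "t = encl (map enc_nat us)" using encl_dlist[of t] us by simp
  ultimately show "\<exists>us. tuple_at w us \<and> t = encl (map enc_nat us)" by blast
next
  assume "\<exists>us. tuple_at w us \<and> t = encl (map enc_nat us)"
  then show "t \<in> set (tuples (c_star H) (neighbors E (enc_nat w)))"
    using assms unfolding set_tuples set_neighbors by (force simp: tuple_at_def distinct_map inj_on_def)
qed

lemma set_R: "e \<in> set R \<longleftrightarrow> (\<exists>w us v. tuple_at w us \<and> v \<in> set (vecs w us) \<and> e = Pair v (gadget w us))"
proof -
  have look: "map (\<lambda>v. dnth ls v) (map enc_nat us) = map (\<lambda>v. ls ! v) us" if "tuple_at w us" for w us
    using tuple_at_less[OF that] by simp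
  then have *: "e \<in> set (vertex_rows tab (c_star H) ls E A (Pair (enc_nat w) (ls ! w))) \<longleftrightarrow>
      (\<exists>us v. tuple_at w us \<and> v \<in> set (vecs w us) \<and> e = Pair v (gadget w us))" if "w < n" for w
  proof (cases "w \<in> set av")
    case True
    then show ?thesis by (auto simp: vertex_rows_def A_eq tuple_at_def)
  next
    case False
    then have "e \<in> set (vertex_rows tab (c_star H) ls E A (Pair (enc_nat w) (ls ! w))) \<longleftrightarrow>
        (\<exists>t\<in>set (tuples (c_star H) (neighbors E (enc_nat w))).
          \<exists>v\<in>set (dlist (tab (Pair (Pair (ls ! w) (encl (map (\<lambda>v. dnth ls v) (dlist t)))) t))).
            e = Pair v (Pair (ls ! w) t))"
      unfolding vertex_rows_def A_eq by auto
    also have "\<dots> \<longleftrightarrow> (\<exists>us. tuple_at w us \<and> (\<exists>v\<in>set (vecs w us). e = Pair v (gadget w us)))"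
      unfolding Bex_def tuples_neighbors[OF that False] vecs_def gadget_def
      using look by (metis (no_types, lifting) dlist_encl)
    finally show ?thesis by blast
  qed
  show ?thesis
    unfolding R_def rows_def using * by (auto simp: set_denum) (auto simp: tuple_at_def)
qed


definition extend :: "(nat \<Rightarrow> 'h) \<Rightarrow> data \<Rightarrow> 'h" where
  "extend \<phi> x = \<phi> (nat_of x)"

lemma vecs_express:
  assumes "tuple_at w us"
  shows "expresses_common_nbr H num d (ls ! w) (map (\<lambda>v. ls ! v) us) (map enc_nat us) (vecs w us)"
  unfolding vecs_def
proof (rule tab)
  show "ls ! w \<in> color_lists H num" using assms reduced(1) by (simp add: tuple_at_def)
  show "set (map (\<lambda>v. ls ! v) us) \<subseteq> color_lists H num"
    using reduced(1) tuple_at_less[OF assms] by auto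
  show "\<forall>B\<in>set (map (\<lambda>v. ls ! v) us). incomparable_set H (colors H num B)"
    using reduced(3) tuple_at_less[OF assms] by (auto simp: C_def)
  show "length (map (\<lambda>v. ls ! v) us) \<le> c_star H" using assms by (simp add: tuple_at_def)
qed simp

text \<open>The colors must come from the reduced lists: only then does the chosen tuple lie in the
  product for which the polynomials were built.\<close>

lemma vecs_veval:
  assumes "tuple_at w us" "\<And>v. v \<in> set av \<Longrightarrow> \<phi> v \<in> C v"
  shows "has_common_nbr H (C w) (\<phi> ` set us) \<longleftrightarrow> (\<forall>v\<in>set (vecs w us). \<not> veval (sat num (extend \<phi>)) v)"
proof -
  have "distinct (map enc_nat us)" using assms(1) by (simp add: tuple_at_def distinct_map inj_on_def)
  moreover have "\<forall>i<length (map enc_nat us). extend \<phi> (map enc_nat us ! i) \<in> colors H num (map (\<lambda>v. ls ! v) us ! i)"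
  proof (intro allI impI)
    fix i assume i: "i < length (map enc_nat us)"
    then have "us ! i \<in> set av" using tuple_at_subset[OF assms(1)] by auto
    from assms(2)[OF this] show "extend \<phi> (map enc_nat us ! i) \<in> colors H num (map (\<lambda>v. ls ! v) us ! i)"
      using i by (simp add: extend_def C_def)
  qed
  moreover have "extend \<phi> ` set (map enc_nat us) = \<phi> ` set us"
    by (auto simp: extend_def image_image)
  ultimately show ?thesis
    using vecs_express[OF assms(1)] unfolding expresses_common_nbr_def C_def by metis
qed

section \<open>Coloring the gadgets is equivalent to extending the coloring\<close>

definition "U = encl (concat (map (\<lambda>e. dlist (dfst e)) R))"

lemma row_subset_U: "e \<in> set R \<Longrightarrow> set (dlist (dfst e)) \<subseteq> set (dlist U)"
  by (auto simp: U_def)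

lemma set_B: "set B = dsnd ` set (dlist (gauss U R))"
  by (simp add: B_def gadgets_def U_def)

lemma gadget_in_B:
  assumes "g \<in> set B"
  shows "\<exists>w us. tuple_at w us \<and> g = gadget w us"
proof -
  have "g \<in> dsnd ` set R" using gauss_subset[of R U] row_subset_U assms unfolding set_B by blast
  then obtain e where "e \<in> set R" "g = dsnd e" by blast
  then show ?thesis unfolding set_R by (metis dsnd.simps(2))
qed

definition gadget_ok :: "(nat \<Rightarrow> 'h) \<Rightarrow> data \<Rightarrow> bool" where
  "gadget_ok \<phi> g \<longleftrightarrow> has_common_nbr H (colors H num (dfst g)) (\<phi> ` nat_of ` set (dlist (dsnd g)))"

lemma gadget_ok_gadget [simp]: "gadget_ok \<phi> (gadget w us) \<longleftrightarrow> has_common_nbr H (C w) (\<phi> ` set us)"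
  by (simp add: gadget_ok_def gadget_def C_def image_image)

definition coloring_av :: "(nat \<Rightarrow> 'h) \<Rightarrow> bool" where
  "coloring_av \<phi> \<longleftrightarrow> (\<forall>v\<in>set av. \<phi> v \<in> C v) \<and> (\<forall>u\<in>set av. \<forall>v\<in>set av. adj G u v \<longrightarrow> adj H (\<phi> u) (\<phi> v))"

text \<open>A failure at \<open>w\<close> would make some row nonzero at the coloring. But that row
  lies in the span of the kept rows, all of which vanish because their gadgets can be
  colored.\<close>

lemma extends_if_gadgets_ok:
  assumes \<phi>: "\<And>v. v \<in> set av \<Longrightarrow> \<phi> v \<in> C v" and B: "\<And>g. g \<in> set B \<Longrightarrow> gadget_ok \<phi> g"
    and w: "w < n" "w \<notin> set av"
  shows "has_common_nbr H (C w) (\<phi> ` {u. adj G w u})"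
proof (rule ccontr)
  let ?N = "{u. adj G w u}"
  assume *: "\<not> has_common_nbr H (C w) (\<phi> ` ?N)"
  have N: "?N \<subseteq> set av" using neighbor_in_av[OF w(2)] by blast
  then have "\<phi> ` ?N \<subseteq> verts H" using \<phi> colors_subset[of H num] by (auto simp: C_def)
  moreover have "finite (\<phi> ` ?N)" using N by (auto intro: finite_subset)
  ultimately obtain S where S: "S \<subseteq> \<phi> ` ?N" "minimal_no_common_nbr H (C w) S"
    using ex_minimal_no_common_nbr[OF _ _ *] by blast
  \<comment> \<open>One neighbor per color of \<open>S\<close> is enough; thus the tuple has
    \<open>card S\<close> entries, at most \<open>c_star H\<close>, and is among those that the
    algorithm has enumerated.\<close>
  then obtain T where T: "T \<subseteq> ?N" "inj_on \<phi> T" "S = \<phi> ` T"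
    by (auto simp: subset_image_inj)
  have finT: "finite T" using T(1) N by (auto intro: finite_subset)
  obtain us where us: "set us = T" "distinct us" using finite_distinct_list[OF finT] by blast
  have "card S \<le> c_star H"
    using S(2) colors_subset[of H num] by (intro card_le_c_star[OF wf_H]) (auto simp: C_def)
  then have "length us \<le> c_star H"
    using us T(2,3) by (simp add: card_image distinct_card[symmetric])
  then have t: "tuple_at w us" using us T(1) w by (auto simp: tuple_at_def)
  have "\<not> has_common_nbr H (C w) (\<phi> ` set us)"
    using S(2) us(1) T(3) by (simp add: minimal_no_common_nbr_def)
  then obtain v where v: "v \<in> set (vecs w us)" "veval (sat num (extend \<phi>)) v"
    using vecs_veval[OF t \<phi>] by blast
  have R: "Pair v (gadget w us) \<in> set R" using t v(1) by (auto simp: set_R)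
  \<comment> \<open>A colorable gadget makes all vectors of its tuple vanish, hence every row with
    that origin, as \<open>gauss_spanning\<close> demands.\<close>
  have "\<not> veval (sat num (extend \<phi>)) (dfst e)" if e: "e \<in> set R" "dsnd e \<in> dsnd ` set (dlist (gauss U R))" for e
  proof -
    obtain w' us' v' where e': "tuple_at w' us'" "v' \<in> set (vecs w' us')" "e = Pair v' (gadget w' us')"
      using e(1) by (auto simp: set_R)
    have "gadget_ok \<phi> (dsnd e)" using e(2) B unfolding set_B by blast
    then have "has_common_nbr H (C w') (\<phi> ` set us')" using e'(3) by simp
    then show ?thesis using vecs_veval[OF e'(1) \<phi>] e'(2,3) by simp
  qed
  then have "\<not> veval (sat num (extend \<phi>)) (dfst (Pair v (gadget w us)))"
    by (intro gauss_spanning[OF row_subset_U _ R])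
  then show False using v(2) by simp
qed

lemma cover_coloring_iff:
  "cover_coloring H G C (set av) \<phi> \<longleftrightarrow> coloring_av \<phi> \<and> (\<forall>g\<in>set B. gadget_ok \<phi> g)"
proof -
  have "gadget_ok \<phi> g"
    if ok: "\<forall>w\<in>verts G - set av. has_common_nbr H (C w) (\<phi> ` {u. adj G w u})" and g: "g \<in> set B" for g
  proof -
    obtain w us where wu: "tuple_at w us" "g = gadget w us" using gadget_in_B[OF g] by blast
    then have "has_common_nbr H (C w) (\<phi> ` {u. adj G w u})"
      using ok by (simp add: tuple_at_def verts_G n_def)
    then have "has_common_nbr H (C w) (\<phi> ` set us)"
      by (rule has_common_nbr_mono) (use wu in \<open>auto simp: tuple_at_def\<close>)
    then show ?thesis using wu by simp
  qed
  moreover have "has_common_nbr H (C w) (\<phi> ` {u. adj G w u})"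
    if "coloring_av \<phi>" "\<forall>g\<in>set B. gadget_ok \<phi> g" "w \<in> verts G - set av" for w
    using that by (intro extends_if_gadgets_ok) (auto simp: coloring_av_def verts_G n_def)
  ultimately show ?thesis
    unfolding cover_coloring_def coloring_av_def by blast
qed

lemma length_B: "length B \<le> (d + 1) * (length av * card (verts H) + 1) ^ d"
proof -
  let ?\<Lambda> = "letters H num (set A)"
  have fin: "finite ?\<Lambda>" using wf_H by (simp add: letters_def wf_graph_def)
  have "card ?\<Lambda> \<le> card (set A \<times> verts H)"
    unfolding letters_def by (rule card_image_le) (use wf_H in \<open>simp add: wf_graph_def\<close>)
  also have "\<dots> \<le> length av * card (verts H)"
    unfolding A_eq card_cartesian_product
    using card_length[of "map enc_nat av"] by (intro mult_le_mono1) simp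
  finally have \<Lambda>: "card ?\<Lambda> \<le> length av * card (verts H)" .
  have "set (dlist U) \<subseteq> encl ` words d ?\<Lambda>"
  proof
    fix m assume "m \<in> set (dlist U)"
    then obtain w us v where t: "tuple_at w us" and v: "v \<in> set (vecs w us)" "m \<in> set (dlist v)"
      by (auto simp: U_def set_R)
    have "m \<in> encl ` words d (letters H num (set (map enc_nat us)))"
      using vecs_express[OF t] v unfolding expresses_common_nbr_def by blast
    moreover have "letters H num (set (map enc_nat us)) \<subseteq> ?\<Lambda>"
      using tuple_at_subset[OF t] unfolding A_eq letters_def
      by (intro image_mono Sigma_mono) auto
    then have "words d (letters H num (set (map enc_nat us))) \<subseteq> words d ?\<Lambda>"
      by (auto simp: words_def)
    ultimately show "m \<in> encl ` words d ?\<Lambda>" by blast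
  qed
  then have "card (set (dlist U)) \<le> card (encl ` words d ?\<Lambda>)"
    by (intro card_mono finite_imageI finite_words fin)
  also have "\<dots> \<le> card (words d ?\<Lambda>)"
    by (intro card_image_le finite_words fin)
  also have "\<dots> \<le> (d + 1) * (length av * card (verts H) + 1) ^ d"
    by (rule card_words[OF fin \<Lambda>])
  finally show ?thesis
    using length_gauss[of R U] row_subset_U by (simp add: B_def gadgets_def U_def[symmetric])
qed

section \<open>The output graph and its encoding\<close>

definition "m = length av"
definition "iv v = nat_of (dindex A (enc_nat v))"
definition "members j = map nat_of (dlist (dsnd (B ! j)))"
definition "es' = map (\<lambda>(u, v). (iv u, iv v)) (filter (\<lambda>(u, v). u \<in> set av \<and> v \<in> set av) es) @
  concat (map (\<lambda>j. map (\<lambda>v. (m + j, iv v)) (members j)) [0..<length B])"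
definition "ls' = map (\<lambda>v. dnth ls v) A @ map (\<lambda>g. dfst g) B"
definition "\<L>' i = colors H num (ls' ! i)"
definition "G' = \<lparr>verts = {..<m + length B}, edges = (\<lambda>(u, v). {u, v}) ` set es'\<rparr>"

lemma dindex_av: "i < m \<Longrightarrow> dindex A (enc_nat (av ! i)) = enc_nat i"
proof -
  assume i: "i < m"
  have "distinct A" unfolding A_eq using distinct_av by (simp add: distinct_map inj_on_def)
  then have "dindex A (A ! i) = enc_nat i" using i by (intro dindex_nth) (simp_all add: A_eq m_def)
  then show ?thesis using i by (simp add: A_eq m_def)
qed

lemma iv_nth [simp]: "i < m \<Longrightarrow> iv (av ! i) = i"
  by (simp add: iv_def dindex_av)

lemma iv_av:
  assumes "v \<in> set av"
  shows "iv v < m" "av ! iv v = v" "dindex A (enc_nat v) = enc_nat (iv v)"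
proof -
  obtain i where "i < m" "v = av ! i" using assms by (auto simp: in_set_conv_nth m_def)
  then show "iv v < m" "av ! iv v = v" "dindex A (enc_nat v) = enc_nat (iv v)"
    by (simp_all add: dindex_av)
qed

lemma members:
  assumes "j < length B"
  obtains w us where "tuple_at w us" "B ! j = gadget w us" "members j = us" "dlist (dsnd (B ! j)) = map enc_nat us"
proof -
  obtain w us where "tuple_at w us" "B ! j = gadget w us"
    using gadget_in_B[of "B ! j"] assms by auto
  then show ?thesis using that by (simp add: members_def gadget_def comp_def)
qed

lemma members_av: "j < length B \<Longrightarrow> set (members j) \<subseteq> set av"
  using members tuple_at_subset by metis

lemma kernel_edges_eq: "kernel_edges E A B = map enc_edge es'"
proof -
  have "concat (map (\<lambda>e. if dfst e \<in> set A \<and> dsnd e \<in> set A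
       then [Pair (dindex A (dfst e)) (dindex A (dsnd e))] else []) (map enc_edge es0)) =
    map enc_edge (map (\<lambda>(u, v). (iv u, iv v)) (filter (\<lambda>(u, v). u \<in> set av \<and> v \<in> set av) es0))" for es0
  proof (induction es0)
    case (Cons e es0)
    obtain u v where e: "e = (u, v)" by force
    have "enc_nat x \<in> set A \<longleftrightarrow> x \<in> set av" for x unfolding A_eq by auto
    then show ?case using Cons iv_av(3) by (simp add: e enc_edge_def)
  qed simp
  moreover have "concat (map (\<lambda>p. map (\<lambda>v. Pair (encl (dlist (enc_nat (length A)) @ dlist (dfst p))) (dindex A v))
       (dlist (dsnd (dsnd p)))) (denum B)) =
    map enc_edge (concat (map (\<lambda>j. map (\<lambda>v. (m + j, iv v)) (members j)) [0..<length B]))"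
  proof -
    have denum: "denum B = map (\<lambda>j. Pair (enc_nat j) (B ! j)) [0..<length B]"
      by (rule nth_equalityI) auto
    have "map (\<lambda>v. Pair (encl (dlist (enc_nat (length A)) @ dlist (enc_nat j))) (dindex A v)) (dlist (dsnd (B ! j)))
      = map enc_edge (map (\<lambda>v. (m + j, iv v)) (members j))" if j: "j < length B" for j
    proof -
      obtain w us where us: "members j = us" "dlist (dsnd (B ! j)) = map enc_nat us" "tuple_at w us"
        using members[OF j] by metis
      then show ?thesis
        using iv_av(3) tuple_at_subset[OF us(3)]
        by (auto simp: enc_edge_def dlist_enc_nat_add m_def A_eq[THEN arg_cong, of length])
    qed
    then show ?thesis unfolding denum map_map comp_def map_concat
      by (intro arg_cong[where f = concat] map_cong) auto
  qed
  ultimately show ?thesis unfolding kernel_edges_def es'_def E_def by simp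
qed


lemma edges_G':
  "edges G' = {iv ` e |e. e \<in> edges G \<and> e \<subseteq> set av} \<union>
     {{m + j, iv v} |j v. j < length B \<and> v \<in> set (members j)}"
proof -
  have "(\<lambda>(u, v). {u, v}) ` set (map (\<lambda>(u, v). (iv u, iv v)) (filter (\<lambda>(u, v). u \<in> set av \<and> v \<in> set av) es))
      = {iv ` e |e. e \<in> edges G \<and> e \<subseteq> set av}" (is "?L = ?R")
  proof
    show "?L \<subseteq> ?R"
    proof
      fix x assume "x \<in> ?L"
      then obtain u v where "(u, v) \<in> set es" "u \<in> set av" "v \<in> set av" "x = {iv u, iv v}" by auto
      then show "x \<in> ?R" unfolding edges_G by (intro CollectI exI[of _ "{u, v}"]) force
    qed
    show "?R \<subseteq> ?L"
    proof
      fix x assume "x \<in> ?R"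
      then obtain u v where uv: "(u, v) \<in> set es" "u \<in> set av" "v \<in> set av" "x = {iv u, iv v}"
        unfolding edges_G by auto
      then show "x \<in> ?L" by (intro image_eqI[of _ _ "(iv u, iv v)"]) force+
    qed
  qed
  moreover have "(\<lambda>(u, v). {u, v}) ` set (concat (map (\<lambda>j. map (\<lambda>v. (m + j, iv v)) (members j)) [0..<length B]))
      = {{m + j, iv v} |j v. j < length B \<and> v \<in> set (members j)}"
  proof -
    have "set (concat (map (\<lambda>j. map (\<lambda>v. (m + j, iv v)) (members j)) [0..<length B]))
        = {(m + j, iv v) |j v. j < length B \<and> v \<in> set (members j)}"
      by auto
    then show ?thesis by (simp only:) blast
  qed
  ultimately show ?thesis
    unfolding G'_def es'_def by (simp only: graph.simps set_append image_Un)
qed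

text \<open>The encoding admits no repeated edges. Edges inside the cover are images of distinct
  edges under the injective \<open>iv\<close>; an edge of gadget \<open>j\<close> contains
  \<open>m + j\<close>, which occurs in no cover edge and in no edge of another gadget.\<close>

lemma distinct_es':  "distinct (map (\<lambda>(u, v). {u, v}) es')"
proof -
  let ?f = "\<lambda>(u, v). {u, v}"
  let ?P = "\<lambda>(u, v). u \<in> set av \<and> v \<in> set av"
  let ?X = "map ?f (map (\<lambda>(u, v). (iv u, iv v)) (filter ?P es))"
  let ?Y = "\<lambda>k. map ?f (concat (map (\<lambda>j. map (\<lambda>v. (m + j, iv v)) (members j)) [0..<k]))"
  have X: "?X = map ((`) iv) (map ?f (filter ?P es))"
    by auto
  have "inj_on iv (set av)" using iv_av(2) by (rule inj_on_inverseI)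
  then have "inj_on ((`) iv) (Pow (set av))" by (rule inj_on_image_Pow)
  moreover have "set (map ?f (filter ?P es)) \<subseteq> Pow (set av)" by auto
  ultimately have dX: "distinct ?X"
    unfolding X distinct_map[of "(`) iv"] using distinct_map_filter[OF distinct_es]
    by (blast intro: inj_on_subset)
  have sX: "e \<subseteq> {..<m}" if "e \<in> set ?X" for e using that iv_av(1) by auto
  have sY: "\<exists>j<k. m + j \<in> e" if "e \<in> set (?Y k)" for e k using that by auto
  have eY: "e \<subseteq> {..<m + k}" if e: "e \<in> set (?Y k)" and k: "k \<le> length B" for e k
  proof -
    obtain j v where "j < k" "v \<in> set (members j)" "e = {m + j, iv v}" using e by auto
    then show ?thesis using k members_av[of j] iv_av(1)[of v] by auto
  qed
  have "distinct (?Y k)" if "k \<le> length B" for k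
    using that
  proof (induction k)
    case (Suc k)
    obtain w us where us: "tuple_at w us" "members k = us" using members[of k] Suc.prems by (metis Suc_le_eq)
    have "inj_on (\<lambda>v. {m + k, iv v}) (set us)"
    proof (rule inj_onI)
      fix u v assume uv: "u \<in> set us" "v \<in> set us" "{m + k, iv u} = {m + k, iv v}"
      then have "u \<in> set av" "v \<in> set av" using tuple_at_subset[OF us(1)] by auto
      moreover have "iv u = iv v"
        using uv(3) iv_av(1)[OF calculation(1)] iv_av(1)[OF calculation(2)] by (simp add: doubleton_eq_iff)
      ultimately show "u = v" by (metis iv_av(2))
    qed
    then have "distinct (map (\<lambda>v. {m + k, iv v}) (members k))"
      using us by (simp add: distinct_map tuple_at_def)
    moreover have "set (?Y k) \<inter> set (map (\<lambda>v. {m + k, iv v}) (members k)) = {}"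
      using eY[of _ k] Suc.prems by fastforce
    moreover have "?Y (Suc k) = ?Y k @ map (\<lambda>v. {m + k, iv v}) (members k)"
      by (simp add: comp_def)
    ultimately show ?case using Suc by (simp only: distinct_append)
  qed simp
  then have "distinct (?Y (length B))" by simp
  moreover have "set ?X \<inter> set (?Y (length B)) = {}"
  proof (intro equals0I)
    fix e assume "e \<in> set ?X \<inter> set (?Y (length B))"
    then obtain j where "e \<subseteq> {..<m}" "m + j \<in> e" using sX sY[of e "length B"] by blast
    then show False by auto
  qed
  ultimately show ?thesis using dX unfolding es'_def map_append distinct_append by blast
qed

lemma adj_G'_cover:
  assumes "i < m" "k < m"
  shows "adj G' i k \<longleftrightarrow> adj G (av ! i) (av ! k)"
proof
  assume "adj G' i k"
  then have "{i, k} \<in> edges G'" by (simp add: adj_def)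
  moreover have "{i, k} \<noteq> {m + j, iv v}" for j v using assms by (auto simp: doubleton_eq_iff)
  ultimately obtain e where e: "e \<in> edges G" "e \<subseteq> set av" "iv ` e = {i, k}"
    unfolding edges_G' by auto
  have "(!) av ` iv ` e = (\<lambda>v. v) ` e"
    unfolding image_image by (rule image_cong) (use e(2) iv_av(2) in auto)
  then have "e = {av ! i, av ! k}" unfolding e(3) by simp
  then show "adj G (av ! i) (av ! k)" using e(1) by (simp add: adj_def)
next
  assume "adj G (av ! i) (av ! k)"
  then have "{av ! i, av ! k} \<in> edges G" by (simp add: adj_def)
  moreover have "{av ! i, av ! k} \<subseteq> set av" using assms by (simp add: m_def)
  moreover have "iv ` {av ! i, av ! k} = {i, k}" using assms by simp
  ultimately show "adj G' i k" unfolding adj_def edges_G' by blast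
qed

lemma adj_G'_gadget:
  assumes "j < length B"
  shows "adj G' (m + j) x \<longleftrightarrow> x < m \<and> av ! x \<in> set (members j)"
proof
  assume "adj G' (m + j) x"
  then have "{m + j, x} \<in> edges G'" by (simp add: adj_def)
  moreover have "{m + j, x} \<noteq> iv ` e" if e: "e \<subseteq> set av" for e
  proof
    assume "{m + j, x} = iv ` e"
    then have "m + j \<in> iv ` e" by blast
    then obtain v where "v \<in> set av" "m + j = iv v" using e by blast
    then show False using iv_av(1)[of v] by simp
  qed
  ultimately obtain j' v where jv: "j' < length B" "v \<in> set (members j')" "{m + j, x} = {m + j', iv v}"
    unfolding edges_G' by auto
  have "v \<in> set av" using members_av[OF jv(1)] jv(2) by blast
  then show "x < m \<and> av ! x \<in> set (members j)"
    using jv iv_av[of v] by (auto simp: doubleton_eq_iff)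
next
  assume "x < m \<and> av ! x \<in> set (members j)"
  then have "{m + j, x} = {m + j, iv (av ! x)}" "av ! x \<in> set (members j)" by simp_all
  then show "adj G' (m + j) x" unfolding adj_def edges_G' using assms by blast
qed

lemma wf_G': "wf_graph G'"
proof -
  have "\<exists>u\<in>{..<m + length B}. \<exists>v\<in>{..<m + length B}. e = {u, v}" if e: "e \<in> edges G'" for e
  proof -
    from e consider e' where "e' \<in> edges G" "e' \<subseteq> set av" "e = iv ` e'"
      | j v where "j < length B" "v \<in> set (members j)" "e = {m + j, iv v}"
      unfolding edges_G' by blast
    then show ?thesis
    proof cases
      case 1
      then obtain u v where "e' = {u, v}" using wf_G unfolding wf_graph_def by blast
      then have "e = {iv u, iv v}" "iv u < m" "iv v < m" using 1 iv_av(1) by auto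
      then show ?thesis by (intro bexI[of _ "iv u"] bexI[of _ "iv v"]) auto
    next
      case 2
      then have "iv v < m" using members_av iv_av(1) by blast
      then show ?thesis using 2 by (intro bexI[of _ "m + j"] bexI[of _ "iv v"]) auto
    qed
  qed
  then show ?thesis by (simp add: wf_graph_def G'_def)
qed

text \<open>This makes \<open>list_colorable_cover\<close> applicable to the output too, so both
  instances are compared through colorings of the same cover.\<close>

lemma cover_G': "vertex_cover G' {..<m}"
proof -
  have "e \<inter> {..<m} \<noteq> {}" if e: "e \<in> edges G'" for e
  proof -
    from e consider e' where "e' \<in> edges G" "e' \<subseteq> set av" "e = iv ` e'"
      | j v where "j < length B" "v \<in> set (members j)" "e = {m + j, iv v}"
      unfolding edges_G' by blast
    then show ?thesis
    proof cases
      case 1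
      then obtain u v where "e' = {u, v}" using wf_G unfolding wf_graph_def by blast
      then show ?thesis using 1 iv_av(1) by auto
    next
      case 2
      then have "iv v < m" using members_av iv_av(1) by blast
      then show ?thesis using 2 by auto
    qed
  qed
  then show ?thesis by (auto simp: vertex_cover_def G'_def)
qed

lemma instance_G': "list_instance H G' \<L>'"
  using wf_G' colors_subset[of H num] by (simp add: list_instance_def \<L>'_def)

lemma length_ls' [simp]: "length ls' = m + length B"
  by (simp add: ls'_def A_eq m_def)

lemma ls'_nth_cover: "i < m \<Longrightarrow> ls' ! i = ls ! (av ! i)"
  using set_av by (auto simp: ls'_def A_eq m_def nth_append subset_iff)

lemma ls'_nth_gadget: "j < length B \<Longrightarrow> ls' ! (m + j) = dfst (B ! j)"
  by (simp add: ls'_def A_eq m_def nth_append)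

lemma ls'_color_lists:
  assumes "i < m + length B"
  shows "ls' ! i \<in> color_lists H num"
proof (cases "i < m")
  case True
  then have "av ! i < n" using set_av by (auto simp: m_def subset_iff)
  then show ?thesis using True reduced(1) by (simp add: ls'_nth_cover)
next
  case False
  define j where "j = i - m"
  have j: "j < length B" "i = m + j" using assms False by (auto simp: j_def)
  then obtain w us where "tuple_at w us" "B ! j = gadget w us" using members by metis
  then show ?thesis using j reduced(1) by (simp add: ls'_nth_gadget gadget_def tuple_at_def)
qed

text \<open>The colorings need to agree only on the cover, because \<open>cover_coloring\<close>
  reads no other values: vertices outside have all their neighbors inside.\<close>

lemma cover_coloring_G':
  assumes "\<And>i. i < m \<Longrightarrow> \<psi> i = \<phi> (av ! i)"
  shows "cover_coloring H G' \<L>' {..<m} \<psi> \<longleftrightarrow> cover_coloring H G C (set av) \<phi>"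
proof -
  have av: "(\<forall>v\<in>set av. P v) \<longleftrightarrow> (\<forall>i<m. P (av ! i))" for P
    unfolding all_set_conv_all_nth m_def ..
  have "(\<forall>v\<in>{..<m}. \<psi> v \<in> \<L>' v) \<longleftrightarrow> (\<forall>v\<in>set av. \<phi> v \<in> C v)"
    unfolding av using assms by (auto simp: \<L>'_def C_def ls'_nth_cover)
  moreover have "(\<forall>u\<in>{..<m}. \<forall>v\<in>{..<m}. adj G' u v \<longrightarrow> adj H (\<psi> u) (\<psi> v)) \<longleftrightarrow>
      (\<forall>u\<in>set av. \<forall>v\<in>set av. adj G u v \<longrightarrow> adj H (\<phi> u) (\<phi> v))"
    unfolding av using assms by (auto simp: adj_G'_cover)
  moreover have "(\<forall>w\<in>verts G' - {..<m}. has_common_nbr H (\<L>' w) (\<psi> ` {u. adj G' w u})) \<longleftrightarrow>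
      (\<forall>g\<in>set B. gadget_ok \<phi> g)"
  proof -
    have "has_common_nbr H (\<L>' (m + j)) (\<psi> ` {u. adj G' (m + j) u}) \<longleftrightarrow> gadget_ok \<phi> (B ! j)"
      if j: "j < length B" for j
    proof -
      have "\<psi> ` {u. adj G' (m + j) u} = (\<lambda>i. \<phi> (av ! i)) ` {i. i < m \<and> av ! i \<in> set (members j)}"
        using assms by (intro image_cong) (auto simp: adj_G'_gadget[OF j])
      also have "\<dots> = \<phi> ` set (members j)"
        using members_av[OF j] by (fastforce simp: m_def in_set_conv_nth subset_iff image_iff)
      finally show ?thesis
        by (simp add: gadget_ok_def \<L>'_def ls'_nth_gadget[OF j] members_def image_image)
    qed
    moreover have "verts G' - {..<m} = (\<lambda>j. m + j) ` {..<length B}"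
    proof -
      have "{..<m + length B} - {..<m} = {m..<m + length B}" by auto
      then show ?thesis using image_add_atLeastLessThan[of m 0 "length B"]
        by (simp add: G'_def atLeast0LessThan add.commute)
    qed
    ultimately show ?thesis by (auto simp: all_set_conv_all_nth)
  qed
  ultimately show ?thesis
    unfolding cover_coloring_iff coloring_av_def unfolding cover_coloring_def by simp
qed

lemma colorable_G': "list_colorable H G' \<L>' \<longleftrightarrow> list_colorable H G \<L>"
proof -
  have "(\<exists>\<psi>. cover_coloring H G' \<L>' {..<m} \<psi>) \<longleftrightarrow> (\<exists>\<phi>. cover_coloring H G C (set av) \<phi>)"
  proof
    assume "\<exists>\<psi>. cover_coloring H G' \<L>' {..<m} \<psi>"
    then obtain \<psi> where "cover_coloring H G' \<L>' {..<m} \<psi>" ..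
    then have "cover_coloring H G C (set av) (\<lambda>v. \<psi> (iv v))"
      by (subst (asm) cover_coloring_G'[where \<phi> = "\<lambda>v. \<psi> (iv v)"]) simp_all
    then show "\<exists>\<phi>. cover_coloring H G C (set av) \<phi>" by blast
  next
    assume "\<exists>\<phi>. cover_coloring H G C (set av) \<phi>"
    then obtain \<phi> where "cover_coloring H G C (set av) \<phi>" ..
    then have "cover_coloring H G' \<L>' {..<m} (\<lambda>i. \<phi> (av ! i))"
      by (subst cover_coloring_G'[where \<phi> = \<phi>]) simp_all
    then show "\<exists>\<psi>. cover_coloring H G' \<L>' {..<m} \<psi>" by blast
  qed
  then show ?thesis
    using list_colorable_cover[OF instance_G' cover_G'] list_colorable_cover[OF instance_reduced cover_av]
      colorable_reduced by simp
qed

lemma encodes_G':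
  "encodes num (kernelize red tab (c_star H) (map (enc_list enc_nat) ls0) (map enc_edge es)) G' \<L>'"
proof -
  let ?nl = "map (\<lambda>A. map nat_of (dlist A)) ls'"
  have "map (enc_list enc_nat) ?nl = ls'"
  proof (rule nth_equalityI)
    fix i assume "i < length (map (enc_list enc_nat) ?nl)"
    then have "i < m + length B" by simp
    then show "map (enc_list enc_nat) ?nl ! i = ls' ! i"
      using color_list_decode(1)[OF ls'_color_lists inj] by simp
  qed simp
  then have "encl ls' = enc_list (enc_list enc_nat) ?nl"
    by (simp only: enc_list_eq_encl[of "enc_list enc_nat"])
  moreover have "encl (kernel_edges E A B) = enc_list enc_edge es'"
    by (simp only: kernel_edges_eq enc_list_eq_encl[of enc_edge])
  moreover have "kernelize red tab (c_star H) (map (enc_list enc_nat) ls0) (map enc_edge es) =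
      Pair (encl ls') (encl (kernel_edges E A B))"
    by (simp add: kernelize_def Let_def ls'_def ls_def A_def B_def R_def E_def)
  moreover have "\<forall>v<length ?nl. distinct (?nl ! v) \<and> set (?nl ! v) = num ` \<L>' v"
    using color_list_decode(2,3)[OF ls'_color_lists inj] by (simp add: \<L>'_def)
  ultimately show ?thesis
    unfolding encodes_def using distinct_es'
    by (intro exI[of _ ?nl] exI[of _ es']) (simp add: G'_def)
qed

text \<open>Pairs of cover vertices account for at most \<open>k^2\<close> edges. Each gadget costs
  one vertex and at most \<open>c_star H\<close> edges, whence the factor
  \<open>c_star H + 1\<close>.\<close>

lemma size_G':
  defines "k \<equiv> 2 * vc_number G"
  shows "card (verts G') + card (edges G') \<le>
    k + k ^ 2 + (c_star H + 1) * ((d + 1) * (k * card (verts H) + 1) ^ d)"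
proof -
  let ?b = "length B" and ?bound = "(d + 1) * (k * card (verts H) + 1) ^ d"
  have m: "m \<le> k" using length_av by (simp add: m_def k_def)
  have "?b \<le> (d + 1) * (length av * card (verts H) + 1) ^ d" by (rule length_B)
  also have "\<dots> \<le> ?bound"
    using m by (intro mult_le_mono2 power_mono add_right_mono mult_le_mono1) (simp_all add: m_def)
  finally have b: "?b \<le> ?bound" .
  let ?E1 = "(\<lambda>(i, k). {i, k}) ` ({..<m} \<times> {..<m})" and ?E2 = "\<lambda>j. (\<lambda>v. {m + j, iv v}) ` set (members j)"
  have "{iv ` e |e. e \<in> edges G \<and> e \<subseteq> set av} \<subseteq> ?E1"
  proof
    fix x assume "x \<in> {iv ` e |e. e \<in> edges G \<and> e \<subseteq> set av}"
    then obtain u v where "x = {iv u, iv v}" "u \<in> set av" "v \<in> set av" unfolding edges_G by auto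
    then show "x \<in> ?E1" using iv_av(1) by (intro image_eqI[of _ _ "(iv u, iv v)"]) auto
  qed
  then have "edges G' \<subseteq> ?E1 \<union> (\<Union>j<?b. ?E2 j)"
    unfolding edges_G' by blast
  then have "card (edges G') \<le> card (?E1 \<union> (\<Union>j<?b. ?E2 j))" by (intro card_mono) auto
  also have "\<dots> \<le> card ?E1 + card (\<Union>j<?b. ?E2 j)" by (rule card_Un_le)
  also have "card ?E1 \<le> m ^ 2"
    using card_image_le[of "{..<m} \<times> {..<m}" "\<lambda>(i, k). {i, k}"] by (simp add: power2_eq_square)
  also have "card (\<Union>j<?b. ?E2 j) \<le> (\<Sum>j<?b. card (?E2 j))" by (rule card_UN_le) simp
  also have "\<dots> \<le> (\<Sum>j<?b. c_star H)"
  proof (rule sum_mono)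
    fix j assume "j \<in> {..<?b}"
    then obtain w us where us: "tuple_at w us" "members j = us" using members[of j] by (metis lessThan_iff)
    have "card (?E2 j) \<le> card (set (members j))" by (rule card_image_le) simp
    also have "\<dots> \<le> length (members j)" by (rule card_length)
    also have "\<dots> \<le> c_star H" using us by (simp add: tuple_at_def)
    finally show "card (?E2 j) \<le> c_star H" .
  qed
  finally have "card (edges G') \<le> m ^ 2 + ?b * c_star H" by simp
  moreover have "card (verts G') = m + ?b" by (simp add: G'_def)
  ultimately have "card (verts G') + card (edges G') \<le> m + m ^ 2 + (c_star H + 1) * ?b"
    by (simp add: algebra_simps)
  also have "\<dots> \<le> k + k ^ 2 + (c_star H + 1) * ?bound"
    using m b by (intro add_mono mult_le_mono2 power_mono) auto
  finally show ?thesis .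
qed

end

text \<open>For \<open>k \<ge> 1\<close> the lower-order terms are absorbed:
  \<open>2 * k * h + 1 \<le> (2 * h + 1) * k\<close> and
  \<open>2 * k + (2 * k) ^ 2 \<le> 6 * k ^ 2\<close>. The sum of the two resulting coefficients is
  the constant.\<close>

lemma kernel_size_bigo:
  "(\<lambda>k::nat. real (2 * k + (2 * k) ^ 2 + (c + 1) * ((d + 1) * (2 * k * h + 1) ^ d)))
     \<in> O(\<lambda>k. real k ^ d + real k ^ 2)"
proof (rule bigoI)
  let ?K = "real (6 + (c + 1) * ((d + 1) * (2 * h + 1) ^ d))"
  show "\<forall>\<^sub>F k in at_top. norm (real (2 * k + (2 * k) ^ 2 + (c + 1) * ((d + 1) * (2 * k * h + 1) ^ d)))
      \<le> ?K * norm (real k ^ d + real k ^ 2)"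
    using eventually_ge_at_top[of 1]
  proof eventually_elim
    case (elim k)
    let ?e = "(c + 1) * ((d + 1) * (2 * h + 1) ^ d)"
    have "(2 * k * h + 1) ^ d \<le> ((2 * h + 1) * k) ^ d"
      using elim by (intro power_mono) (simp_all add: algebra_simps)
    also have "\<dots> = (2 * h + 1) ^ d * k ^ d" by (rule power_mult_distrib)
    finally have "(c + 1) * ((d + 1) * (2 * k * h + 1) ^ d) \<le> (c + 1) * ((d + 1) * ((2 * h + 1) ^ d * k ^ d))"
      by (intro mult_le_mono2)
    also have "\<dots> = ?e * k ^ d" by (simp only: mult.assoc)
    also have "2 * k + (2 * k) ^ 2 \<le> 6 * k ^ 2"
      using elim by (simp add: power2_eq_square)
    ultimately have "2 * k + (2 * k) ^ 2 + (c + 1) * ((d + 1) * (2 * k * h + 1) ^ d) \<le> 6 * k ^ 2 + ?e * k ^ d"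
      by linarith
    also have "\<dots> \<le> (6 + ?e) * k ^ 2 + (6 + ?e) * k ^ d"
      by (intro add_mono mult_le_mono1) auto
    also have "\<dots> = (6 + ?e) * (k ^ d + k ^ 2)"
      by (simp only: add_mult_distrib2 add.commute)
    finally have "real (2 * k + (2 * k) ^ 2 + (c + 1) * ((d + 1) * (2 * k * h + 1) ^ d))
        \<le> real ((6 + ?e) * (k ^ d + k ^ 2))"
      by (rule of_nat_mono)
    then show ?case by simp
  qed
qed

theorem theorem24:
  fixes H :: "'h graph" and d :: nat
  assumes "wf_graph H" and "d \<ge> 1"
    and "\<And>Ls L S. length Ls \<le> c_star H \<Longrightarrow>
           (\<forall>A\<in>set Ls. A \<subseteq> verts H \<and> incomparable_set H A) \<Longrightarrow>
           L \<subseteq> verts H \<Longrightarrow>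
           S \<in> listset Ls \<Longrightarrow>
           \<not> has_common_nbr H L (set S) \<Longrightarrow>
           can_be_forbidden H d (listset Ls) L S"
  shows "\<exists>f. list_coloring_vc_kernel H f \<and>
             (\<lambda>k. real (f k)) \<in> O(\<lambda>k. real k ^ d + real k ^ 2)"
proof (intro exI conjI)
  \<comment> \<open>The bound of \<open>size_G'\<close> with the cover size replaced by
    \<open>2 * k\<close>. It must not depend on \<open>num\<close>, which is quantified after
    it.\<close>
  let ?f = "\<lambda>k. 2 * k + (2 * k) ^ 2 + (c_star H + 1) * ((d + 1) * (2 * k * card (verts H) + 1) ^ d)"
  show "(\<lambda>k. real (?f k)) \<in> O(\<lambda>k. real k ^ d + real k ^ 2)"
    by (rule kernel_size_bigo)
  show "list_coloring_vc_kernel H ?f"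
    unfolding list_coloring_vc_kernel_def
  proof (intro allI impI)
    fix num :: "'h \<Rightarrow> nat"
    assume inj: "inj_on num (verts H)"
    \<comment> \<open>Both tables are fixed before any input is considered, so a single program and
      a single polynomial serve all instances.\<close>
    obtain red where red: "ptime red" "\<And>A. A \<in> color_lists H num \<Longrightarrow> reduced_list H num A (red A)"
      using ex_list_reduction[OF assms(1) inj] by blast
    obtain tab where tab: "ptime tab"
      "\<And>A Ls ts. A \<in> color_lists H num \<Longrightarrow> set Ls \<subseteq> color_lists H num \<Longrightarrow>
        (\<forall>B\<in>set Ls. incomparable_set H (colors H num B)) \<Longrightarrow> length Ls \<le> c_star H \<Longrightarrow>
        length ts = length Ls \<Longrightarrow>
        expresses_common_nbr H num d A Ls ts (dlist (tab (Pair (Pair A (encl Ls)) (encl ts))))"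
      using ex_vector_table[OF assms(1) inj assms(3)] by blast
    let ?F = "\<lambda>x. kernelize red tab (c_star H) (dlist (dfst x)) (dlist (dsnd x))"
    obtain p q where pq: "\<And>x. computes_within p (poly q (dsize x)) x (?F x)"
      using ptime_computes[OF ptime_kernelize[OF red(1) tab(1)]] by blast
    have "\<exists>z G' \<L>'. computes_within p (poly q (dsize x)) x z \<and>
        list_instance H G' \<L>' \<and> encodes num z G' \<L>' \<and>
        (list_colorable H G' \<L>' \<longleftrightarrow> list_colorable H G \<L>) \<and>
        card (verts G') + card (edges G') \<le> ?f (vc_number G)"
      if inst: "list_instance H G \<L>" and enc: "encodes num x G \<L>" for x and G :: "nat graph" and \<L>
    proof -
      obtain ls0 es where "x = Pair (enc_list (enc_list enc_nat) ls0) (enc_list enc_edge es) \<and>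
          verts G = {..<length ls0} \<and>
          (\<forall>v<length ls0. distinct (ls0 ! v) \<and> set (ls0 ! v) = num ` \<L> v) \<and>
          distinct (map (\<lambda>(u, v). {u, v}) es) \<and> edges G = (\<lambda>(u, v). {u, v}) ` set es"
        using enc unfolding encodes_def by (elim exE)
      then have x: "x = Pair (enc_list (enc_list enc_nat) ls0) (enc_list enc_edge es)"
        and G: "verts G = {..<length ls0}"
          "\<And>v. v < length ls0 \<Longrightarrow> distinct (ls0 ! v) \<and> set (ls0 ! v) = num ` \<L> v"
          "distinct (map (\<lambda>(u, v). {u, v}) es)" "edges G = (\<lambda>(u, v). {u, v}) ` set es"
        by simp_all
      interpret kernel_instance H num d red tab G \<L> ls0 es
        using assms(1) inj red(2) tab(2) inst G by unfold_locales
      have "?F x = kernelize red tab (c_star H) (map (enc_list enc_nat) ls0) (map enc_edge es)"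
        by (simp add: x)
      then have "computes_within p (poly q (dsize x)) x
          (kernelize red tab (c_star H) (map (enc_list enc_nat) ls0) (map enc_edge es))"
        using pq[of x] by simp
      then show ?thesis
        by (intro exI conjI) (rule instance_G' encodes_G' colorable_G' size_G' | assumption)+
    qed
    then show "\<exists>p (q :: nat poly). \<forall>x G \<L>. list_instance H G \<L> \<and> encodes num x G \<L> \<longrightarrow>
        (\<exists>z G' \<L>'. computes_within p (poly q (dsize x)) x z \<and>
          list_instance H G' \<L>' \<and> encodes num z G' \<L>' \<and>
          (list_colorable H G' \<L>' \<longleftrightarrow> list_colorable H G \<L>) \<and>
          card (verts G') + card (edges G') \<le> ?f (vc_number G))"
      by blast
  qed
qed

end
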